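(* Let $E$ be the cuspidal Weierstrass curve over $\mathbb C$, let $0<d<n$ be coprime integers and $e=n-d$. Then the solutions $r_{(E,(n,d))}$ and $r_{(E,(n,e))}$ of the classical Yang--Baxter equation for $\mathfrak g=\mathfrak{sl}_n(\mathbb C)$ are gauge equivalent.
   Context: **The solution $r_{(E,(n,d))}$.** $E=V(wv^2-u^3)\subset\mathbb P^2_{\mathbb C}$. Let $\mathcal P$ be a simple vector bundle ($\mathrm{End}(\mathcal P)=\mathbb C$) of rank $n$ and degree $d$ on $E$, and $\mathcal A=\mathrm{Ad}(\mathcal P)$ the sheaf of Lie algebras of its traceless endomorphisms (up to isomorphism depending only on $(n,d)$). Let $\pi:\mathbb P^1\to E$ be the normalization with homogeneous coordinates $(z_0:z_1)$ such that $\pi(0:1)$ is the singular point; the regular part of $E$ is identified with $\mathbb C$ via $x\mapsto\pi(1:x)$, and the regular differential form used is $dz$, $z=z_1/z_0$. For $x\neq y\in\mathbb C$, $\mathrm{res}_x:H^0(\mathcal A(x))\to\mathcal A|_x$ is the residue at $x$ of $s\,dz$ (an isomorphism) and $\mathrm{ev}_y:H^0(\mathcal A(x))\to\mathcal A|_y$ is evaluation. After a trivialization of $\mathcal A$ as a sheaf of Lie algebras near $0$, $\mathrm{ev}_y\circ\mathrm{res}_x^{-1}$ lies in $\mathrm{End}(\mathfrak g)$, and $r_{(E,(n,d))}(x,y)$ is the corresponding tensor under $\mathfrak g\otimes\mathfrak g\to\mathrm{End}(\mathfrak g)$, $a\otimes b\mapsto(c\mapsto\mathrm{tr}(ac)b)$;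 it is well defined up to gauge equivalence. **Explicit form.** A representative is as follows. Put $J_{(1,1)}=\begin{pmatrix}0&1\\0&0\end{pmatrix}$ and, if $J_{(a,b)}=\begin{pmatrix}A_1&A_2\\0&A_3\end{pmatrix}$ with $A_1$ of size $a\times a$, $A_3$ of size $b\times b$, $$J_{(a,a+b)}=\begin{pmatrix}0&\mathbb 1&0\\0&A_1&A_2\\0&0&A_3\end{pmatrix},\quad J_{(a+b,b)}=\begin{pmatrix}A_1&A_2&0\\0&A_3&\mathbb 1\\0&0&0\end{pmatrix};$$ this determines $J=J_{(e,d)}$. In blocks of sizes $e,d$ let $V_{e,d}=\Bigl\{F=\begin{pmatrix}W&X\\ Y&Z\end{pmatrix}+\begin{pmatrix}W'&0\\ Y'&Z'\end{pmatrix}z+\begin{pmatrix}0&0\\ Y''&0\end{pmatrix}z^2\Bigr\}\subset\mathfrak g[z]$, $F_0=\begin{pmatrix}W'&X\\ Y''&Z'\end{pmatrix}$, $F_\epsilon=\begin{pmatrix}W&0\\ Y'&Z\end{pmatrix}$, and $\mathrm{Sol}((e,d),x)=\{F\in V_{e,d}:[F_0,J]+xF_0+F_\epsilon=0\}$. Then $F\mapsto F(x)$ is an isomorphism $\mathrm{Sol}((e,d),x)\to\mathfrak g$, and $r_{(E,(n,d))}(x,y)$ corresponds to the endomorphism $F(x)\mapsto\frac1{y-x}F(y)$ of $\mathfrak g$. **Gauge equivalence.** $r$ and $\tilde r$ are gauge equivalent if $\tilde r(x,y)=(\phi(x)\otimes\phi(y))r(x,y)$ for a holomorphic germ $\phi:(\mathbb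 C,0)\to\mathrm{Aut}(\mathfrak g)$. *)

theory Defs
  imports "HOL-Complex_Analysis.Complex_Analysis" "Jordan_Normal_Form.Determinant"
begin

hide_const (open) Finite_Cartesian_Product.mat Finite_Cartesian_Product.vec
  Determinants.det Determinants.trace
hide_type (open) Finite_Cartesian_Product.vec

text \<open>
  The cuspidal curve \<open>E = V(w v\<^sup>2 - u\<^sup>3)\<close> has the normalization
  \<open>\<pi>(z\<^sub>0 : z\<^sub>1) = (z\<^sub>0\<^sup>2 z\<^sub>1 : z\<^sub>0\<^sup>3 : z\<^sub>1\<^sup>3)\<close>, with cusp \<open>s = \<pi>(0 : 1)\<close>.  Its function field is
  \<open>\<complex>(z)\<close> with \<open>z = z\<^sub>1 / z\<^sub>0\<close>, and \<open>t = 1 / z\<close> is the local parameter of the normalization at \<open>s\<close>.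
  The curve is covered by
  \<^item> the regular part \<open>E - {s}\<close>, with coordinate ring \<open>\<complex>[z]\<close>, and
  \<^item> \<open>Spec O\<close>, where \<open>O\<close> is the local ring of \<open>E\<close> at \<open>s\<close>; since \<open>u/w = t\<^sup>2\<close> and \<open>v/w = t\<^sup>3\<close>, it is the
    localization of \<open>\<complex>[t\<^sup>2, t\<^sup>3] = {P \<in> \<complex>[t]. P has no linear term}\<close> at the origin;

  the two pieces overlap in the generic point \<open>Spec \<complex>(z)\<close>.
\<close>

type_synonym ratfun = "complex poly fract"

definition const_fun :: "complex \<Rightarrow> ratfun" where
  "const_fun c = to_fract [:c:]"

definition z_fun :: ratfun where
  "z_fun = to_fract [:0, 1:]"

definition regular_ring :: "ratfun set" where
  "regular_ring = range to_fract"

definition poly_in_t :: "complex poly \<Rightarrow> ratfun" where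
  "poly_in_t P = (\<Sum>i\<le>degree P. const_fun (poly.coeff P i) * inverse z_fun ^ i)"

definition cusp_ring :: "ratfun set" where
  "cusp_ring = {poly_in_t P / poly_in_t Q |P Q.
     poly.coeff P 1 = 0 \<and> poly.coeff Q 1 = 0 \<and> poly.coeff Q 0 \<noteq> 0}"

definition mat_over :: "nat \<Rightarrow> 'a set \<Rightarrow> 'a mat set" where
  "mat_over n R = {A \<in> carrier_mat n n. \<forall>i<n. \<forall>j<n. A $$ (i, j) \<in> R}"

definition mtrace :: "'a :: comm_monoid_add mat \<Rightarrow> 'a" where
  "mtrace A = (\<Sum>i<dim_row A. A $$ (i, i))"

text \<open>
  Vector bundles on each of the two pieces are free (\<open>\<complex>[z]\<close> is a principal ideal domain, \<open>O\<close> is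
  local), so a vector bundle of rank \<open>n\<close> on \<open>E\<close> is given by a transition matrix
  \<open>g \<in> GL\<^sub>n(\<complex>(z))\<close>: with the frame over \<open>E - {s}\<close> fixed, the bundle is the subsheaf of the constant
  sheaf \<open>\<complex>(z)\<^sup>n\<close> whose sections over \<open>E - {s}\<close> are \<open>\<complex>[z]\<^sup>n\<close> and whose stalk at \<open>s\<close> is \<open>g O\<^sup>n\<close>.
\<close>

definition vector_bundle :: "nat \<Rightarrow> ratfun mat \<Rightarrow> bool" where
  "vector_bundle n g \<longleftrightarrow> g \<in> carrier_mat n n \<and> det g \<noteq> 0"

text \<open>
  The determinant line bundle has stalk \<open>det g \<cdot> O\<close> at \<open>s\<close> and is trivial elsewhere; its degree is
  minus the order of vanishing of \<open>det g\<close> in \<open>t\<close>.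
\<close>

definition vb_degree :: "ratfun mat \<Rightarrow> int" where
  "vb_degree g = (THE k. \<exists>p q. p \<noteq> 0 \<and> q \<noteq> 0 \<and> det g = Fraction_Field.Fract p q \<and>
     k = int (degree p) - int (degree q))"

text \<open>Global endomorphisms: regular on \<open>E - {s}\<close>, and mapping the stalk \<open>g O\<^sup>n\<close> at \<open>s\<close> to itself.\<close>

definition End_vb :: "nat \<Rightarrow> ratfun mat \<Rightarrow> ratfun mat set" where
  "End_vb n g = {u \<in> mat_over n regular_ring. \<exists>v \<in> mat_over n cusp_ring. u * g = g * v}"

definition simple_bundle :: "nat \<Rightarrow> int \<Rightarrow> ratfun mat \<Rightarrow> bool" where
  "simple_bundle n k g \<longleftrightarrow> vector_bundle n g \<and> vb_degree g = k \<and>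
     End_vb n g = {const_fun c \<cdot>\<^sub>m 1\<^sub>m n |c. True}"

text \<open>\<open>H\<^sup>0(A(x))\<close> for the sheaf \<open>A = Ad(P)\<close> of traceless endomorphisms and a regular point \<open>x\<close>.\<close>

definition H0_Ad :: "nat \<Rightarrow> ratfun mat \<Rightarrow> complex \<Rightarrow> ratfun mat set" where
  "H0_Ad n g x = {s \<in> carrier_mat n n. mtrace s = 0 \<and>
     (z_fun - const_fun x) \<cdot>\<^sub>m s \<in> mat_over n regular_ring \<and>
     (\<exists>v \<in> mat_over n cusp_ring. s * g = g * v)}"

text \<open>The value at a point which is not a pole (unspecified at the poles).\<close>

definition rat_eval :: "ratfun \<Rightarrow> complex \<Rightarrow> complex" where
  "rat_eval f y = (THE c. \<exists>p q. f = Fraction_Field.Fract p q \<and> poly q y \<noteq> 0 \<and>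
     c = poly p y / poly q y)"

definition res_map :: "complex \<Rightarrow> ratfun mat \<Rightarrow> complex mat" where
  "res_map x s = map_mat (\<lambda>f. residue (rat_eval f) x) s"

definition ev_map :: "complex \<Rightarrow> ratfun mat \<Rightarrow> complex mat" where
  "ev_map y s = map_mat (\<lambda>f. rat_eval f y) s"

definition sl :: "nat \<Rightarrow> complex mat set" where
  "sl n = {A \<in> carrier_mat n n. mtrace A = 0}"

definition lie_aut :: "nat \<Rightarrow> (complex mat \<Rightarrow> complex mat) \<Rightarrow> bool" where
  "lie_aut n f \<longleftrightarrow> bij_betw f (sl n) (sl n) \<and>
     (\<forall>a\<in>sl n. \<forall>b\<in>sl n. f (a + b) = f a + f b) \<and>
     (\<forall>c. \<forall>a\<in>sl n. f (c \<cdot>\<^sub>m a) = c \<cdot>\<^sub>m f a) \<and>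
     (\<forall>a\<in>sl n. \<forall>b\<in>sl n. f (a * b - b * a) = f a * f b - f b * f a)"

text \<open>
  \<open>M\<^sub>n(\<complex>) \<otimes> M\<^sub>n(\<complex>)\<close> is identified with the space of coordinate arrays with respect to the basis
  \<open>E\<^sub>i\<^sub>j \<otimes> E\<^sub>k\<^sub>l\<close> (indices below \<open>n\<close>, extended by \<open>0\<close>).
\<close>

type_synonym tensor2 = "nat \<Rightarrow> nat \<Rightarrow> nat \<Rightarrow> nat \<Rightarrow> complex"

definition tensor_sum :: "nat \<Rightarrow> nat \<Rightarrow> (nat \<Rightarrow> complex mat) \<Rightarrow> (nat \<Rightarrow> complex mat) \<Rightarrow> tensor2" where
  "tensor_sum n m a b = (\<lambda>i j k l. if i < n \<and> j < n \<and> k < n \<and> l < n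
     then (\<Sum>\<mu><m. a \<mu> $$ (i, j) * b \<mu> $$ (k, l)) else 0)"

definition sl_tensor_sl :: "nat \<Rightarrow> tensor2 set" where
  "sl_tensor_sl n = {tensor_sum n m a b |m a b. \<forall>\<mu><m. a \<mu> \<in> sl n \<and> b \<mu> \<in> sl n}"

text \<open>The map \<open>a \<otimes> b \<mapsto> (c \<mapsto> tr(ac) b)\<close>.\<close>

definition tensor_endo :: "nat \<Rightarrow> tensor2 \<Rightarrow> complex mat \<Rightarrow> complex mat" where
  "tensor_endo n R c = Matrix.mat n n (\<lambda>(k, l). \<Sum>i<n. \<Sum>j<n. R i j k l * c $$ (j, i))"

text \<open>
  The frame of the bundle over \<open>E - {s}\<close> trivializes \<open>A\<close> there as \<open>sl\<^sub>n \<otimes> \<complex>[z]\<close>; the following is the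
  solution with respect to this trivialization.
\<close>

definition r_sol :: "nat \<Rightarrow> ratfun mat \<Rightarrow> complex \<Rightarrow> complex \<Rightarrow> tensor2" where
  "r_sol n g x y = (THE R. R \<in> sl_tensor_sl n \<and>
     (\<forall>c\<in>sl n. tensor_endo n R c = ev_map y (inv_into (H0_Ad n g x) (res_map x) c)))"

text \<open>\<open>S = (f \<otimes> h) R\<close> for linear endomorphisms \<open>f\<close> and \<open>h\<close> of \<open>sl\<^sub>n\<close>.\<close>

definition tensor_map ::
  "nat \<Rightarrow> (complex mat \<Rightarrow> complex mat) \<Rightarrow> (complex mat \<Rightarrow> complex mat) \<Rightarrow> tensor2 \<Rightarrow> tensor2 \<Rightarrow> bool"
where
  "tensor_map n f h R S \<longleftrightarrow> (\<exists>m a b. (\<forall>\<mu><m. a \<mu> \<in> sl n \<and> b \<mu> \<in> sl n) \<and>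
     R = tensor_sum n m a b \<and> S = tensor_sum n m (\<lambda>\<mu>. f (a \<mu>)) (\<lambda>\<mu>. h (b \<mu>)))"

definition gauge_equivalent ::
  "nat \<Rightarrow> (complex \<Rightarrow> complex \<Rightarrow> tensor2) \<Rightarrow> (complex \<Rightarrow> complex \<Rightarrow> tensor2) \<Rightarrow> bool"
where
  "gauge_equivalent n r r' \<longleftrightarrow> (\<exists>\<epsilon>>0. \<exists>\<phi> :: complex \<Rightarrow> complex mat \<Rightarrow> complex mat.
     (\<forall>z\<in>ball 0 \<epsilon>. lie_aut n (\<phi> z)) \<and>
     (\<forall>a\<in>sl n. \<forall>i<n. \<forall>j<n. (\<lambda>z. \<phi> z a $$ (i, j)) holomorphic_on ball 0 \<epsilon>) \<and>
     (\<forall>x\<in>ball 0 \<epsilon>. \<forall>y\<in>ball 0 \<epsilon>. x \<noteq> y \<longrightarrow> tensor_map n (\<phi> x) (\<phi> y) (r x y) (r' x y)))"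

text \<open>
  The representatives of \<open>r\<close> attached to \<open>(E, (n, d))\<close>, one for each simple bundle
  of rank \<open>n\<close> and degree \<open>d\<close> with a frame over \<open>E - {s}\<close>.
\<close>

definition r_solutions :: "nat \<Rightarrow> nat \<Rightarrow> (complex \<Rightarrow> complex \<Rightarrow> tensor2) set" where
  "r_solutions n d = {r_sol n P |P. simple_bundle n (int d) P}"

end

theory Submission
  imports Defs "Jordan_Normal_Form.Char_Poly"
begin

text \<open>
  A vector bundle on \<open>E\<close> is a transition matrix \<open>g\<close>, up to \<open>GL\<^sub>n(\<complex>[z])\<close> on the left (change of the frame over
  the regular part) and \<open>GL\<^sub>n(O)\<close> on the right (change of the frame at the cusp). If \<open>s\<close> is a traceless rational
  endomorphism of a bundle \<open>P\<close>, then \<open>- s\<^sup>T\<close> is one of the dual bundle, with the same poles, and tensoring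
  with a line bundle changes no endomorphism. Hence \<open>a \<mapsto> - a\<^sup>T\<close> identifies \<open>Ad(P)\<close> with \<open>Ad(P')\<close>, where
  \<open>P'\<close> is the dual of \<open>P\<close> twisted by a line bundle of degree \<open>1\<close>. If \<open>P\<close> is simple of rank \<open>n\<close> and degree \<open>d\<close>, then
  \<open>P'\<close> is simple of rank \<open>n\<close> and degree \<open>n - d = e\<close> (\<open>dual_simple\<close>). The theorem therefore follows once two simple
  bundles of the same rank and degree are known to agree up to a line bundle
  (\<open>simple_bundles_twist_equivalent\<close>): the identification of the sheaves is then
  \<open>s \<mapsto> - A s\<^sup>T A\<^sup>-\<^sup>1\<close> with \<open>A \<in> GL\<^sub>n(\<complex>[z])\<close>, it commutes with residues and values, and
  \<open>\<phi>(z) a = - A(z) a\<^sup>T A(z)\<^sup>-\<^sup>1\<close> is the gauge equivalence (\<open>gauge_equivalentI\<close>).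

  The classification of the simple bundles has three steps.
  Row reduction over \<open>\<complex>[z]\<close> gives the splitting of the pull-back to the projective line: \<open>g\<close> is equivalent to
  \<open>D U\<close>, where \<open>D\<close> is a diagonal matrix of powers of \<open>z\<close> and \<open>U\<close> is invertible over the local ring of the
  normalization at the cusp. Modulo \<open>GL\<^sub>n(O)\<close> only the \<open>1\<close>-jet of \<open>U\<close> matters, so \<open>g\<close> becomes \<open>D (1 + t B)\<close> with a
  constant matrix \<open>B\<close> (\<open>normal_form\<close>). A matrix unit is an endomorphism of this bundle as soon as two
  exponents in \<open>D\<close> differ by \<open>2\<close>; so for a simple bundle of degree \<open>d\<close> they are \<open>0\<close> (\<open>e\<close> times) and \<open>1\<close> (\<open>d\<close> times)
  (\<open>simple_normal_form\<close>).
  Secondly, homomorphisms from \<open>D (1 + t B)\<close> to \<open>D (1 + t B')\<close> come from the constant matrices \<open>F\<close> which are block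
  lower triangular for the block sizes \<open>e, d\<close> and for which \<open>F B - B' F\<close> lives in the lower left block
  (\<open>hom_lift_props\<close>).
  Thirdly, this matrix problem obeys the Euclidean algorithm: if \<open>B\<close> has only scalar endomorphisms, its upper right
  block has full rank, \<open>B\<close> can be brought to the form of \<open>reduced_mat\<close>, and there remains the same problem for the
  pair \<open>(e - d, d)\<close> or \<open>(e, d - e)\<close>. The induction ends with \<open>1 \<times> 1\<close> matrices, and the trace of \<open>B\<close> is an invariant
  throughout; so two such \<open>B\<close> with the same trace are isomorphic (\<open>brick_isomorphic\<close>). A line bundle of
  degree \<open>0\<close> adds a scalar to \<open>B\<close>, which makes the traces agree.

  That \<open>r\<close> is well defined needs \<open>res\<^sub>x\<close> to be bijective (\<open>simple_residue_bij\<close>): a section without residue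
  is a traceless endomorphism of a simple bundle, hence \<open>0\<close>, and surjectivity follows by counting dimensions on
  the normal form.
\<close>

section \<open>Traces of matrices\<close>

lemma mat_mult_entry:
  assumes "A \<in> carrier_mat n m" "B \<in> carrier_mat m k" "i < n" "j < k"
  shows "(A * B) $$ (i, j) = (\<Sum>l<m. A $$ (i, l) * B $$ (l, j))"
  using assms by (simp add: scalar_prod_def lessThan_atLeast0)

lemma mtrace_entries: "A \<in> carrier_mat n n \<Longrightarrow> mtrace A = (\<Sum>i<n. A $$ (i, i))"
  by (auto simp: mtrace_def)

lemma mtrace_comm:
  fixes A B :: "'a :: comm_ring_1 mat"
  assumes A: "A \<in> carrier_mat n m" and B: "B \<in> carrier_mat m n"
  shows "mtrace (A * B) = mtrace (B * A)"
proof -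
  have "mtrace (A * B) = (\<Sum>i<n. \<Sum>l<m. A $$ (i, l) * B $$ (l, i))"
    using A B by (simp add: mtrace_entries[of _ n] mat_mult_entry[OF A B] del: index_mult_mat)
  also have "\<dots> = (\<Sum>l<m. \<Sum>i<n. A $$ (i, l) * B $$ (l, i))"
    by (rule sum.swap)
  also have "\<dots> = mtrace (B * A)"
    using A B by (simp add: mtrace_entries[of _ m] mat_mult_entry[OF B A] mult.commute del: index_mult_mat)
  finally show ?thesis .
qed

lemma mtrace_add:
  "A \<in> carrier_mat n n \<Longrightarrow> B \<in> carrier_mat n n \<Longrightarrow> mtrace (A + B) = mtrace A + mtrace B"
  by (auto simp: mtrace_entries[of _ n] sum.distrib)

lemma mtrace_minus:
  fixes A :: "'a :: comm_ring_1 mat"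
  shows "A \<in> carrier_mat n n \<Longrightarrow> B \<in> carrier_mat n n \<Longrightarrow> mtrace (A - B) = mtrace A - mtrace B"
  by (auto simp: mtrace_def sum_subtractf)

lemma mtrace_smult:
  fixes A :: "'a :: comm_ring_1 mat"
  shows "A \<in> carrier_mat n n \<Longrightarrow> mtrace (c \<cdot>\<^sub>m A) = c * mtrace A"
  by (auto simp: mtrace_entries[of _ n] sum_distrib_left)

lemma mtrace_uminus:
  fixes A :: "'a :: comm_ring_1 mat"
  shows "A \<in> carrier_mat n n \<Longrightarrow> mtrace (- A) = - mtrace A"
  by (auto simp: mtrace_entries[of _ n] sum_negf)

lemma mtrace_one: "mtrace (1\<^sub>m n :: 'a :: comm_ring_1 mat) = of_nat n"
  by (simp add: mtrace_entries[of _ n])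

lemma mtrace_transpose:
  "A \<in> carrier_mat n n \<Longrightarrow> mtrace (transpose_mat A) = mtrace A"
  by (auto simp: mtrace_entries[of _ n])

lemma mtrace_conj:
  fixes A :: "'a :: comm_ring_1 mat"
  assumes "A \<in> carrier_mat n n" "M \<in> carrier_mat n n" "B \<in> carrier_mat n n" "B * A = 1\<^sub>m n"
  shows "mtrace (A * M * B) = mtrace M"
proof -
  have "mtrace (A * M * B) = mtrace (B * (A * M))" using assms by (intro mtrace_comm) auto
  also have "B * (A * M) = M" using assms by (simp flip: assoc_mult_mat[of _ n n _ n _ n])
  finally show ?thesis .
qed

section \<open>The matrix problem\<close>

text \<open>
  The index set \<open>{..<n}\<close> is split at \<open>e\<close> into blocks of sizes \<open>e\<close> and \<open>n - e\<close>. The endomorphisms of the direct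
  sum of \<open>e\<close> copies of the trivial bundle and \<open>n - e\<close> copies of \<open>O(1)\<close> on the projective line have values at infinity
  in \<open>block_lower\<close>; their derivatives there fill exactly the block \<open>corner\<close>.
\<close>

definition block_lower :: "nat \<Rightarrow> nat \<Rightarrow> complex mat set" where
  "block_lower n e = {F \<in> carrier_mat n n. \<forall>i<e. \<forall>j<n. e \<le> j \<longrightarrow> F $$ (i, j) = 0}"

definition corner :: "nat \<Rightarrow> nat \<Rightarrow> complex mat set" where
  "corner n e = {L \<in> carrier_mat n n. \<forall>i<n. \<forall>j<n. L $$ (i, j) \<noteq> 0 \<longrightarrow> e \<le> i \<and> j < e}"

text \<open>
  The homomorphisms between the bundles glued from \<open>B\<close> and \<open>B'\<close>: the condition at the cusp reads
  \<open>F B - B' F + (derivative of F) = 0\<close>, and the derivative is an arbitrary element of \<open>corner\<close>.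
\<close>

definition homs :: "nat \<Rightarrow> nat \<Rightarrow> complex mat \<Rightarrow> complex mat \<Rightarrow> complex mat set" where
  "homs n e B B' = {F \<in> block_lower n e. F * B - B' * F \<in> corner n e}"

definition isomorphic :: "nat \<Rightarrow> nat \<Rightarrow> complex mat \<Rightarrow> complex mat \<Rightarrow> bool" where
  "isomorphic n e B B' \<longleftrightarrow>
     (\<exists>F \<in> homs n e B B'. \<exists>G \<in> homs n e B' B. F * G = 1\<^sub>m n \<and> G * F = 1\<^sub>m n)"

text \<open>
  An object with scalar endomorphisms only; it corresponds to a simple bundle.
\<close>

definition brick :: "nat \<Rightarrow> nat \<Rightarrow> complex mat \<Rightarrow> bool" where
  "brick n e B \<longleftrightarrow> B \<in> carrier_mat n n \<and> (\<forall>F \<in> homs n e B B. \<exists>c. F = c \<cdot>\<^sub>m 1\<^sub>m n)"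

lemma brickE:
  assumes "brick n e B" "F \<in> homs n e B B" obtains c where "F = c \<cdot>\<^sub>m 1\<^sub>m n"
  using assms unfolding brick_def by blast

lemma block_lower_carrier: "F \<in> block_lower n e \<Longrightarrow> F \<in> carrier_mat n n"
  by (simp add: block_lower_def)

lemma corner_carrier: "F \<in> corner n e \<Longrightarrow> F \<in> carrier_mat n n"
  by (simp add: corner_def)

lemma homs_carrier: "F \<in> homs n e B B' \<Longrightarrow> F \<in> carrier_mat n n"
  by (simp add: homs_def block_lower_def)

lemma sum_nonzeroE:
  assumes "(\<Sum>l<m. f l * g l) \<noteq> (0::complex)"
  obtains l where "l < m" "f l \<noteq> 0" "g l \<noteq> 0"
  using assms by (metis (no_types, lifting) lessThan_iff mult_eq_0_iff sum.not_neutral_contains_not_neutral)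

lemma block_lower_mult:
  assumes "F \<in> block_lower n e" "G \<in> block_lower n e" "e \<le> n"
  shows "F * G \<in> block_lower n e"
proof -
  have "(F * G) $$ (i, j) = 0" if "i < e" "j < n" "e \<le> j" for i j
  proof (rule ccontr)
    assume "(F * G) $$ (i, j) \<noteq> 0"
    hence "(\<Sum>l<n. F $$ (i, l) * G $$ (l, j)) \<noteq> 0"
      using assms that by (subst mat_mult_entry[symmetric, of _ n _ _ n]) (auto simp: block_lower_def)
    then obtain l where "l < n" "F $$ (i, l) \<noteq> 0" "G $$ (l, j) \<noteq> 0" by (rule sum_nonzeroE)
    thus False using assms that by (cases "l < e") (auto simp: block_lower_def)
  qed
  thus ?thesis using assms by (auto simp: block_lower_def)
qed

text \<open>
  The lower left block is a two-sided ideal among the block lower triangular matrices; this makes \<open>homs\<close>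
  closed under composition.
\<close>

lemma corner_mult_left:
  assumes "F \<in> block_lower n e" "L \<in> corner n e" "e \<le> n"
  shows "F * L \<in> corner n e"
proof -
  have "e \<le> i \<and> j < e" if ij: "i < n" "j < n" and nz: "(F * L) $$ (i, j) \<noteq> 0" for i j
  proof -
    have "(\<Sum>l<n. F $$ (i, l) * L $$ (l, j)) \<noteq> 0"
      using assms ij nz by (subst mat_mult_entry[symmetric, of _ n _ _ n]) (auto simp: block_lower_def corner_def)
    then obtain l where "l < n" "F $$ (i, l) \<noteq> 0" "L $$ (l, j) \<noteq> 0" by (rule sum_nonzeroE)
    thus ?thesis using assms ij by (cases "i < e") (auto simp: block_lower_def corner_def)
  qed
  thus ?thesis using assms by (auto simp: block_lower_def corner_def)
qed

lemma corner_mult_right: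
  assumes "F \<in> block_lower n e" "L \<in> corner n e" "e \<le> n"
  shows "L * F \<in> corner n e"
proof -
  have "e \<le> i \<and> j < e" if ij: "i < n" "j < n" and nz: "(L * F) $$ (i, j) \<noteq> 0" for i j
  proof -
    have "(\<Sum>l<n. L $$ (i, l) * F $$ (l, j)) \<noteq> 0"
      using assms ij nz by (subst mat_mult_entry[symmetric, of _ n _ _ n]) (auto simp: block_lower_def corner_def)
    then obtain l where l: "l < n" "L $$ (i, l) \<noteq> 0" "F $$ (l, j) \<noteq> 0" by (rule sum_nonzeroE)
    hence "e \<le> i" "l < e" using assms ij by (auto simp: corner_def)
    moreover have "\<not> e \<le> j" using \<open>l < e\<close> l assms(1) ij by (auto simp: block_lower_def)
    ultimately show ?thesis by simp
  qed
  thus ?thesis using assms by (auto simp: block_lower_def corner_def)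
qed

lemma corner_add: "L \<in> corner n e \<Longrightarrow> M \<in> corner n e \<Longrightarrow> L + M \<in> corner n e"
  by (fastforce simp: corner_def)

lemma corner_diff_swap:
  assumes "L - M \<in> corner n e" "L \<in> carrier_mat n n" "M \<in> carrier_mat n n"
  shows "M - L \<in> corner n e"
proof -
  have "e \<le> i \<and> j < e" if ij: "i < n" "j < n" "(M - L) $$ (i, j) \<noteq> 0" for i j
  proof -
    have "(L - M) $$ (i, j) \<noteq> 0" using ij assms(2,3) by simp
    thus ?thesis using assms(1) ij unfolding corner_def by blast
  qed
  thus ?thesis using assms(2,3) unfolding corner_def by auto
qed

lemma block_lower_one: "1\<^sub>m n \<in> block_lower n e"
  by (auto simp: block_lower_def one_mat_def)

lemma corner_zero: "0\<^sub>m n n \<in> corner n e"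
  by (auto simp: corner_def)

lemma mtrace_corner: "L \<in> corner n e \<Longrightarrow> mtrace L = 0"
  by (auto simp: corner_def mtrace_def intro!: sum.neutral) (metis linorder_not_less)

lemma homs_comp:
  assumes F: "F \<in> homs n e B B'" and G: "G \<in> homs n e B' B''" and e: "e \<le> n"
    and B: "B \<in> carrier_mat n n" "B' \<in> carrier_mat n n" "B'' \<in> carrier_mat n n"
  shows "G * F \<in> homs n e B B''"
proof -
  have c: "F \<in> carrier_mat n n" "G \<in> carrier_mat n n" using F G homs_carrier by blast+
  have "G * F * B - B'' * (G * F) = G * (F * B - B' * F) + (G * B' - B'' * G) * F"
  proof -
    have c2: "F * B \<in> carrier_mat n n" "B' * F \<in> carrier_mat n n" "G * B' \<in> carrier_mat n n"
      "B'' * G \<in> carrier_mat n n" using c B by auto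
    have "G * (F * B - B' * F) = G * F * B - G * B' * F"
      using mult_minus_distrib_mat[OF c(2) c2(1,2)] c B by (simp add: assoc_mult_mat[of _ n n _ n _ n])
    moreover have "(G * B' - B'' * G) * F = G * B' * F - B'' * (G * F)"
      using minus_mult_distrib_mat[OF c2(3,4) c(1)] c B by (simp add: assoc_mult_mat[of _ n n _ n _ n])
    ultimately show ?thesis using c B by (auto intro!: eq_matI)
  qed
  also have "\<dots> \<in> corner n e"
    using F G e by (intro corner_add corner_mult_left corner_mult_right) (auto simp: homs_def)
  finally show ?thesis using F G e block_lower_mult by (auto simp: homs_def)
qed

lemma homs_one:
  assumes "B \<in> carrier_mat n n" shows "1\<^sub>m n \<in> homs n e B B"
  using assms by (auto simp: homs_def block_lower_one minus_r_inv_mat corner_zero)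

lemma isomorphic_sym: "isomorphic n e B B' \<Longrightarrow> isomorphic n e B' B"
  by (auto simp: isomorphic_def)

lemma isomorphic_trans:
  assumes "isomorphic n e B B'" "isomorphic n e B' B''" and e: "e \<le> n"
    and B: "B \<in> carrier_mat n n" "B' \<in> carrier_mat n n" "B'' \<in> carrier_mat n n"
  shows "isomorphic n e B B''"
proof -
  obtain F G where FG: "F \<in> homs n e B B'" "G \<in> homs n e B' B" "F * G = 1\<^sub>m n" "G * F = 1\<^sub>m n"
    using assms by (auto simp: isomorphic_def)
  obtain F' G' where FG': "F' \<in> homs n e B' B''" "G' \<in> homs n e B'' B'" "F' * G' = 1\<^sub>m n" "G' * F' = 1\<^sub>m n"
    using assms by (auto simp: isomorphic_def)
  note c = FG(1,2)[THEN homs_carrier] FG'(1,2)[THEN homs_carrier]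
  have "(F' * F) * (G * G') = F' * (F * G) * G'" "(G * G') * (F' * F) = G * (G' * F') * F"
    using c by (simp_all add: assoc_mult_mat[of _ n n _ n _ n])
  hence "(F' * F) * (G * G') = 1\<^sub>m n" "(G * G') * (F' * F) = 1\<^sub>m n" using FG FG' c by simp_all
  moreover have "F' * F \<in> homs n e B B''" "G * G' \<in> homs n e B'' B"
    using homs_comp[OF FG(1) FG'(1) e B] homs_comp[OF FG'(2) FG(2) e B(3,2,1)] by auto
  ultimately show ?thesis unfolding isomorphic_def by (intro bexI conjI)
qed

text \<open>
  Conjugation preserves the trace, and the error term lies in \<open>corner\<close>, which has zero diagonal.
\<close>

lemma isomorphic_mtrace:
  assumes iso: "isomorphic n e B B'" and e: "e \<le> n"
    and B: "B \<in> carrier_mat n n" "B' \<in> carrier_mat n n"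
  shows "mtrace B = mtrace B'"
proof -
  obtain F G where FG: "F \<in> homs n e B B'" "G \<in> homs n e B' B" "F * G = 1\<^sub>m n" "G * F = 1\<^sub>m n"
    using iso by (auto simp: isomorphic_def)
  have c: "F \<in> carrier_mat n n" "G \<in> carrier_mat n n" using FG homs_carrier by blast+
  have "G * (F * B - B' * F) \<in> corner n e"
    using FG e by (intro corner_mult_left) (auto simp: homs_def)
  moreover have "G * (F * B - B' * F) = B - G * B' * F"
  proof -
    have "G * (F * B - B' * F) = G * (F * B) - G * (B' * F)"
      using c B by (intro mult_minus_distrib_mat[of _ n n _ n]) auto
    moreover have "G * (F * B) = G * F * B" "G * (B' * F) = G * B' * F"
      using c B by (simp_all add: assoc_mult_mat[of _ n n _ n _ n])
    ultimately show ?thesis using FG B by simp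
  qed
  ultimately have "mtrace (B - G * B' * F) = 0" using mtrace_corner by metis
  moreover have "mtrace (G * B' * F) = mtrace B'" using c B FG by (intro mtrace_conj) auto
  ultimately show ?thesis using c B by (simp add: mtrace_minus[of _ n])
qed

lemma isomorphic_brick:
  assumes iso: "isomorphic n e B B'" and br: "brick n e B" and e: "e \<le> n"
    and B: "B' \<in> carrier_mat n n"
  shows "brick n e B'"
proof -
  obtain F G where FG: "F \<in> homs n e B B'" "G \<in> homs n e B' B" "F * G = 1\<^sub>m n" "G * F = 1\<^sub>m n"
    using iso by (auto simp: isomorphic_def)
  have c: "F \<in> carrier_mat n n" "G \<in> carrier_mat n n" using FG homs_carrier by blast+
  have Bc: "B \<in> carrier_mat n n" using br by (simp add: brick_def)
  have "\<exists>c. H = c \<cdot>\<^sub>m 1\<^sub>m n" if H: "H \<in> homs n e B' B'" for H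
  proof -
    have Hc: "H \<in> carrier_mat n n" using H homs_carrier by blast
    have "G * (H * F) \<in> homs n e B B"
      using homs_comp[OF homs_comp[OF FG(1) H e Bc B B] FG(2) e Bc B Bc] .
    with br obtain k where "G * (H * F) = k \<cdot>\<^sub>m 1\<^sub>m n" by (rule brickE)
    hence "F * (G * (H * F)) * G = F * (k \<cdot>\<^sub>m 1\<^sub>m n) * G" by simp
    moreover have "F * (G * (H * F)) * G = (F * G) * H * (F * G)"
      using c Hc by (simp add: assoc_mult_mat[of _ n n _ n _ n])
    moreover have "F * (k \<cdot>\<^sub>m 1\<^sub>m n) * G = k \<cdot>\<^sub>m (F * G)"
      using c by (simp add: mult_smult_distrib[of _ n n _ n] mult_smult_assoc_mat[of _ n n])
    ultimately show ?thesis using FG Hc by auto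
  qed
  thus ?thesis using B by (auto simp: brick_def)
qed

section \<open>Reflection in the antidiagonal\<close>

text \<open>
  The transpose exchanges upper and lower triangular matrices; reflecting in the antidiagonal instead keeps
  block lower triangular matrices, swaps the two block sizes and reverses products. It is the duality of the matrix
  problem that reduces the case \<open>e < d\<close> to \<open>d \<le> e\<close>.
\<close>

definition flip_mat :: "nat \<Rightarrow> complex mat \<Rightarrow> complex mat" where
  "flip_mat n A = Matrix.mat n n (\<lambda>(i, j). A $$ (n - 1 - j, n - 1 - i))"

lemma flip_carrier[simp]: "flip_mat n A \<in> carrier_mat n n"
  by (simp add: flip_mat_def)

lemma flip_entry: "i < n \<Longrightarrow> j < n \<Longrightarrow> flip_mat n A $$ (i, j) = A $$ (n - 1 - j, n - 1 - i)"
  by (simp add: flip_mat_def)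

lemma flip_flip: "A \<in> carrier_mat n n \<Longrightarrow> flip_mat n (flip_mat n A) = A"
  by (auto simp: flip_mat_def intro!: eq_matI)

lemma flip_mult:
  assumes "A \<in> carrier_mat n n" "B \<in> carrier_mat n n"
  shows "flip_mat n (A * B) = flip_mat n B * flip_mat n A"
proof (intro eq_matI)
  fix i j assume ij: "i < dim_row (flip_mat n B * flip_mat n A)" "j < dim_col (flip_mat n B * flip_mat n A)"
  hence ij: "i < n" "j < n" by (auto simp: flip_mat_def)
  have "flip_mat n (A * B) $$ (i, j) = (\<Sum>l<n. A $$ (n - 1 - j, l) * B $$ (l, n - 1 - i))"
    using assms ij by (subst flip_entry, simp, simp, subst mat_mult_entry) auto
  also have "\<dots> = (\<Sum>l<n. A $$ (n - 1 - j, n - 1 - l) * B $$ (n - 1 - l, n - 1 - i))"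
    by (subst sum.nat_diff_reindex[symmetric]) simp
  also have "\<dots> = (flip_mat n B * flip_mat n A) $$ (i, j)"
    using ij by (subst mat_mult_entry[of _ n n _ n]) (auto simp: flip_entry mult.commute intro!: sum.cong)
  finally show "flip_mat n (A * B) $$ (i, j) = (flip_mat n B * flip_mat n A) $$ (i, j)" .
qed (auto simp: flip_mat_def)

lemma flip_minus:
  assumes "A \<in> carrier_mat n n" "B \<in> carrier_mat n n"
  shows "flip_mat n (A - B) = flip_mat n A - flip_mat n B"
  using assms by (auto simp: flip_mat_def intro!: eq_matI)

lemma flip_one: "flip_mat n (1\<^sub>m n) = 1\<^sub>m n"
  by (auto simp: flip_mat_def intro!: eq_matI)

lemma flip_scalar: "flip_mat n (c \<cdot>\<^sub>m 1\<^sub>m n) = c \<cdot>\<^sub>m 1\<^sub>m n"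
  by (auto simp: flip_mat_def intro!: eq_matI)

lemma mtrace_flip:
  assumes "A \<in> carrier_mat n n" shows "mtrace (flip_mat n A) = mtrace A"
proof -
  have "mtrace (flip_mat n A) = (\<Sum>i<n. A $$ (n - 1 - i, n - 1 - i))"
    by (simp add: mtrace_entries[of _ n] flip_entry)
  also have "\<dots> = (\<Sum>i<n. A $$ (i, i))"
    using sum.nat_diff_reindex[of "\<lambda>i. A $$ (i, i)" n] by simp
  finally show ?thesis using assms by (simp add: mtrace_entries[of _ n])
qed

lemma flip_block_lower:
  assumes "F \<in> block_lower n e" "e \<le> n"
  shows "flip_mat n F \<in> block_lower n (n - e)"
  using assms by (auto simp: block_lower_def flip_entry)

lemma flip_corner:
  assumes "F \<in> corner n e" "e \<le> n"
  shows "flip_mat n F \<in> corner n (n - e)"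
proof -
  have "n - e \<le> i \<and> j < n - e" if ij: "i < n" "j < n" and nz: "flip_mat n F $$ (i, j) \<noteq> 0" for i j
  proof -
    have "F $$ (n - 1 - j, n - 1 - i) \<noteq> 0" using ij nz by (simp add: flip_entry)
    moreover have "n - 1 - j < n" "n - 1 - i < n" using ij by auto
    ultimately have "e \<le> n - 1 - j \<and> n - 1 - i < e" using assms unfolding corner_def by blast
    thus ?thesis using ij by auto
  qed
  thus ?thesis by (auto simp: corner_def)
qed

lemma flip_homs:
  assumes F: "F \<in> homs n e B B'" and e: "e \<le> n"
    and B: "B \<in> carrier_mat n n" "B' \<in> carrier_mat n n"
  shows "flip_mat n F \<in> homs n (n - e) (flip_mat n B') (flip_mat n B)"
proof -
  have c: "F \<in> carrier_mat n n" using F homs_carrier by blast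
  have "flip_mat n (B' * F - F * B) = flip_mat n F * flip_mat n B' - flip_mat n B * flip_mat n F"
    using c B by (subst flip_minus, simp, simp) (simp add: flip_mult)
  moreover have "B' * F - F * B \<in> corner n e"
    using F c B by (intro corner_diff_swap[of "F * B"]) (auto simp: homs_def)
  ultimately show ?thesis
    using flip_corner[of "B' * F - F * B" n e] flip_block_lower[of F n e] F e by (auto simp: homs_def)
qed

lemma flip_isomorphic:
  assumes "isomorphic n e B B'" and e: "e \<le> n"
    and B: "B \<in> carrier_mat n n" "B' \<in> carrier_mat n n"
  shows "isomorphic n (n - e) (flip_mat n B) (flip_mat n B')"
proof -
  obtain F G where FG: "F \<in> homs n e B B'" "G \<in> homs n e B' B" "F * G = 1\<^sub>m n" "G * F = 1\<^sub>m n"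
    using assms by (auto simp: isomorphic_def)
  have c: "F \<in> carrier_mat n n" "G \<in> carrier_mat n n" using FG homs_carrier by blast+
  have "flip_mat n F * flip_mat n G = 1\<^sub>m n" "flip_mat n G * flip_mat n F = 1\<^sub>m n"
    using flip_mult[OF c] flip_mult[OF c(2) c(1)] FG flip_one by metis+
  thus ?thesis using flip_homs[OF FG(1) e B] flip_homs[OF FG(2) e B(2) B(1)]
    unfolding isomorphic_def by (intro bexI conjI)
qed

lemma flip_brick:
  assumes "brick n e B" and e: "e \<le> n"
  shows "brick n (n - e) (flip_mat n B)"
proof -
  have B: "B \<in> carrier_mat n n" using assms by (simp add: brick_def)
  have "\<exists>c. F = c \<cdot>\<^sub>m 1\<^sub>m n" if F: "F \<in> homs n (n - e) (flip_mat n B) (flip_mat n B)" for F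
  proof -
    have c: "F \<in> carrier_mat n n" using F homs_carrier by blast
    have "flip_mat n F \<in> homs n e B B"
      using flip_homs[OF F] e B by (simp add: flip_flip)
    with assms(1) obtain k where k: "flip_mat n F = k \<cdot>\<^sub>m 1\<^sub>m n" by (rule brickE)
    have "F = flip_mat n (flip_mat n F)" using flip_flip[OF c] by (rule sym)
    also have "\<dots> = k \<cdot>\<^sub>m 1\<^sub>m n" unfolding k by (rule flip_scalar)
    finally show ?thesis by (rule exI)
  qed
  thus ?thesis by (simp add: brick_def)
qed

section \<open>Kernels and injective matrices\<close>

lemma det_zero_iff_kernel:
  fixes Q :: "complex mat"
  assumes Q: "Q \<in> carrier_mat n n"
  shows "det Q = 0 \<longleftrightarrow> (\<exists>v. (\<exists>j<n. v j \<noteq> 0) \<and> (\<forall>i<n. (\<Sum>j<n. Q $$ (i, j) * v j) = 0))"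
proof -
  have mv: "(Q *\<^sub>v v) $ i = (\<Sum>j<n. Q $$ (i, j) * v $ j)" if "v \<in> carrier_vec n" "i < n" for v i
    using Q that by (simp add: scalar_prod_def lessThan_atLeast0)
  show ?thesis
  proof
    assume "det Q = 0"
    then obtain v where v: "v \<in> carrier_vec n" "v \<noteq> 0\<^sub>v n" "Q *\<^sub>v v = 0\<^sub>v n"
      using det_0_iff_vec_prod_zero_field[OF Q] by auto
    have "\<exists>j<n. v $ j \<noteq> 0"
    proof (rule ccontr)
      assume "\<not> ?thesis"
      hence "v = 0\<^sub>v n" using v(1) by (intro eq_vecI) auto
      thus False using v by simp
    qed
    moreover have "\<forall>i<n. (\<Sum>j<n. Q $$ (i, j) * v $ j) = 0" using mv[OF v(1)] v(3) by (metis index_zero_vec(1))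
    ultimately show "\<exists>v. (\<exists>j<n. v j \<noteq> 0) \<and> (\<forall>i<n. (\<Sum>j<n. Q $$ (i, j) * v j) = 0)" by blast
  next
    assume "\<exists>v. (\<exists>j<n. v j \<noteq> 0) \<and> (\<forall>i<n. (\<Sum>j<n. Q $$ (i, j) * v j) = 0)"
    then obtain v j where v: "j < n" "v j \<noteq> 0" "\<And>i. i < n \<Longrightarrow> (\<Sum>j<n. Q $$ (i, j) * v j) = 0" by blast
    have "Matrix.vec n v \<noteq> 0\<^sub>v n" using v(1,2) by (metis index_vec index_zero_vec(1))
    moreover have "Q *\<^sub>v Matrix.vec n v = 0\<^sub>v n"
      using Q v(3) by (intro eq_vecI) (auto simp: scalar_prod_def lessThan_atLeast0)
    ultimately show "det Q = 0" using det_0_iff_vec_prod_zero_field[OF Q] by (metis vec_carrier)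
  qed
qed

lemma det_zero_left_kernel:
  fixes Q :: "complex mat"
  assumes Q: "Q \<in> carrier_mat n n" "det Q = 0"
  shows "\<exists>\<xi>. (\<exists>k<n. \<xi> k \<noteq> 0) \<and> (\<forall>j<n. (\<Sum>i<n. \<xi> i * Q $$ (i, j)) = 0)"
proof -
  have "det (transpose_mat Q) = 0" using Q by (simp add: det_transpose)
  then obtain v where v: "\<exists>j<n. v j \<noteq> 0" "\<forall>i<n. (\<Sum>j<n. transpose_mat Q $$ (i, j) * v j) = 0"
    using det_zero_iff_kernel[of "transpose_mat Q" n] Q by auto
  from v(1) obtain k where k: "k < n" "v k \<noteq> 0" by blast
  have "(\<Sum>i<n. v i * Q $$ (i, j)) = 0" if "j < n" for j
    using v(2) that Q by (auto simp: mult.commute)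
  thus ?thesis using k by (intro exI[of _ v]) auto
qed

lemma det_nonzero_inverse:
  fixes Q :: "'a :: field mat"
  assumes Q: "Q \<in> carrier_mat n n" "det Q \<noteq> 0"
  obtains P where "P \<in> carrier_mat n n" "P * Q = 1\<^sub>m n" "Q * P = 1\<^sub>m n"
proof -
  let ?P = "(1 / det Q) \<cdot>\<^sub>m adj_mat Q"
  have "?P \<in> carrier_mat n n" "?P * Q = 1\<^sub>m n" "Q * ?P = 1\<^sub>m n"
    using adj_mat[OF Q(1)] Q
    by (auto simp: mult_smult_distrib[of _ n n _ n] mult_smult_assoc_mat[of _ n n] intro!: eq_matI)
  thus ?thesis using that by blast
qed

definition injective_mat :: "nat \<Rightarrow> nat \<Rightarrow> complex mat \<Rightarrow> bool" where
  "injective_mat e d M \<longleftrightarrow> (\<forall>v. (\<forall>i<e. (\<Sum>j<d. M $$ (i, j) * v j) = 0) \<longrightarrow> (\<forall>j<d. v j = 0))"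

text \<open>
  Padding \<open>M\<close> with zero columns to a square matrix yields a singular matrix in both cases, and a singular matrix
  has a left kernel.
\<close>

lemma left_kernel_exists:
  fixes M :: "complex mat"
  assumes "d < e \<or> d = e \<and> \<not> injective_mat e d M"
  shows "\<exists>\<xi>. (\<exists>k<e. \<xi> k \<noteq> 0) \<and> (\<forall>j<d. (\<Sum>i<e. \<xi> i * M $$ (i, j)) = 0)"
proof -
  define Q where "Q = Matrix.mat e e (\<lambda>(i, j). if j < d then M $$ (i, j) else 0)"
  have Q: "Q \<in> carrier_mat e e" by (simp add: Q_def)
  have "\<exists>v. (\<exists>j<e. v j \<noteq> 0) \<and> (\<forall>i<e. (\<Sum>j<e. Q $$ (i, j) * v j) = 0)"
  proof (cases "d < e")
    case True
    have "(\<Sum>j<e. Q $$ (i, j) * (if j = d then 1 else 0)) = 0" if "i < e" for i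
      using that by (intro sum.neutral) (auto simp: Q_def)
    thus ?thesis using True by (intro exI[of _ "\<lambda>j. if j = d then 1 else 0"]) auto
  next
    case False
    with assms obtain v where "d = e" "\<forall>i<e. (\<Sum>j<d. M $$ (i, j) * v j) = 0" "\<exists>j<d. v j \<noteq> 0"
      unfolding injective_mat_def by blast
    thus ?thesis by (intro exI[of _ v]) (auto simp: Q_def)
  qed
  hence "det Q = 0" using det_zero_iff_kernel[OF Q] by blast
  from det_zero_left_kernel[OF Q this]
  obtain \<xi> k where \<xi>: "k < e" "\<xi> k \<noteq> 0" "\<forall>j<e. (\<Sum>i<e. \<xi> i * Q $$ (i, j)) = 0"
    by (elim exE conjE)
  have "(\<Sum>i<e. \<xi> i * M $$ (i, j)) = 0" if "j < d" for j
  proof -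
    have "j < e" using that assms by auto
    thus ?thesis using \<xi>(3)[rule_format, of j] that by (simp add: Q_def)
  qed
  thus ?thesis using \<xi>(1,2) by (intro exI[of _ \<xi>]) auto
qed

text \<open>
  Columns are added on the left one at a time. A nonzero \<open>\<xi>\<close> with \<open>\<xi> M = 0\<close> exists as long as \<open>d < e\<close>; a unit
  vector on which \<open>\<xi>\<close> does not vanish is then independent of the columns of \<open>M\<close>.
\<close>

lemma injective_extend:
  assumes "injective_mat e d M" "d \<le> e"
  shows "\<exists>Q \<in> carrier_mat e e. det Q \<noteq> 0 \<and> (\<forall>i<e. \<forall>j<d. Q $$ (i, j + (e - d)) = M $$ (i, j))"
  using assms
proof (induction "e - d" arbitrary: d M)
  case 0
  define Q where "Q = Matrix.mat e e (\<lambda>(i, j). M $$ (i, j))"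
  have Q: "Q \<in> carrier_mat e e" by (simp add: Q_def)
  have d: "d = e" using 0 by simp
  have "det Q \<noteq> 0"
  proof
    assume "det Q = 0"
    then obtain v where v: "\<exists>j<e. v j \<noteq> 0" "\<forall>i<e. (\<Sum>j<e. Q $$ (i, j) * v j) = 0"
      using det_zero_iff_kernel[OF Q] by blast
    have "\<forall>i<e. (\<Sum>j<d. M $$ (i, j) * v j) = 0" using v(2) by (simp add: Q_def d)
    thus False using 0(2) v(1) unfolding injective_mat_def d by blast
  qed
  thus ?case using Q by (intro bexI[of _ Q]) (auto simp: Q_def d)
next
  case (Suc m)
  hence de: "d < e" by simp
  obtain \<xi> k where \<xi>0: "k < e" "\<xi> k \<noteq> 0" "\<forall>j<d. (\<Sum>i<e. \<xi> i * M $$ (i, j)) = 0"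
    using left_kernel_exists[of d e M, OF disjI1[OF de]] by (elim exE conjE)
  note \<xi> = \<xi>0(1,2) \<xi>0(3)[rule_format]
  define M' where "M' = Matrix.mat e (Suc d)
    (\<lambda>(i, j). if j = 0 then (if i = k then 1 else 0) else M $$ (i, j - 1))"
  have "injective_mat e (Suc d) M'"
    unfolding injective_mat_def
  proof (intro allI impI)
    fix v j assume v: "\<forall>i<e. (\<Sum>j<Suc d. M' $$ (i, j) * v j) = 0" and j: "j < Suc d"
    have eq: "(if i = k then v 0 else 0) + (\<Sum>j<d. M $$ (i, j) * v (Suc j)) = 0" if "i < e" for i
    proof -
      have "(\<Sum>j<Suc d. M' $$ (i, j) * v j) = M' $$ (i, 0) * v 0 + (\<Sum>j<d. M' $$ (i, Suc j) * v (Suc j))"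
        by (rule sum.lessThan_Suc_shift)
      moreover have "(\<Sum>j<Suc d. M' $$ (i, j) * v j) = 0" using v that by blast
      ultimately have "M' $$ (i, 0) * v 0 + (\<Sum>j<d. M' $$ (i, Suc j) * v (Suc j)) = 0" by simp
      moreover have "(\<Sum>j<d. M' $$ (i, Suc j) * v (Suc j)) = (\<Sum>j<d. M $$ (i, j) * v (Suc j))"
        "M' $$ (i, 0) * v 0 = (if i = k then v 0 else 0)"
        using that by (simp_all add: M'_def)
      ultimately show ?thesis by simp
    qed
    \<comment> \<open>Pairing a relation with \<open>\<xi>\<close> isolates the coefficient of the new column.\<close>
    have "(\<Sum>i<e. \<xi> i * ((if i = k then v 0 else 0) + (\<Sum>j<d. M $$ (i, j) * v (Suc j)))) = 0"
      by (rule sum.neutral) (simp add: eq)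
    also have "(\<Sum>i<e. \<xi> i * ((if i = k then v 0 else 0) + (\<Sum>j<d. M $$ (i, j) * v (Suc j)))) =
      (\<Sum>i<e. \<xi> i * (if i = k then v 0 else 0)) + (\<Sum>i<e. \<Sum>j<d. \<xi> i * M $$ (i, j) * v (Suc j))"
      by (simp add: distrib_left sum.distrib sum_distrib_left mult.assoc del: mult_if_delta)
    also have "(\<Sum>i<e. \<xi> i * (if i = k then v 0 else 0)) = \<xi> k * v 0"
      using \<xi>(1) by (simp add: if_distrib[of "\<lambda>x. _ * x"] sum.delta cong: if_cong)
    also have "(\<Sum>i<e. \<Sum>j<d. \<xi> i * M $$ (i, j) * v (Suc j)) = (\<Sum>j<d. (\<Sum>i<e. \<xi> i * M $$ (i, j)) * v (Suc j))"
      by (subst sum.swap) (simp add: sum_distrib_right)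
    also have "\<dots> = 0" by (rule sum.neutral) (simp add: \<xi>(3))
    finally have v0: "v 0 = 0" using \<xi>(2) by simp
    have "\<forall>i<e. (\<Sum>j<d. M $$ (i, j) * v (Suc j)) = 0" using eq[unfolded v0] by simp
    moreover have "(\<forall>i<e. (\<Sum>j<d. M $$ (i, j) * v (Suc j)) = 0) \<longrightarrow> (\<forall>j<d. v (Suc j) = 0)"
      using Suc.prems(1) unfolding injective_mat_def by (rule spec)
    ultimately have "\<forall>j<d. v (Suc j) = 0" by blast
    thus "v j = 0" using v0 j by (cases j) auto
  qed
  moreover have "m = e - Suc d" "Suc d \<le> e" using Suc.hyps(2) by auto
  ultimately obtain Q where
    Q: "Q \<in> carrier_mat e e" "det Q \<noteq> 0" "\<And>i j. i < e \<Longrightarrow> j < Suc d \<Longrightarrow> Q $$ (i, j + (e - Suc d)) = M' $$ (i, j)"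
    using Suc.hyps(1)[of "Suc d" M'] by blast
  have "Q $$ (i, j + (e - d)) = M $$ (i, j)" if "i < e" "j < d" for i j
    using Q(3)[of i "Suc j"] that de by (simp add: M'_def Suc_diff_Suc)
  thus ?case using Q by blast
qed

definition last_cols :: "nat \<Rightarrow> nat \<Rightarrow> complex mat" where
  "last_cols e d = Matrix.mat e d (\<lambda>(i, j). if i = j + (e - d) then 1 else 0)"

lemma last_cols_carrier[simp]:
  "last_cols e d \<in> carrier_mat e d" "dim_row (last_cols e d) = e" "dim_col (last_cols e d) = d"
  by (simp_all add: last_cols_def)

lemma mult_last_cols:
  assumes "X \<in> carrier_mat m e" "d \<le> e" "i < m" "j < d"
  shows "(X * last_cols e d) $$ (i, j) = X $$ (i, j + (e - d))"
proof -
  have "(X * last_cols e d) $$ (i, j) = (\<Sum>l<e. X $$ (i, l) * (if l = j + (e - d) then 1 else 0))"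
    using assms by (subst mat_mult_entry[of _ m e _ d]) (auto simp: last_cols_def)
  also have "\<dots> = X $$ (i, j + (e - d))"
    using assms by (simp add: if_distrib[of "\<lambda>x. _ * x"] sum.delta cong: if_cong)
  finally show ?thesis .
qed

lemma last_cols_mult:
  assumes "X \<in> carrier_mat d m" "d \<le> e" "i < e" "j < m"
  shows "(last_cols e d * X) $$ (i, j) = (if e - d \<le> i then X $$ (i - (e - d), j) else 0)"
proof -
  have "(last_cols e d * X) $$ (i, j) = (\<Sum>l<d. (if l = i - (e - d) \<and> e - d \<le> i then 1 else 0) * X $$ (l, j))"
    using assms by (subst mat_mult_entry[of _ e d _ m]) (auto simp: last_cols_def intro!: sum.cong)
  also have "\<dots> = (if e - d \<le> i then X $$ (i - (e - d), j) else 0)"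
    using assms by (auto simp: if_distrib[of "\<lambda>x. x * _"] sum.delta cong: if_cong)
  finally show ?thesis .
qed

lemma last_cols_cancel:
  assumes X: "X \<in> carrier_mat d m" "X' \<in> carrier_mat d m" and d: "d \<le> e"
    and eq: "last_cols e d * X = last_cols e d * X'"
  shows "X = X'"
proof (rule eq_matI)
  fix i j assume "i < dim_row X'" "j < dim_col X'"
  hence ij: "i < d" "j < m" using X by auto
  obtain l where l: "l < e" "e - d \<le> l" "l - (e - d) = i"
    using ij d by (intro that[of "i + (e - d)"]) auto
  have "(last_cols e d * X) $$ (l, j) = (last_cols e d * X') $$ (l, j)" using eq by simp
  thus "X $$ (i, j) = X' $$ (i, j)"
    using last_cols_mult[OF X(1) d l(1) ij(2)] last_cols_mult[OF X(2) d l(1) ij(2)] l by simp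
qed (use X in auto)

lemma injective_normalize:
  assumes inj: "injective_mat e d M" and M: "M \<in> carrier_mat e d" and d: "d \<le> e"
  obtains P P' where "P \<in> carrier_mat e e" "P' \<in> carrier_mat e e" "P * P' = 1\<^sub>m e" "P' * P = 1\<^sub>m e"
    "P * M = last_cols e d"
proof -
  obtain Q where Q: "Q \<in> carrier_mat e e" "det Q \<noteq> 0" "\<And>i j. i < e \<Longrightarrow> j < d \<Longrightarrow> Q $$ (i, j + (e - d)) = M $$ (i, j)"
    using injective_extend[OF inj d] by blast
  obtain P where P: "P \<in> carrier_mat e e" "P * Q = 1\<^sub>m e" "Q * P = 1\<^sub>m e"
    using det_nonzero_inverse[OF Q(1,2)] by blast
  have QM: "Q * last_cols e d = M"
    using Q M d by (intro eq_matI) (auto simp: mult_last_cols[of _ e] simp del: index_mult_mat(1) Nat.add_diff_assoc)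
  have "P * M = P * Q * last_cols e d"
    using assoc_mult_mat[OF P(1) Q(1) last_cols_carrier(1)] QM by simp
  hence "P * M = last_cols e d" using P by (simp add: left_mult_one_mat[of _ e d])
  thus ?thesis using that[of P Q] P Q by blast
qed

lemma block_lower_four_block:
  assumes "W \<in> carrier_mat e e" "Y \<in> carrier_mat d e" "Z \<in> carrier_mat d d"
  shows "four_block_mat W (0\<^sub>m e d) Y Z \<in> block_lower (e + d) e"
  using assms by (auto simp: block_lower_def)

text \<open>
  The conditions for a homomorphism, block by block; the lower left block imposes none.
\<close>

lemma homs_four_block:
  assumes F: "W \<in> carrier_mat e e" "Y \<in> carrier_mat d e" "Z \<in> carrier_mat d d"
    and B: "B1 \<in> carrier_mat e e" "B2 \<in> carrier_mat e d" "B3 \<in> carrier_mat d e" "B4 \<in> carrier_mat d d"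
    and B': "B1' \<in> carrier_mat e e" "B2' \<in> carrier_mat e d" "B3' \<in> carrier_mat d e" "B4' \<in> carrier_mat d d"
    and eq: "W * B1 = B1' * W + B2' * Y" "W * B2 = B2' * Z" "Y * B2 + Z * B4 = B4' * Z"
  shows "four_block_mat W (0\<^sub>m e d) Y Z \<in> homs (e + d) e (four_block_mat B1 B2 B3 B4) (four_block_mat B1' B2' B3' B4')"
proof -
  let ?F = "four_block_mat W (0\<^sub>m e d) Y Z"
  let ?B = "four_block_mat B1 B2 B3 B4" and ?B' = "four_block_mat B1' B2' B3' B4'"
  have 1: "?F * ?B = four_block_mat (B1' * W + B2' * Y) (B2' * Z) (Y * B1 + Z * B3) (B4' * Z)"
    using mult_four_block_mat[OF F(1) zero_carrier_mat[of e d] F(2,3) B] F B B' eq by simp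
  have 2: "?B' * ?F = four_block_mat (B1' * W + B2' * Y) (B2' * Z) (B3' * W + B4' * Y) (B4' * Z)"
    using mult_four_block_mat[OF B' F(1) zero_carrier_mat[of e d] F(2,3)] F B B' eq by simp
  have "?F * ?B - ?B' * ?F \<in> corner (e + d) e"
    unfolding 1 2 using F B B' by (auto simp: corner_def split: if_splits)
  thus ?thesis using block_lower_four_block[OF F] by (simp add: homs_def)
qed

section \<open>The Euclidean reduction step\<close>

text \<open>
  The shape of a brick after normalization: the upper right block consists of the last \<open>d\<close> columns of the identity,
  the lower blocks are cleared, and \<open>A\<close> carries the remaining information. Splitting \<open>A\<close> at \<open>e - d\<close> gives
  the smaller matrix problem.
\<close>

definition reduced_mat :: "nat \<Rightarrow> nat \<Rightarrow> complex mat \<Rightarrow> complex mat" where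
  "reduced_mat e d A = four_block_mat A (last_cols e d) (0\<^sub>m d e) (0\<^sub>m d d)"

lemma reduced_mat_carrier: "A \<in> carrier_mat e e \<Longrightarrow> reduced_mat e d A \<in> carrier_mat (e + d) (e + d)"
  by (simp add: reduced_mat_def)

lemma mtrace_reduced:
  assumes A: "A \<in> carrier_mat e e" shows "mtrace (reduced_mat e d A) = mtrace A"
proof -
  have "mtrace (reduced_mat e d A) = (\<Sum>i<e + d. reduced_mat e d A $$ (i, i))"
    by (rule mtrace_entries[OF reduced_mat_carrier[OF A]])
  also have "\<dots> = (\<Sum>i<e. A $$ (i, i))"
    using A by (intro sum.mono_neutral_cong_right) (auto simp: reduced_mat_def)
  finally show ?thesis using A by (simp add: mtrace_entries[of _ e])
qed

text \<open>
  Otherwise there are nonzero \<open>v\<close> with \<open>B2 v = 0\<close> and, because \<open>d \<le> e\<close>, also \<open>\<xi>\<close> with \<open>\<xi> B2 = 0\<close>. Then the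
  matrix with lower left block \<open>v \<xi>\<close> is a nilpotent endomorphism.
\<close>

lemma brick_injective:
  assumes br: "brick (e + d) e (four_block_mat B1 B2 B3 B4)" and d: "0 < d" "d \<le> e"
    and B: "B1 \<in> carrier_mat e e" "B2 \<in> carrier_mat e d" "B3 \<in> carrier_mat d e" "B4 \<in> carrier_mat d d"
  shows "injective_mat e d B2"
proof (rule ccontr)
  assume ninj: "\<not> injective_mat e d B2"
  then have "\<exists>v. (\<forall>i<e. (\<Sum>j<d. B2 $$ (i, j) * v j) = 0) \<and> (\<exists>l<d. v l \<noteq> 0)"
    unfolding injective_mat_def by simp
  then obtain v l where v1: "\<forall>i<e. (\<Sum>j<d. B2 $$ (i, j) * v j) = 0" and l: "l < d" "v l \<noteq> 0"
    by (elim exE conjE)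
  note v = v1[rule_format] l
  have "d < e \<or> d = e \<and> \<not> injective_mat e d B2" using ninj d by auto
  from left_kernel_exists[OF this]
  obtain \<xi> k where \<xi>0: "k < e" "\<xi> k \<noteq> 0" "\<forall>j<d. (\<Sum>i<e. \<xi> i * B2 $$ (i, j)) = 0"
    by (elim exE conjE)
  note \<xi> = \<xi>0(1,2) \<xi>0(3)[rule_format]
  define Y where "Y = Matrix.mat d e (\<lambda>(i, j). v i * \<xi> j)"
  have Y: "Y \<in> carrier_mat d e" by (simp add: Y_def)
  have BY: "B2 * Y = 0\<^sub>m e e"
  proof (rule eq_matI)
    fix i j assume "i < dim_row (0\<^sub>m e e :: complex mat)" "j < dim_col (0\<^sub>m e e :: complex mat)"
    hence ij: "i < e" "j < e" by auto
    have "(B2 * Y) $$ (i, j) = (\<Sum>l<d. B2 $$ (i, l) * v l * \<xi> j)"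
      using ij by (subst mat_mult_entry[OF B(2) Y]) (auto simp: Y_def mult.assoc)
    also have "\<dots> = 0" using v(1)[OF ij(1)] by (simp flip: sum_distrib_right)
    finally show "(B2 * Y) $$ (i, j) = 0\<^sub>m e e $$ (i, j)" using ij by simp
  qed (use B Y in auto)
  have YB: "Y * B2 = 0\<^sub>m d d"
  proof (rule eq_matI)
    fix i j assume "i < dim_row (0\<^sub>m d d :: complex mat)" "j < dim_col (0\<^sub>m d d :: complex mat)"
    hence ij: "i < d" "j < d" by auto
    have "(Y * B2) $$ (i, j) = (\<Sum>l<e. v i * (\<xi> l * B2 $$ (l, j)))"
      using ij by (subst mat_mult_entry[OF Y B(2)]) (auto simp: Y_def mult.assoc)
    also have "\<dots> = 0" using \<xi>(3)[OF ij(2)] by (simp flip: sum_distrib_left)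
    finally show "(Y * B2) $$ (i, j) = 0\<^sub>m d d $$ (i, j)" using ij by simp
  qed (use B Y in auto)
  let ?F = "four_block_mat (0\<^sub>m e e) (0\<^sub>m e d) Y (0\<^sub>m d d)"
  have "?F \<in> homs (e + d) e (four_block_mat B1 B2 B3 B4) (four_block_mat B1 B2 B3 B4)"
    using Y B BY YB by (intro homs_four_block) auto
  with br obtain c where c: "?F = c \<cdot>\<^sub>m 1\<^sub>m (e + d)" by (rule brickE)
  have "?F $$ (0, 0) = (c \<cdot>\<^sub>m 1\<^sub>m (e + d)) $$ (0, 0)" by (simp only: c)
  hence "c = 0" using d by simp
  have "?F $$ (e + l, k) = (c \<cdot>\<^sub>m 1\<^sub>m (e + d)) $$ (e + l, k)" by (simp only: c)
  hence "v l * \<xi> k = 0" using \<open>c = 0\<close> v \<xi> Y by (simp add: Y_def)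
  thus False using v \<xi> by simp
qed

text \<open>
  Row operations turn the injective block \<open>B2\<close> into the last columns of the identity. The lower left block of the
  base change is chosen to cancel \<open>B4\<close>; the block below \<open>B1\<close> is arbitrary anyway.
\<close>

lemma brick_reduce:
  assumes br: "brick (e + d) e B" and d: "0 < d" "d \<le> e"
  obtains A where "A \<in> carrier_mat e e" "isomorphic (e + d) e B (reduced_mat e d A)"
proof -
  have Bc: "B \<in> carrier_mat (e + d) (e + d)" using br by (simp add: brick_def)
  obtain B1 B2 B3 B4 where sp: "split_block B e e = (B1, B2, B3, B4)" by (metis prod_cases4)
  have B: "B1 \<in> carrier_mat e e" "B2 \<in> carrier_mat e d" "B3 \<in> carrier_mat d e" "B4 \<in> carrier_mat d d"
    and Beq: "B = four_block_mat B1 B2 B3 B4"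
    using split_block[OF sp, of d d] Bc by auto
  have "injective_mat e d B2" using brick_injective[OF br[unfolded Beq] d B] .
  then obtain P P' where P: "P \<in> carrier_mat e e" "P' \<in> carrier_mat e e" "P * P' = 1\<^sub>m e" "P' * P = 1\<^sub>m e"
    and PB: "P * B2 = last_cols e d" using injective_normalize[OF _ B(2) d(2)] by metis
  let ?N = "last_cols e d"
  have PN: "P' * ?N = B2"
    using P B by (simp flip: PB assoc_mult_mat[of _ e e _ e _ d])
  \<comment> \<open>The last \<open>d\<close> rows of \<open>P\<close> form a left inverse of \<open>B2\<close>.\<close>
  define R where "R = Matrix.mat d e (\<lambda>(i, j). if j = i + (e - d) then 1 else 0 :: complex) * P"
  have R: "R \<in> carrier_mat d e" using P by (auto simp: R_def)
  have RB: "R * B2 = 1\<^sub>m d"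
  proof -
    have "R * B2 = Matrix.mat d e (\<lambda>(i, j). if j = i + (e - d) then 1 else 0) * ?N"
      unfolding R_def using P B PB by (subst assoc_mult_mat[of _ d e _ e _ d]) auto
    also have "\<dots> = 1\<^sub>m d"
    proof (rule eq_matI)
      fix i j assume "i < dim_row (1\<^sub>m d :: complex mat)" "j < dim_col (1\<^sub>m d :: complex mat)"
      thus "(Matrix.mat d e (\<lambda>(i, j). if j = i + (e - d) then 1 else 0) * ?N) $$ (i, j) = 1\<^sub>m d $$ (i, j)"
        using d by (subst mult_last_cols[of _ d]) auto
    qed auto
    finally show ?thesis .
  qed
  \<comment> \<open>This choice clears the lower right block.\<close>
  define Y where "Y = - (B4 * R)"
  have Y: "Y \<in> carrier_mat d e" using B R by (auto simp: Y_def)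
  have YB: "Y * B2 = - B4"
    unfolding Y_def using B R RB by (simp add: assoc_mult_mat[of _ d d _ e _ d])
  define A where "A = (P * B1 - ?N * Y) * P'"
  have A: "A \<in> carrier_mat e e" using P B Y by (auto simp: A_def)
  have AP: "A * P = P * B1 - ?N * Y"
  proof -
    have "A * P = (P * B1 - ?N * Y) * (P' * P)"
      unfolding A_def by (rule assoc_mult_mat) (use P B Y in auto)
    also have "\<dots> = P * B1 - ?N * Y"
      using P B Y by (simp add: minus_carrier_mat[of _ e e] right_mult_one_mat[of _ e e] mult_carrier_mat[of _ e d _ e])
    finally show ?thesis .
  qed
  define Y' where "Y' = - (Y * P')"
  have Y': "Y' \<in> carrier_mat d e" using Y P by (auto simp: Y'_def)
  have eq1: "P * B1 = A * P + ?N * Y"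
    unfolding AP using P B Y by (intro eq_matI) auto
  have YP: "Y * P' * P = Y" using Y P by (simp add: assoc_mult_mat[of _ d e _ e _ e])
  have eq2: "P' * A = B1 * P' + B2 * Y'"
  proof -
    have "P' * A = P' * (P * B1 - ?N * Y) * P'"
      unfolding A_def by (rule assoc_mult_mat[symmetric]) (use P B Y in auto)
    also have "P' * (P * B1 - ?N * Y) = P' * (P * B1) - P' * (?N * Y)"
      by (rule mult_minus_distrib_mat) (use P B Y in auto)
    also have "P' * (P * B1) = P' * P * B1"
      by (rule assoc_mult_mat[symmetric]) (use P B Y in auto)
    also have "P' * (?N * Y) = P' * ?N * Y"
      by (rule assoc_mult_mat[symmetric]) (use P B Y in auto)
    also have "(P' * P * B1 - P' * ?N * Y) * P' = P' * P * B1 * P' - P' * ?N * Y * P'"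
      by (rule minus_mult_distrib_mat) (use P B Y PN in auto)
    also have "P' * P * B1 * P' = B1 * P'" using P B by simp
    also have "P' * ?N * Y * P' = B2 * (Y * P')"
      unfolding PN by (rule assoc_mult_mat) (use P B Y in auto)
    also have "B1 * P' - B2 * (Y * P') = B1 * P' + B2 * Y'"
    proof -
      have "B2 * Y' = - (B2 * (Y * P'))" unfolding Y'_def
        using B P Y by (simp add: uminus_mult_right_mat)
      thus ?thesis using B P Y by (intro eq_matI) auto
    qed
    finally show ?thesis .
  qed
  have Y'N: "Y' * ?N = B4"
  proof -
    have "Y' * ?N = - (Y * P' * ?N)" unfolding Y'_def using Y P by simp
    also have "Y * P' * ?N = Y * (P' * ?N)" by (rule assoc_mult_mat) (use P B Y in auto)
    finally show ?thesis using PN YB B by simp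
  qed
  let ?F = "four_block_mat P (0\<^sub>m e d) Y (1\<^sub>m d)" and ?G = "four_block_mat P' (0\<^sub>m e d) Y' (1\<^sub>m d)"
  have F: "?F \<in> homs (e + d) e B (reduced_mat e d A)" unfolding Beq reduced_mat_def
    using P Y B A eq1 PB YB by (intro homs_four_block) (auto simp: uminus_l_inv_mat)
  have G: "?G \<in> homs (e + d) e (reduced_mat e d A) B" unfolding Beq reduced_mat_def
    using P Y' B A eq2 PN Y'N by (intro homs_four_block) auto
  have "Y * P' + Y' = 0\<^sub>m d e" unfolding Y'_def using Y P by (intro eq_matI) auto
  hence "?F * ?G = four_block_mat (1\<^sub>m e) (0\<^sub>m e d) (0\<^sub>m d e) (1\<^sub>m d)"
    using P Y Y' mult_four_block_mat[OF P(1) zero_carrier_mat Y one_carrier_mat P(2) zero_carrier_mat Y' one_carrier_mat]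
    by simp
  moreover have "Y' * P + Y = 0\<^sub>m d e"
  proof -
    have "Y' * P = - (Y * P' * P)" unfolding Y'_def using Y P by (simp add: uminus_mult_left_mat)
    thus ?thesis unfolding YP using Y by (intro eq_matI) auto
  qed
  hence "?G * ?F = four_block_mat (1\<^sub>m e) (0\<^sub>m e d) (0\<^sub>m d e) (1\<^sub>m d)"
    using P Y Y' mult_four_block_mat[OF P(2) zero_carrier_mat Y' one_carrier_mat P(1) zero_carrier_mat Y one_carrier_mat]
    by simp
  ultimately have "isomorphic (e + d) e B (reduced_mat e d A)"
    unfolding isomorphic_def by (intro bexI[OF _ F] bexI[OF _ G] conjI) simp_all
  thus ?thesis using that A by blast
qed

text \<open>
  The functor from the smaller matrix problem to the larger one. The lower left block is forced: multiplied by
  \<open>last_cols\<close> it has to be the defect \<open>F A - A' F\<close>, which is concentrated in the last \<open>d\<close> rows because \<open>F\<close> is a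
  homomorphism.
\<close>

definition lift_hom :: "nat \<Rightarrow> nat \<Rightarrow> complex mat \<Rightarrow> complex mat \<Rightarrow> complex mat \<Rightarrow> complex mat" where
  "lift_hom e d A A' F = four_block_mat F (0\<^sub>m e d)
     (Matrix.mat d e (\<lambda>(i, j). (F * A - A' * F) $$ (i + (e - d), j)))
     (Matrix.mat d d (\<lambda>(i, j). F $$ (i + (e - d), j + (e - d))))"

text \<open>
  Multiplication by \<open>last_cols\<close> on the left puts the rows of a matrix below \<open>e - d\<close> zero rows, so a matrix with
  vanishing top rows is recovered from its bottom rows.
\<close>

lemma last_cols_mult_rows:
  assumes X: "X \<in> carrier_mat e m" and d: "d \<le> e"
    and top: "\<And>i j. i < e - d \<Longrightarrow> j < m \<Longrightarrow> X $$ (i, j) = 0"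
  shows "last_cols e d * Matrix.mat d m (\<lambda>(i, j). X $$ (i + (e - d), j)) = X"
proof (rule eq_matI)
  fix i j assume "i < dim_row X" "j < dim_col X"
  hence ij: "i < e" "j < m" using X by auto
  let ?Y = "Matrix.mat d m (\<lambda>(i, j). X $$ (i + (e - d), j))"
  have "(last_cols e d * ?Y) $$ (i, j) = (if e - d \<le> i then ?Y $$ (i - (e - d), j) else 0)"
    using d ij by (intro last_cols_mult) auto
  also have "\<dots> = X $$ (i, j)"
  proof (cases "e - d \<le> i")
    case True
    hence "i - (e - d) < d" "i - (e - d) + (e - d) = i" using ij d by auto
    thus ?thesis using True ij by (simp del: Nat.add_diff_assoc)
  qed (use top ij in auto)
  finally show "(last_cols e d * ?Y) $$ (i, j) = X $$ (i, j)" .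
qed (use X in auto)

text \<open>
  The two identities that characterize the lower blocks of \<open>lift_hom\<close>.
\<close>

lemma
  assumes F: "F \<in> homs e (e - d) A A'" and A: "A \<in> carrier_mat e e" "A' \<in> carrier_mat e e"
    and d: "d \<le> e"
  shows lift_hom_left: "last_cols e d * Matrix.mat d e (\<lambda>(i, j). (F * A - A' * F) $$ (i + (e - d), j)) = F * A - A' * F"
    and lift_hom_right: "last_cols e d * Matrix.mat d d (\<lambda>(i, j). F $$ (i + (e - d), j + (e - d))) = F * last_cols e d"
proof -
  have c: "F \<in> carrier_mat e e" using F homs_carrier by blast
  have L: "F * A - A' * F \<in> corner e (e - d)" and bl: "F \<in> block_lower e (e - d)" using F by (auto simp: homs_def)
  show "last_cols e d * Matrix.mat d e (\<lambda>(i, j). (F * A - A' * F) $$ (i + (e - d), j)) = F * A - A' * F"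
  proof (rule last_cols_mult_rows[OF _ d])
    fix i j assume ij: "i < e - d" "j < e"
    show "(F * A - A' * F) $$ (i, j) = 0"
    proof (rule ccontr)
      assume "(F * A - A' * F) $$ (i, j) \<noteq> 0"
      moreover have "i < e" using ij by simp
      ultimately have "e - d \<le> i" using L ij unfolding corner_def by blast
      thus False using ij by simp
    qed
  qed (use corner_carrier[OF L] in simp)
  have "(F * last_cols e d) $$ (i, j) = F $$ (i, j + (e - d))" if "i < e" "j < d" for i j
    using c d that by (rule mult_last_cols)
  hence eq: "Matrix.mat d d (\<lambda>(i, j). F $$ (i + (e - d), j + (e - d))) =
        Matrix.mat d d (\<lambda>(i, j). (F * last_cols e d) $$ (i + (e - d), j))"
    using d by (intro eq_matI) (simp_all del: Nat.add_diff_assoc index_mult_mat)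
  show "last_cols e d * Matrix.mat d d (\<lambda>(i, j). F $$ (i + (e - d), j + (e - d))) = F * last_cols e d"
    unfolding eq
  proof (rule last_cols_mult_rows[OF _ d])
    fix i j assume ij: "i < e - d" "j < d"
    have "i < e" using ij by simp
    with c d have "(F * last_cols e d) $$ (i, j) = F $$ (i, j + (e - d))"
      using ij(2) by (rule mult_last_cols)
    also have "\<dots> = 0" using bl ij d by (auto simp: block_lower_def)
    finally show "(F * last_cols e d) $$ (i, j) = 0" .
  qed (use c in auto)
qed

lemma lift_hom_in_homs:
  assumes F: "F \<in> homs e (e - d) A A'" and A: "A \<in> carrier_mat e e" "A' \<in> carrier_mat e e"
    and d: "d \<le> e"
  shows "lift_hom e d A A' F \<in> homs (e + d) e (reduced_mat e d A) (reduced_mat e d A')"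
proof -
  have c: "F \<in> carrier_mat e e" using F homs_carrier by blast
  have L: "F * A - A' * F \<in> corner e (e - d)" using F by (auto simp: homs_def)
  let ?Y = "Matrix.mat d e (\<lambda>(i, j). (F * A - A' * F) $$ (i + (e - d), j))"
  let ?Z = "Matrix.mat d d (\<lambda>(i, j). F $$ (i + (e - d), j + (e - d)))"
  have "F * A = A' * F + (F * A - A' * F)" using c A by (intro eq_matI) auto
  hence "F * A = A' * F + last_cols e d * ?Y" by (simp only: lift_hom_left[OF F A d])
  moreover have "F * last_cols e d = last_cols e d * ?Z"
    using lift_hom_right[OF F A d] by simp
  moreover have YN: "?Y * last_cols e d = 0\<^sub>m d d"
  proof (rule eq_matI)
    fix i j assume "i < dim_row (0\<^sub>m d d :: complex mat)" "j < dim_col (0\<^sub>m d d :: complex mat)"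
    hence ij: "i < d" "j < d" by auto
    have "(?Y * last_cols e d) $$ (i, j) = ?Y $$ (i, j + (e - d))"
      using ij d by (intro mult_last_cols) auto
    also have "\<dots> = (F * A - A' * F) $$ (i + (e - d), j + (e - d))"
      using ij d by (simp del: Nat.add_diff_assoc)
    also have "\<dots> = 0"
    proof (rule ccontr)
      assume "(F * A - A' * F) $$ (i + (e - d), j + (e - d)) \<noteq> 0"
      moreover have "i + (e - d) < e" "j + (e - d) < e" using ij d by auto
      ultimately have "j + (e - d) < e - d" using L unfolding corner_def by blast
      thus False by simp
    qed
    finally show "(?Y * last_cols e d) $$ (i, j) = 0\<^sub>m d d $$ (i, j)" using ij by simp
  qed auto
  moreover have "?Y * last_cols e d + ?Z * 0\<^sub>m d d = 0\<^sub>m d d * ?Z"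
    unfolding YN by simp
  ultimately show ?thesis
    unfolding lift_hom_def reduced_mat_def using c A by (intro homs_four_block) simp_all
qed

text \<open>
  The lower blocks of the product are compared after multiplication by \<open>last_cols\<close>, which is injective; there the
  two defects cancel.
\<close>

lemma lift_hom_inverse:
  assumes F: "F \<in> homs e (e - d) A A'" and G: "G \<in> homs e (e - d) A' A"
    and A: "A \<in> carrier_mat e e" "A' \<in> carrier_mat e e" and d: "d \<le> e"
    and FG: "F * G = 1\<^sub>m e"
  shows "lift_hom e d A A' F * lift_hom e d A' A G = 1\<^sub>m (e + d)"
proof -
  have c: "F \<in> carrier_mat e e" "G \<in> carrier_mat e e" using F G homs_carrier by blast+
  let ?N = "last_cols e d"
  define Y where "Y = Matrix.mat d e (\<lambda>(i, j). (F * A - A' * F) $$ (i + (e - d), j))"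
  define Z where "Z = Matrix.mat d d (\<lambda>(i, j). F $$ (i + (e - d), j + (e - d)))"
  define Y' where "Y' = Matrix.mat d e (\<lambda>(i, j). (G * A' - A * G) $$ (i + (e - d), j))"
  define Z' where "Z' = Matrix.mat d d (\<lambda>(i, j). G $$ (i + (e - d), j + (e - d)))"
  have YZ: "Y \<in> carrier_mat d e" "Y' \<in> carrier_mat d e" "Z \<in> carrier_mat d d" "Z' \<in> carrier_mat d d"
    by (simp_all add: Y_def Z_def Y'_def Z'_def)
  have N: "?N * Y = F * A - A' * F" "?N * Z = F * ?N" "?N * Y' = G * A' - A * G" "?N * Z' = G * ?N"
    unfolding Y_def Z_def Y'_def Z'_def
    using lift_hom_left[OF F A d] lift_hom_right[OF F A d] lift_hom_left[OF G A(2,1) d] lift_hom_right[OF G A(2,1) d]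
    by simp_all
  have NZX: "?N * (Z * X) = F * (?N * X)" if "X \<in> carrier_mat d m" for X m
  proof -
    have "?N * (Z * X) = ?N * Z * X" using YZ that by (intro assoc_mult_mat[symmetric, of _ e d _ d _ m]) auto
    also have "\<dots> = F * (?N * X)" unfolding N using c that by (intro assoc_mult_mat[of _ e e _ d _ m]) auto
    finally show ?thesis .
  qed
  have ZZ: "Z * Z' = 1\<^sub>m d"
  proof (rule last_cols_cancel[OF _ _ d])
    have "?N * (Z * Z') = F * (G * ?N)" using NZX[OF YZ(4)] N by simp
    also have "\<dots> = F * G * ?N" using c by (intro assoc_mult_mat[symmetric, of _ e e _ e _ d]) auto
    finally show "?N * (Z * Z') = ?N * 1\<^sub>m d" using FG by (simp add: left_mult_one_mat[of _ e d] right_mult_one_mat[of _ e d])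
  qed (use YZ in auto)
  have YY: "Y * G + Z * Y' = 0\<^sub>m d e"
  proof (rule last_cols_cancel[OF _ _ d])
    have "?N * (Y * G + Z * Y') = ?N * (Y * G) + ?N * (Z * Y')"
      using YZ c by (intro mult_add_distrib_mat[of _ e d _ e]) auto
    also have "?N * (Y * G) = ?N * Y * G"
      using YZ c by (intro assoc_mult_mat[symmetric, of _ e d _ e _ e]) auto
    also have "\<dots> = F * A * G - A' * F * G"
      unfolding N using c A by (intro minus_mult_distrib_mat[of _ e e _ _ e]) auto
    also have "A' * F * G = A'" using c A FG by (simp add: assoc_mult_mat[of _ e e _ e _ e])
    also have "?N * (Z * Y') = F * (G * A' - A * G)"
      using NZX[OF YZ(2)] N by simp
    also have "\<dots> = F * (G * A') - F * (A * G)"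
      using c A by (intro mult_minus_distrib_mat[of _ e e _ e]) auto
    also have "F * (G * A') = F * G * A'" using c A by (simp add: assoc_mult_mat[of _ e e _ e _ e])
    also have "F * (A * G) = F * A * G" using c A by (simp add: assoc_mult_mat[of _ e e _ e _ e])
    finally show "?N * (Y * G + Z * Y') = ?N * 0\<^sub>m d e"
      using c A FG by (auto intro!: eq_matI simp: right_mult_zero_mat[of _ e d])
  qed (use YZ c in auto)
  have "lift_hom e d A A' F * lift_hom e d A' A G =
      four_block_mat F (0\<^sub>m e d) Y Z * four_block_mat G (0\<^sub>m e d) Y' Z'"
    by (simp add: lift_hom_def Y_def Z_def Y'_def Z'_def)
  also have "\<dots> = four_block_mat (F * G + 0\<^sub>m e d * Y') (F * 0\<^sub>m e d + 0\<^sub>m e d * Z') (Y * G + Z * Y') (Y * 0\<^sub>m e d + Z * Z')"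
    using YZ c by (intro mult_four_block_mat) auto
  also have "\<dots> = 1\<^sub>m (e + d)" using YZ c by (simp add: FG ZZ YY)
  finally show ?thesis .
qed

lemma reduced_isomorphic:
  assumes iso: "isomorphic e (e - d) A A'" and A: "A \<in> carrier_mat e e" "A' \<in> carrier_mat e e" and d: "d \<le> e"
  shows "isomorphic (e + d) e (reduced_mat e d A) (reduced_mat e d A')"
proof -
  obtain F G where FG: "F \<in> homs e (e - d) A A'" "G \<in> homs e (e - d) A' A" "F * G = 1\<^sub>m e" "G * F = 1\<^sub>m e"
    using iso by (auto simp: isomorphic_def)
  show ?thesis unfolding isomorphic_def
    by (intro bexI[OF _ lift_hom_in_homs[OF FG(1) A d]] bexI[OF _ lift_hom_in_homs[OF FG(2) A(2,1) d]] conjI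
      lift_hom_inverse[OF FG(1,2) A d FG(3)] lift_hom_inverse[OF FG(2,1) A(2,1) d FG(4)])
qed

lemma reduced_brick:
  assumes br: "brick (e + d) e (reduced_mat e d A)" and A: "A \<in> carrier_mat e e" and d: "d \<le> e"
  shows "brick e (e - d) A"
proof -
  have "\<exists>c. F = c \<cdot>\<^sub>m 1\<^sub>m e" if F: "F \<in> homs e (e - d) A A" for F
  proof -
    have c: "F \<in> carrier_mat e e" using F homs_carrier by blast
    from br lift_hom_in_homs[OF F A A d]
    obtain k where k: "lift_hom e d A A F = k \<cdot>\<^sub>m 1\<^sub>m (e + d)" by (rule brickE)
    have "F = k \<cdot>\<^sub>m 1\<^sub>m e"
    proof (rule eq_matI)
      fix i j assume "i < dim_row (k \<cdot>\<^sub>m 1\<^sub>m e)" "j < dim_col (k \<cdot>\<^sub>m 1\<^sub>m e)"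
      hence ij: "i < e" "j < e" by auto
      have "lift_hom e d A A F $$ (i, j) = (k \<cdot>\<^sub>m 1\<^sub>m (e + d)) $$ (i, j)" by (simp only: k)
      thus "F $$ (i, j) = (k \<cdot>\<^sub>m 1\<^sub>m e) $$ (i, j)" using ij c by (simp add: lift_hom_def)
    qed (use c in auto)
    thus ?thesis by blast
  qed
  thus ?thesis using A by (auto simp: brick_def)
qed

text \<open>
  With one empty block the homomorphisms are the intertwiners of \<open>B\<close>. Then \<open>B\<close> is an endomorphism of itself,
  hence scalar, all matrices are endomorphisms, and so \<open>n \<le> 1\<close>.
\<close>

lemma brick_isomorphic_degenerate:
  assumes br: "brick n e B" "brick n e B'" and e: "e = 0 \<or> e = n" and tr: "mtrace B = mtrace B'"
  shows "isomorphic n e B B'"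
proof -
  have B: "B \<in> carrier_mat n n" "B' \<in> carrier_mat n n" using br by (auto simp: brick_def)
  have hom: "F \<in> homs n e B B" if "F \<in> carrier_mat n n" "F * B = B * F" for F
    using that B e by (auto simp: homs_def block_lower_def corner_def)
  obtain c where c: "B = c \<cdot>\<^sub>m 1\<^sub>m n" using brickE[OF br(1) hom[OF B(1) refl]] by blast
  have "n \<le> 1"
  proof (rule ccontr)
    assume "\<not> n \<le> 1"
    hence n: "1 < n" by simp
    define F :: "complex mat" where "F = Matrix.mat n n (\<lambda>(i, j). if i = 0 \<and> j = 1 then 1 else 0)"
    have F: "F \<in> carrier_mat n n" by (simp add: F_def)
    have "F * B = B * F" unfolding c using F
      by (simp add: mult_smult_distrib[of _ n n _ n] mult_smult_assoc_mat[of _ n n _ n])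
    then obtain k where k: "F = k \<cdot>\<^sub>m 1\<^sub>m n" using brickE[OF br(1) hom[OF F]] by blast
    have "F $$ (0, 1) = (k \<cdot>\<^sub>m 1\<^sub>m n) $$ (0, 1)" by (simp only: k)
    thus False using n by (simp add: F_def)
  qed
  hence "B = B'" using tr B by (intro eq_matI) (auto simp: mtrace_entries[of _ n] le_Suc_eq)
  thus ?thesis using homs_one[OF B(1)] unfolding isomorphic_def by (intro bexI[of _ "1\<^sub>m n"]) auto
qed

text \<open>
  Euclidean algorithm on the block sizes \<open>(f, n - f)\<close>. If \<open>n - f \<le> f\<close>, both bricks are reduced to matrices of size
  \<open>f\<close>, split at \<open>f - (n - f)\<close>; they are again bricks of the same trace, and the isomorphism between them lifts. The other
  case follows by reflection.
\<close>

theorem brick_isomorphic: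
  assumes "e \<le> n" "brick n e B" "brick n e B'" "mtrace B = mtrace B'"
  shows "isomorphic n e B B'"
  using assms
proof (induction n arbitrary: e B B' rule: less_induct)
  case (less n)
  have main: "isomorphic n f B B'"
    if f: "f \<le> n" "n - f \<le> f" and br: "brick n f B" "brick n f B'" and tr: "mtrace B = mtrace B'" for f B B'
  proof (cases "f = n \<or> f = 0")
    case True
    thus ?thesis using brick_isomorphic_degenerate br tr by blast
  next
    case False
    define d where "d = n - f"
    have d: "0 < d" "d \<le> f" and n: "n = f + d" and fn: "f < n" using f False by (auto simp: d_def)
    have Bc: "B \<in> carrier_mat (f + d) (f + d)" "B' \<in> carrier_mat (f + d) (f + d)" using br by (auto simp: brick_def n)
    obtain A where A: "A \<in> carrier_mat f f" "isomorphic (f + d) f B (reduced_mat f d A)"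
      using brick_reduce[OF br(1)[unfolded n] d] by blast
    obtain A' where A': "A' \<in> carrier_mat f f" "isomorphic (f + d) f B' (reduced_mat f d A')"
      using brick_reduce[OF br(2)[unfolded n] d] by blast
    note R = reduced_mat_carrier[OF A(1), of d] reduced_mat_carrier[OF A'(1), of d]
    have le: "f \<le> f + d" by simp
    have "brick f (f - d) A"
      by (rule reduced_brick[OF isomorphic_brick[OF A(2) br(1)[unfolded n] le R(1)] A(1) d(2)])
    moreover have "brick f (f - d) A'"
      by (rule reduced_brick[OF isomorphic_brick[OF A'(2) br(2)[unfolded n] le R(2)] A'(1) d(2)])
    moreover have "mtrace A = mtrace A'"
      using isomorphic_mtrace[OF A(2) le Bc(1) R(1)] isomorphic_mtrace[OF A'(2) le Bc(2) R(2)] tr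
      by (simp add: mtrace_reduced A A')
    ultimately have "isomorphic f (f - d) A A'"
      using less.IH[OF fn, of "f - d" A A'] by simp
    hence "isomorphic (f + d) f (reduced_mat f d A) (reduced_mat f d A')"
      using A A' d by (intro reduced_isomorphic) auto
    hence "isomorphic (f + d) f B (reduced_mat f d A')"
      using isomorphic_trans[OF A(2) _ le Bc(1) R] by blast
    hence "isomorphic (f + d) f B B'"
      using isomorphic_trans[OF _ isomorphic_sym[OF A'(2)] le Bc(1) R(2) Bc(2)] by blast
    thus ?thesis by (simp add: n)
  qed
  show ?case
  proof (cases "n - e \<le> e")
    case True
    thus ?thesis using main[of e B B'] less.prems by blast
  next
    case False
    have B: "B \<in> carrier_mat n n" "B' \<in> carrier_mat n n" using less.prems by (auto simp: brick_def)
    have "isomorphic n (n - e) (flip_mat n B) (flip_mat n B')"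
      using False less.prems B by (intro main flip_brick) (auto simp: mtrace_flip)
    from flip_isomorphic[OF this] show ?thesis using less.prems B by (simp add: flip_flip)
  qed
qed

section \<open>Expansion at the cusp\<close>

text \<open>
  The Laurent expansion of \<open>p(z)\<close> in the local parameter \<open>t = 1 / z\<close> at the cusp.
\<close>

definition expand_poly :: "complex poly \<Rightarrow> complex fls" where
  "expand_poly p = poly (map_poly fls_const p) fls_X_inv"

interpretation fls_const_hom: comm_ring_hom "fls_const :: complex \<Rightarrow> complex fls"
  by unfold_locales (simp_all add: fls_plus_const fls_const_mult_const)

interpretation fls_const_poly_hom: map_poly_comm_ring_hom "fls_const :: complex \<Rightarrow> complex fls" ..

lemma expand_poly_hom: "expand_poly (p + q) = expand_poly p + expand_poly q" "expand_poly (p * q) = expand_poly p * expand_poly q" "expand_poly 1 = 1" "expand_poly 0 = 0"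
  "expand_poly (- p) = - expand_poly p"
  by (simp_all add: expand_poly_def hom_distribs)

lemma expand_poly_nth: "fls_nth (expand_poly p) k = (if k \<le> 0 then poly.coeff p (nat (- k)) else 0)"
proof (induction p arbitrary: k)
  case 0
  thus ?case by (simp add: expand_poly_hom)
next
  case (pCons a p)
  have "expand_poly (pCons a p) = fls_const a + fls_X_inv * expand_poly p"
    using pCons(1) by (simp add: expand_poly_def map_poly_pCons)
  hence "fls_nth (expand_poly (pCons a p)) k = (if k = 0 then a else 0) + fls_nth (expand_poly p) (k + 1)"
    by (simp add: fls_X_inv_times_conv_shift)
  moreover have "poly.coeff (pCons a p) (nat (- k)) = poly.coeff p (nat (- (k + 1)))" if "k < 0"
  proof -
    have "nat (- k) = Suc (nat (- (k + 1)))" using that by simp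
    thus ?thesis by simp
  qed
  ultimately show ?case by (auto simp: pCons(2))
qed

lemma expand_poly_eq_0_iff: "expand_poly p = 0 \<longleftrightarrow> p = 0"
proof
  assume 0: "expand_poly p = 0"
  have "poly.coeff p k = 0" for k using expand_poly_nth[of p "- int k"] by (simp add: 0)
  thus "p = 0" by (simp add: poly_eq_iff)
qed (simp add: expand_poly_hom)

lemma expand_poly_subdegree: "fls_subdegree (expand_poly p) = - int (degree p)"
proof (cases "p = 0")
  case False
  show ?thesis
    by (rule fls_subdegree_eqI) (use False in \<open>auto simp: expand_poly_nth coeff_eq_0\<close>)
qed (simp add: expand_poly_hom)

text \<open>
  The expansion of a rational function in \<open>t\<close>. It does not depend on the chosen fraction (\<open>expand_Fract\<close>), and
  it is an embedding of fields, so orders of vanishing and Taylor coefficients at the cusp can be read off there.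
\<close>

definition expand :: "ratfun \<Rightarrow> complex fls" where
  "expand f = (SOME g. \<exists>p q. q \<noteq> 0 \<and> f = Fraction_Field.Fract p q \<and> g = expand_poly p / expand_poly q)"

abbreviation tc :: "ratfun \<Rightarrow> int \<Rightarrow> complex" where "tc f k \<equiv> fls_nth (expand f) k"

lemma expand_Fract:
  assumes "q \<noteq> 0" shows "expand (Fraction_Field.Fract p q) = expand_poly p / expand_poly q"
  unfolding expand_def
proof (rule some_equality)
  show "\<exists>p' q'. q' \<noteq> 0 \<and> Fraction_Field.Fract p q = Fraction_Field.Fract p' q' \<and> expand_poly p / expand_poly q = expand_poly p' / expand_poly q'"
    using assms by blast
next
  fix g assume "\<exists>p' q'. q' \<noteq> 0 \<and> Fraction_Field.Fract p q = Fraction_Field.Fract p' q' \<and> g = expand_poly p' / expand_poly q'"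
  then obtain p' q' where pq: "q' \<noteq> 0" "Fraction_Field.Fract p q = Fraction_Field.Fract p' q'" "g = expand_poly p' / expand_poly q'" by blast
  hence "p * q' = p' * q" using assms by (simp add: eq_fract)
  hence "expand_poly p * expand_poly q' = expand_poly p' * expand_poly q" by (metis expand_poly_hom(2))
  thus "g = expand_poly p / expand_poly q" using pq assms by (simp add: frac_eq_eq expand_poly_eq_0_iff)
qed

lemma expand_to_fract: "expand (to_fract p) = expand_poly p"
  by (simp add: to_fract_def expand_Fract expand_poly_hom)

interpretation expand_hom: field_hom expand
proof unfold_locales
  fix f g :: ratfun
  obtain p q where f: "f = Fraction_Field.Fract p q" "q \<noteq> 0" by (cases f) auto
  obtain p' q' where g: "g = Fraction_Field.Fract p' q'" "q' \<noteq> 0" by (cases g) auto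
  have nz: "expand_poly q \<noteq> 0" "expand_poly q' \<noteq> 0" using f g by (simp_all add: expand_poly_eq_0_iff)
  show "expand (f + g) = expand f + expand g" using f g nz by (simp add: expand_Fract expand_poly_hom divide_simps)
  show "expand (f * g) = expand f * expand g" using f g nz by (simp add: expand_Fract expand_poly_hom)
next
  show "expand 0 = 0" by (simp add: Zero_fract_def expand_Fract expand_poly_hom)
  show "expand 1 = 1" by (simp add: One_fract_def expand_Fract expand_poly_hom)
qed

lemma expand_inj: "expand f = expand g \<longleftrightarrow> f = g"
  by (rule expand_hom.eq_iff)

lemma expand_const: "expand (const_fun c) = fls_const c"
  by (rule fls_eqI) (auto simp: const_fun_def expand_to_fract expand_poly_nth nat_eq_iff2 coeff_pCons split: nat.splits)

lemma expand_z: "expand z_fun = fls_X_inv"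
  by (simp add: z_fun_def expand_to_fract expand_poly_def map_poly_pCons)

lemma expand_t: "expand (inverse z_fun) = fls_X"
  by (simp add: expand_hom.hom_inverse expand_z fls_inverse_X_inv)

lemma z_nonzero: "z_fun \<noteq> 0"
  by (metis expand_hom.hom_zero expand_z fls_X_inv_nonzero)

interpretation const_fun_hom: field_hom const_fun
proof unfold_locales
  fix a b show "const_fun (a + b) = const_fun a + const_fun b" "const_fun (a * b) = const_fun a * const_fun b"
    by (simp_all add: const_fun_def to_fract_def mult.commute)
qed (simp_all add: const_fun_def to_fract_def Zero_fract_def One_fract_def one_pCons)

text \<open>
  The local ring of the normalization at the point over the cusp: the functions without pole at \<open>t = 0\<close>.
\<close>

definition inf_ring :: "ratfun set" where
  "inf_ring = {f. \<forall>k<0. tc f k = 0}"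

lemma inf_ringD: "f \<in> inf_ring \<Longrightarrow> expand f = fps_to_fls (fls_regpart (expand f))"
  by (auto simp: inf_ring_def fls_eq_iff)

lemma inf_ring_iff: "f \<in> inf_ring \<longleftrightarrow> (\<exists>F. expand f = fps_to_fls F)"
  using inf_ringD[of f] by (auto simp: inf_ring_def)

lemma inf_ring_mult_coeffs:
  assumes "f \<in> inf_ring" "g \<in> inf_ring"
  shows "f * g \<in> inf_ring" "tc (f * g) 0 = tc f 0 * tc g 0"
    "tc (f * g) 1 = tc f 0 * tc g 1 + tc f 1 * tc g 0"
proof -
  obtain F G where FG: "expand f = fps_to_fls F" "expand g = fps_to_fls G" using assms by (auto simp: inf_ring_iff)
  have fg: "expand (f * g) = fps_to_fls (F * G)" by (simp add: expand_hom.hom_mult FG fls_times_fps_to_fls)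
  show "f * g \<in> inf_ring" using fg by (auto simp: inf_ring_iff)
  show "tc (f * g) 0 = tc f 0 * tc g 0" by (simp add: fg FG)
  show "tc (f * g) 1 = tc f 0 * tc g 1 + tc f 1 * tc g 0"
    by (simp add: fg FG fps_mult_nth)
qed

definition subring_set :: "'a :: comm_ring_1 set \<Rightarrow> bool" where
  "subring_set R \<longleftrightarrow> 0 \<in> R \<and> 1 \<in> R \<and> (\<forall>a\<in>R. - a \<in> R) \<and> (\<forall>a\<in>R. \<forall>b\<in>R. a + b \<in> R \<and> a * b \<in> R)"

lemma subring_inf: "subring_set inf_ring"
  using inf_ring_mult_coeffs(1)
  by (auto simp: subring_set_def inf_ring_def expand_hom.hom_add expand_hom.hom_uminus)

lemma const_in_inf: "const_fun c \<in> inf_ring"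
  by (auto simp: inf_ring_def expand_const)

lemma t_in_inf: "inverse z_fun \<in> inf_ring"
  by (auto simp: inf_ring_def expand_t)

lemma inf_ring_inverse:
  assumes f: "f \<in> inf_ring" and nz: "tc f 0 \<noteq> 0"
  shows "inverse f \<in> inf_ring"
proof -
  obtain F where F: "expand f = fps_to_fls F" using f by (auto simp: inf_ring_iff)
  have "fps_nth F 0 \<noteq> 0" using nz F by simp
  hence "expand (inverse f) = fps_to_fls (inverse F)"
    by (simp add: expand_hom.hom_inverse F fls_inverse_fps_to_fls)
  thus ?thesis by (auto simp: inf_ring_iff)
qed

lemma fps_to_fls_sum: "fps_to_fls (sum f A) = (\<Sum>i\<in>A. fps_to_fls (f i))"
  by (induction A rule: infinite_finite_induct) (simp_all add: fps_to_fls_plus)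

lemma expand_poly_in_t: "expand (poly_in_t P) = fps_to_fls (fps_of_poly P)"
proof -
  have "expand (poly_in_t P) = (\<Sum>i\<le>degree P. fls_const (poly.coeff P i) * fls_X ^ i)"
    by (simp add: poly_in_t_def expand_hom.hom_sum expand_hom.hom_mult expand_hom.hom_power expand_const expand_t)
  also have "\<dots> = fps_to_fls (\<Sum>i\<le>degree P. fps_const (poly.coeff P i) * fps_X ^ i)"
    by (simp add: fps_to_fls_sum fls_times_fps_to_fls fps_to_fls_power)
  also have "(\<Sum>i\<le>degree P. fps_const (poly.coeff P i) * fps_X ^ i) = fps_of_poly P"
    by (rule fps_ext) (auto simp: fps_sum_nth fps_X_power_nth if_distrib sum.delta coeff_eq_0 cong: if_cong)
  finally show ?thesis .
qed

text \<open>
  The inclusion from right to left needs a representation by polynomials without linear term. If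
  \<open>f = P(t) / Q(t)\<close> with \<open>Q(0) \<noteq> 0\<close>, then multiplying both by \<open>Q(0) - Q'(0) t\<close> removes the linear term of the denominator, and
  that of the numerator vanishes together with the linear coefficient of \<open>f\<close>.
\<close>

lemma cusp_ring_eq: "cusp_ring = {f \<in> inf_ring. tc f 1 = 0}"
proof (intro equalityI subsetI)
  fix f assume "f \<in> cusp_ring"
  then obtain P Q where PQ: "f = poly_in_t P / poly_in_t Q" "poly.coeff P 1 = 0" "poly.coeff Q 1 = 0" "poly.coeff Q 0 \<noteq> 0"
    by (auto simp: cusp_ring_def)
  have in_inf: "poly_in_t R \<in> inf_ring" for R by (auto simp: inf_ring_iff expand_poly_in_t)
  have nz: "tc (poly_in_t Q) 0 \<noteq> 0" using PQ by (simp add: expand_poly_in_t)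
  hence Qnz: "poly_in_t Q \<noteq> 0" by auto
  have "f = poly_in_t P * inverse (poly_in_t Q)" using PQ by (simp add: divide_inverse)
  hence f: "f \<in> inf_ring" using inf_ring_mult_coeffs(1) in_inf inf_ring_inverse[OF in_inf nz] by simp
  have "tc (f * poly_in_t Q) 1 = tc f 0 * tc (poly_in_t Q) 1 + tc f 1 * tc (poly_in_t Q) 0"
    by (rule inf_ring_mult_coeffs(3)[OF f in_inf])
  moreover have "f * poly_in_t Q = poly_in_t P" using PQ Qnz by simp
  ultimately show "f \<in> {f \<in> inf_ring. tc f 1 = 0}" using f PQ nz by (simp add: expand_poly_in_t)
next
  fix f assume "f \<in> {f \<in> inf_ring. tc f 1 = 0}"
  hence f: "f \<in> inf_ring" "tc f 1 = 0" by auto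
  show "f \<in> cusp_ring"
  proof (cases "f = 0")
    case True
    have "poly_in_t 0 / poly_in_t 1 \<in> cusp_ring" unfolding cusp_ring_def by (intro CollectI exI[of _ 0] exI[of _ 1]) auto
    thus ?thesis using True by (simp add: poly_in_t_def const_fun_hom.hom_zero)
  next
    case False
    obtain p q where pq: "f = Fraction_Field.Fract p q" "q \<noteq> 0" by (cases f) auto
    have p: "p \<noteq> 0" using False pq by (auto simp: Zero_fract_def eq_fract)
    have fpq: "expand f * expand_poly q = expand_poly p" using pq by (simp add: expand_Fract expand_poly_eq_0_iff)
    have refl: "expand_poly r = fls_X_inv ^ degree r * fps_to_fls (fps_of_poly (reflect_poly r))" for r
      by (rule fls_eqI)
        (auto simp: expand_poly_nth fls_X_inv_power_times_conv_shift coeff_reflect_poly coeff_eq_0 nat_le_iff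
          intro!: arg_cong[where f = "poly.coeff r"])
    define C where "C = [:lead_coeff q, - poly.coeff (reflect_poly q) 1:]"
    define Q where "Q = reflect_poly q * C"
    have "fls_subdegree (expand f) \<ge> 0" using f by (intro fls_subdegree_ge0I) (auto simp: inf_ring_def)
    moreover have "fls_subdegree (expand f * expand_poly q) = fls_subdegree (expand f) + fls_subdegree (expand_poly q)"
      using False pq by (intro fls_subdegree_mult) (auto simp: expand_poly_eq_0_iff)
    ultimately have deg: "degree p \<le> degree q" using fpq by (simp add: expand_poly_subdegree)
    define P where "P = monom 1 (degree q - degree p) * reflect_poly p * C"
    let ?u = "fls_X :: complex fls"
    define RP RQ where "RP = fps_to_fls (fps_of_poly (reflect_poly p))" and "RQ = fps_to_fls (fps_of_poly (reflect_poly q))"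
    have "expand f * (inverse ?u ^ degree q * RQ) = inverse ?u ^ degree p * RP"
      using fpq by (simp add: refl fls_inverse_X RP_def RQ_def)
    hence "expand f * (inverse ?u ^ degree q * RQ) * ?u ^ degree q = inverse ?u ^ degree p * RP * ?u ^ degree q"
      by (rule arg_cong)
    moreover have "expand f * (inverse ?u ^ degree q * RQ) * ?u ^ degree q = expand f * RQ"
      by (simp add: power_inverse)
    moreover have "inverse ?u ^ degree p * RP * ?u ^ degree q = RP * ?u ^ (degree q - degree p)"
      using deg by (simp add: power_inverse power_diff divide_inverse mult_ac)
    ultimately have "expand f * fps_to_fls (fps_of_poly (reflect_poly q)) =
        fps_to_fls (fps_of_poly (reflect_poly p)) * fls_X ^ (degree q - degree p)"
      by (simp add: RP_def RQ_def)
    hence "expand f * fps_to_fls (fps_of_poly (reflect_poly q)) * fps_to_fls (fps_of_poly C) =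
        fps_to_fls (fps_of_poly (reflect_poly p)) * fls_X ^ (degree q - degree p) * fps_to_fls (fps_of_poly C)"
      by simp
    hence "expand f * fps_to_fls (fps_of_poly Q) = fps_to_fls (fps_of_poly P)"
      by (simp add: P_def Q_def fps_of_poly_mult fls_times_fps_to_fls fps_of_poly_monom fps_to_fls_power mult_ac)
    hence "expand (f * poly_in_t Q) = expand (poly_in_t P)"
      by (simp add: expand_hom.hom_mult expand_poly_in_t)
    hence fPQ: "f * poly_in_t Q = poly_in_t P" by (simp add: expand_inj)
    have Q0: "poly.coeff Q 0 \<noteq> 0" using pq by (simp add: Q_def C_def coeff_mult)
    have Q1: "poly.coeff Q 1 = 0" using pq by (simp add: Q_def C_def coeff_mult)
    have "poly_in_t Q \<noteq> 0"
    proof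
      assume "poly_in_t Q = 0"
      hence "tc (poly_in_t Q) 0 = 0" by simp
      thus False using Q0 by (simp only: expand_poly_in_t) simp
    qed
    hence "f = poly_in_t P / poly_in_t Q" using fPQ by (simp add: field_simps)
    moreover have "poly.coeff P 1 = 0"
    proof -
      have in_inf: "poly_in_t R \<in> inf_ring" for R by (auto simp: inf_ring_iff expand_poly_in_t)
      have "tc (f * poly_in_t Q) 1 = tc f 0 * tc (poly_in_t Q) 1 + tc f 1 * tc (poly_in_t Q) 0"
        by (rule inf_ring_mult_coeffs(3)[OF f(1) in_inf])
      thus ?thesis using f(2) Q1 by (simp add: fPQ expand_poly_in_t)
    qed
    ultimately show ?thesis using Q0 Q1 unfolding cusp_ring_def by blast
  qed
qed

lemma cusp_inf: "cusp_ring \<subseteq> inf_ring"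
  by (auto simp: cusp_ring_eq)

lemma subring_cusp: "subring_set cusp_ring"
  using subring_inf inf_ring_mult_coeffs
  by (auto simp: subring_set_def cusp_ring_eq expand_hom.hom_add expand_hom.hom_uminus)

lemma subring_regular: "subring_set regular_ring"
  unfolding subring_set_def regular_ring_def
  by (auto simp flip: to_fract_add to_fract_mult to_fract_uminus intro: range_eqI[of _ _ 0] range_eqI[of _ _ 1])

section \<open>Matrices over a subring of a field\<close>

lemma subring_sum: "subring_set R \<Longrightarrow> (\<And>i. i \<in> A \<Longrightarrow> f i \<in> R) \<Longrightarrow> sum f A \<in> R"
  by (induction A rule: infinite_finite_induct) (auto simp: subring_set_def)

lemma subring_prod: "subring_set R \<Longrightarrow> (\<And>i. i \<in> A \<Longrightarrow> f i \<in> R) \<Longrightarrow> prod f A \<in> R"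
  by (induction A rule: infinite_finite_induct) (auto simp: subring_set_def)

lemma mat_over_carrier: "A \<in> mat_over n R \<Longrightarrow> A \<in> carrier_mat n n"
  by (simp add: mat_over_def)

lemma mat_over_entry: "A \<in> mat_over n R \<Longrightarrow> i < n \<Longrightarrow> j < n \<Longrightarrow> A $$ (i, j) \<in> R"
  by (simp add: mat_over_def)

lemma mat_over_mult:
  assumes R: "subring_set R" and A: "A \<in> mat_over n R" "B \<in> mat_over n R"
  shows "A * B \<in> mat_over n R"
proof -
  note c = A[THEN mat_over_carrier]
  have "(A * B) $$ (i, j) \<in> R" if "i < n" "j < n" for i j
    unfolding mat_mult_entry[OF c that]
    by (rule subring_sum[OF R]) (use A that R in \<open>auto simp: mat_over_def subring_set_def\<close>)
  thus ?thesis using c by (auto simp: mat_over_def)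
qed

lemma det_in_subring:
  assumes R: "subring_set R" and A: "A \<in> carrier_mat n n" "\<And>i j. i < n \<Longrightarrow> j < n \<Longrightarrow> A $$ (i, j) \<in> R"
  shows "det A \<in> R"
proof -
  have "signof p * (\<Prod>i = 0..<n. A $$ (i, p i)) \<in> R" if p: "p permutes {0..<n}" for p
  proof -
    have "(\<Prod>i = 0..<n. A $$ (i, p i)) \<in> R"
      using permutes_in_image[OF p] by (intro subring_prod[OF R] A(2)) auto
    moreover have "signof p \<in> R" using R by (auto simp: subring_set_def sign_def)
    ultimately show ?thesis using R by (auto simp: subring_set_def)
  qed
  thus ?thesis unfolding det_def'[OF A(1)] by (intro subring_sum[OF R]) auto
qed

lemma adj_mat_over:
  assumes R: "subring_set R" and A: "A \<in> mat_over n R"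
  shows "adj_mat A \<in> mat_over n R"
proof -
  note c = mat_over_carrier[OF A]
  have "cofactor A j i \<in> R" if ij: "i < n" "j < n" for i j
  proof -
    have d: "mat_delete A j i \<in> carrier_mat (n - 1) (n - 1)" using c by (rule mat_delete_carrier)
    have "det (mat_delete A j i) \<in> R"
    proof (rule det_in_subring[OF R d])
      fix k l assume kl: "k < n - 1" "l < n - 1"
      have "mat_delete A j i $$ (k, l) = A $$ (if k < j then k else Suc k, if l < i then l else Suc l)"
        using kl c by (simp add: mat_delete_def)
      thus "mat_delete A j i $$ (k, l) \<in> R" using kl by (auto intro!: mat_over_entry[OF A])
    qed
    moreover have "(-1) ^ (j + i) \<in> R" using R by (cases "even (j + i)") (auto simp: subring_set_def)
    ultimately show ?thesis using R by (auto simp: cofactor_def subring_set_def)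
  qed
  thus ?thesis using c adj_mat(1)[OF c] by (auto simp: mat_over_def adj_mat_def)
qed

definition GL :: "nat \<Rightarrow> 'a :: field set \<Rightarrow> 'a mat set" where
  "GL n R = {A \<in> mat_over n R. \<exists>B \<in> mat_over n R. A * B = 1\<^sub>m n \<and> B * A = 1\<^sub>m n}"

text \<open>
  Cramer's rule stays inside the subring.
\<close>

lemma GL_I:
  assumes R: "subring_set R" and A: "A \<in> mat_over n R" and d: "det A \<noteq> 0" "inverse (det A) \<in> R"
  shows "A \<in> GL n R"
proof -
  note c = mat_over_carrier[OF A]
  let ?B = "inverse (det A) \<cdot>\<^sub>m adj_mat A"
  note adj = adj_mat_over[OF R A] adj_mat[OF c]
  have "?B \<in> mat_over n R" using adj(1) d(2) R by (auto simp: mat_over_def subring_set_def)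
  moreover have "A * ?B = 1\<^sub>m n" "?B * A = 1\<^sub>m n"
    using adj d c
    by (auto simp: mult_smult_distrib[of _ n n _ n] mult_smult_assoc_mat[of _ n n] intro!: eq_matI)
  ultimately show ?thesis using A unfolding GL_def by blast
qed

lemma GL_D: "A \<in> GL n R \<Longrightarrow> A \<in> mat_over n R" "A \<in> GL n R \<Longrightarrow> A \<in> carrier_mat n n"
  by (auto simp: GL_def mat_over_def)

lemma GL_inverse:
  assumes "A \<in> GL n R" obtains B where "B \<in> GL n R" "A * B = 1\<^sub>m n" "B * A = 1\<^sub>m n"
  using assms by (auto simp: GL_def)

lemma GL_one: "subring_set R \<Longrightarrow> 1\<^sub>m n \<in> GL n R"
  by (intro GL_I) (auto simp: mat_over_def subring_set_def)

lemma GL_mult: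
  assumes R: "subring_set R" and A: "A \<in> GL n R" "A' \<in> GL n R"
  shows "A * A' \<in> GL n R"
proof -
  obtain B where B: "B \<in> GL n R" "A * B = 1\<^sub>m n" "B * A = 1\<^sub>m n" using A(1) by (rule GL_inverse)
  obtain B' where B': "B' \<in> GL n R" "A' * B' = 1\<^sub>m n" "B' * A' = 1\<^sub>m n" using A(2) by (rule GL_inverse)
  note c = A[THEN GL_D(2)] B(1)[THEN GL_D(2)] B'(1)[THEN GL_D(2)]
  have "A * A' * (B' * B) = A * (A' * B') * B" "B' * B * (A * A') = B' * (B * A) * A'"
    using c by (simp_all add: assoc_mult_mat[of _ n n _ n _ n])
  hence "A * A' * (B' * B) = 1\<^sub>m n" "B' * B * (A * A') = 1\<^sub>m n" using B B' c by simp_all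
  moreover have "A * A' \<in> mat_over n R" "B' * B \<in> mat_over n R"
    using mat_over_mult[OF R] A B(1) B'(1) GL_D(1) by blast+
  ultimately show ?thesis unfolding GL_def by blast
qed

lemma GL_det:
  assumes "A \<in> GL n R" shows "det A \<noteq> 0"
proof -
  obtain B where B: "B \<in> GL n R" "A * B = 1\<^sub>m n" using assms by (rule GL_inverse)
  have "det A * det B = 1" using det_mult[OF assms[THEN GL_D(2)] B(1)[THEN GL_D(2)]] B(2) by simp
  thus ?thesis by auto
qed

section \<open>First order jets at the cusp\<close>

text \<open>
  \<open>M = M0 + M1 t + O(t\<^sup>2)\<close>. Only these two coefficients matter for gluing at the cusp: a matrix is defined over the
  cusp ring exactly if \<open>M1 = 0\<close> (\<open>mat_over_cusp_iff_jet\<close>).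
\<close>

definition jet :: "nat \<Rightarrow> ratfun mat \<Rightarrow> complex mat \<Rightarrow> complex mat \<Rightarrow> bool" where
  "jet n M M0 M1 \<longleftrightarrow> M \<in> mat_over n inf_ring \<and> M0 = map_mat (\<lambda>f. tc f 0) M \<and> M1 = map_mat (\<lambda>f. tc f 1) M"

lemma jetD: "jet n M M0 M1 \<Longrightarrow> M \<in> mat_over n inf_ring" "jet n M M0 M1 \<Longrightarrow> M0 \<in> carrier_mat n n"
  "jet n M M0 M1 \<Longrightarrow> M1 \<in> carrier_mat n n" "jet n M M0 M1 \<Longrightarrow> M \<in> carrier_mat n n"
  by (auto simp: jet_def mat_over_def)

lemma jet_exists:
  assumes "M \<in> mat_over n inf_ring" shows "\<exists>M0 M1. jet n M M0 M1"
  using assms by (auto simp: jet_def)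

lemma jetI:
  assumes "M \<in> carrier_mat n n" "M0 \<in> carrier_mat n n" "M1 \<in> carrier_mat n n"
    and "\<And>i j. i < n \<Longrightarrow> j < n \<Longrightarrow> M $$ (i, j) \<in> inf_ring \<and> tc (M $$ (i, j)) 0 = M0 $$ (i, j) \<and> tc (M $$ (i, j)) 1 = M1 $$ (i, j)"
  shows "jet n M M0 M1"
  unfolding jet_def mat_over_def using assms by (auto intro!: eq_matI)

lemma jet_entry:
  assumes "jet n M M0 M1" "i < n" "j < n"
  shows "M $$ (i, j) \<in> inf_ring" "tc (M $$ (i, j)) 0 = M0 $$ (i, j)" "tc (M $$ (i, j)) 1 = M1 $$ (i, j)"
  using assms by (auto simp: jet_def mat_over_def)

lemma jet_mult:
  assumes M: "jet n M M0 M1" and N: "jet n N N0 N1"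
  shows "jet n (M * N) (M0 * N0) (M0 * N1 + M1 * N0)"
proof (rule jetI)
  note c = jetD(2-4)[OF M] jetD(2-4)[OF N]
  show "M * N \<in> carrier_mat n n" "M0 * N0 \<in> carrier_mat n n" "M0 * N1 + M1 * N0 \<in> carrier_mat n n" using c by auto
  fix i j assume ij: "i < n" "j < n"
  have "M * N \<in> mat_over n inf_ring" using mat_over_mult[OF subring_inf] jetD(1) M N by blast
  hence "(M * N) $$ (i, j) \<in> inf_ring" using ij by (rule mat_over_entry)
  moreover have "tc ((M * N) $$ (i, j)) 0 = (M0 * N0) $$ (i, j)"
    unfolding mat_mult_entry[OF c(3) c(6) ij] mat_mult_entry[OF c(1) c(4) ij] expand_hom.hom_sum fls_nth_sum
    by (intro sum.cong refl) (use jet_entry[OF M] jet_entry[OF N] ij in \<open>simp add: inf_ring_mult_coeffs\<close>)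
  moreover have "tc ((M * N) $$ (i, j)) 1 = (M0 * N1 + M1 * N0) $$ (i, j)"
  proof -
    have "(M0 * N1 + M1 * N0) $$ (i, j) = (M0 * N1) $$ (i, j) + (M1 * N0) $$ (i, j)"
      using c ij by simp
    thus ?thesis
    unfolding mat_mult_entry[OF c(3) c(6) ij] mat_mult_entry[OF c(1) c(5) ij] mat_mult_entry[OF c(2) c(4) ij]
      expand_hom.hom_sum fls_nth_sum sum.distrib[symmetric]
      using jet_entry[OF M] jet_entry[OF N] ij by (simp add: inf_ring_mult_coeffs)
  qed
  ultimately show "(M * N) $$ (i, j) \<in> inf_ring \<and> tc ((M * N) $$ (i, j)) 0 = (M0 * N0) $$ (i, j) \<and>
      tc ((M * N) $$ (i, j)) 1 = (M0 * N1 + M1 * N0) $$ (i, j)" by blast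
qed

lemma jet_unique:
  assumes "jet n M M0 M1" "jet n M N0 N1" shows "M0 = N0" "M1 = N1"
  using assms by (auto simp: jet_def)

lemma jet_one: "jet n (1\<^sub>m n) (1\<^sub>m n) (0\<^sub>m n n)"
  using subring_inf by (intro jetI) (auto simp: subring_set_def one_mat_def)

lemma mat_over_cusp_iff_jet: "M \<in> mat_over n cusp_ring \<longleftrightarrow> (\<exists>M0. jet n M M0 (0\<^sub>m n n))"
proof
  assume M: "M \<in> mat_over n cusp_ring"
  hence "jet n M (map_mat (\<lambda>f. tc f 0) M) (0\<^sub>m n n)"
    by (intro jetI) (auto simp: mat_over_def cusp_ring_eq)
  thus "\<exists>M0. jet n M M0 (0\<^sub>m n n)" by blast
next
  assume "\<exists>M0. jet n M M0 (0\<^sub>m n n)"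
  then obtain M0 where M: "jet n M M0 (0\<^sub>m n n)" by blast
  show "M \<in> mat_over n cusp_ring"
    using jetD(4)[OF M] jet_entry[OF M] by (auto simp: mat_over_def cusp_ring_eq)
qed

lemma jet_det:
  assumes M: "jet n M M0 M1" shows "det M \<in> inf_ring" "tc (det M) 0 = det M0"
proof -
  note c = jetD(2-4)[OF M]
  show "det M \<in> inf_ring" using det_in_subring[OF subring_inf c(3)] jet_entry[OF M] by blast
  have m: "prod f A \<in> inf_ring \<and> tc (prod f A) 0 = (\<Prod>i\<in>A. tc (f i) 0)" if "\<And>i. i \<in> A \<Longrightarrow> f i \<in> inf_ring" for f and A :: "nat set"
    using that
  proof (induction A rule: infinite_finite_induct)
    case (insert x A)
    thus ?case by (simp add: inf_ring_mult_coeffs del: expand_hom.hom_prod)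
  qed (use subring_inf in \<open>auto simp: subring_set_def\<close>)
  have "tc (signof p * (\<Prod>i = 0..<n. M $$ (i, p i))) 0 = signof p * (\<Prod>i = 0..<n. M0 $$ (i, p i))"
    if p: "p permutes {0..<n}" for p
  proof -
    have inr: "M $$ (i, p i) \<in> inf_ring" "tc (M $$ (i, p i)) 0 = M0 $$ (i, p i)" if "i \<in> {0..<n}" for i
      using jet_entry[OF M, of i "p i"] permutes_in_image[OF p, of i] that by auto
    have s: "signof p \<in> inf_ring" "tc (signof p) 0 = signof p"
      using subring_inf by (auto simp: subring_set_def sign_def expand_hom.hom_uminus)
    have "tc (signof p * (\<Prod>i = 0..<n. M $$ (i, p i))) 0 = tc (signof p) 0 * (\<Prod>i = 0..<n. tc (M $$ (i, p i)) 0)"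
      using m[of "{0..<n}" "\<lambda>i. M $$ (i, p i)"] inr s by (simp add: inf_ring_mult_coeffs del: expand_hom.hom_prod)
    also have "(\<Prod>i = 0..<n. tc (M $$ (i, p i)) 0) = (\<Prod>i = 0..<n. M0 $$ (i, p i))"
      by (rule prod.cong) (use inr in auto)
    finally show ?thesis using s by simp
  qed
  thus "tc (det M) 0 = det M0"
    unfolding det_def'[OF c(1)] det_def'[OF c(3)] expand_hom.hom_sum fls_nth_sum by (intro sum.cong) auto
qed

lemma GL_inf_jet:
  assumes M: "jet n M M0 M1" and d: "det M0 \<noteq> 0" shows "M \<in> GL n inf_ring"
proof (rule GL_I[OF subring_inf jetD(1)[OF M]])
  show "det M \<noteq> 0" using jet_det[OF M] d by auto
  show "inverse (det M) \<in> inf_ring" using jet_det[OF M] d by (intro inf_ring_inverse) auto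
qed

text \<open>
  The determinant lies in the cusp ring and is a unit of the normalization; comparing linear coefficients in
  \<open>det M \<cdot> (det M)\<^sup>-\<^sup>1 = 1\<close> shows that its inverse has no linear term either.
\<close>

lemma GL_cusp_jet:
  assumes M: "jet n M M0 (0\<^sub>m n n)" and d: "det M0 \<noteq> 0" shows "M \<in> GL n cusp_ring"
proof (rule GL_I[OF subring_cusp])
  show Mc: "M \<in> mat_over n cusp_ring" using M mat_over_cusp_iff_jet by blast
  show dn: "det M \<noteq> 0" using jet_det[OF M] d by auto
  have i: "inverse (det M) \<in> inf_ring" using jet_det[OF M] d by (intro inf_ring_inverse) auto
  have dc: "det M \<in> cusp_ring" using det_in_subring[OF subring_cusp] Mc by (auto simp: mat_over_def)
  have "tc (det M * inverse (det M)) 1 = 0" using dn by simp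
  moreover have "tc (det M * inverse (det M)) 1 = tc (det M) 0 * tc (inverse (det M)) 1 + tc (det M) 1 * tc (inverse (det M)) 0"
    using jet_det[OF M] i by (intro inf_ring_mult_coeffs) auto
  moreover have "tc (det M) 1 = 0" using dc by (simp add: cusp_ring_eq)
  ultimately have "tc (det M) 0 * tc (inverse (det M)) 1 = 0" by simp
  moreover have "tc (det M) 0 \<noteq> 0" using jet_det[OF M] d by simp
  ultimately have "tc (inverse (det M)) 1 = 0" by simp
  thus "inverse (det M) \<in> cusp_ring" using i by (simp add: cusp_ring_eq)
qed

text \<open>
  The matrix \<open>1 + t B\<close>, which glues the frame at the cusp along the tangent direction.
\<close>

definition glue :: "nat \<Rightarrow> complex mat \<Rightarrow> ratfun mat" where
  "glue n B = 1\<^sub>m n + inverse z_fun \<cdot>\<^sub>m map_mat const_fun B"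

lemma jet_const_t:
  assumes "F \<in> carrier_mat n n" "G \<in> carrier_mat n n"
  shows "jet n (map_mat const_fun F + inverse z_fun \<cdot>\<^sub>m map_mat const_fun G) F G"
proof (rule jetI)
  fix i j assume ij: "i < n" "j < n"
  have "const_fun a + inverse z_fun * const_fun b \<in> inf_ring" for a b
    using subring_inf const_in_inf t_in_inf by (auto simp: subring_set_def)
  moreover have "tc (const_fun a + inverse z_fun * const_fun b) 0 = a" "tc (const_fun a + inverse z_fun * const_fun b) 1 = b" for a b
    by (simp_all add: expand_hom.hom_add expand_hom.hom_mult expand_const expand_t fls_X_times_conv_shift)
  ultimately show "(map_mat const_fun F + inverse z_fun \<cdot>\<^sub>m map_mat const_fun G) $$ (i, j) \<in> inf_ring \<and>
    tc ((map_mat const_fun F + inverse z_fun \<cdot>\<^sub>m map_mat const_fun G) $$ (i, j)) 0 = F $$ (i, j) \<and>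
    tc ((map_mat const_fun F + inverse z_fun \<cdot>\<^sub>m map_mat const_fun G) $$ (i, j)) 1 = G $$ (i, j)"
    using assms ij by simp
qed (use assms in auto)

lemma jet_glue:
  assumes "B \<in> carrier_mat n n" shows "jet n (glue n B) (1\<^sub>m n) B"
proof -
  have "map_mat const_fun (1\<^sub>m n) = 1\<^sub>m n" by (auto intro!: eq_matI)
  thus ?thesis using jet_const_t[of "1\<^sub>m n" n B] assms by (simp add: glue_def)
qed

lemma jet_inverse:
  assumes M: "jet n M M0 M1" and N: "N \<in> mat_over n inf_ring" "M * N = 1\<^sub>m n"
    and P: "P \<in> carrier_mat n n" "P * M0 = 1\<^sub>m n"
  shows "jet n N P (- (P * M1 * P))"
proof -
  obtain N0 N1 where J: "jet n N N0 N1" using jet_exists[OF N(1)] by blast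
  note c = jetD(2-4)[OF M] jetD(2-4)[OF J]
  have e: "M0 * N0 = 1\<^sub>m n" "M0 * N1 + M1 * N0 = 0\<^sub>m n n"
    using jet_unique[OF jet_mult[OF M J]] jet_one[of n] unfolding N(2) by blast+
  have "P * (M0 * N0) = P * M0 * N0" using c P by (intro assoc_mult_mat[symmetric]) auto
  hence N0: "N0 = P" using e P c by simp
  have "P * (M0 * N1 + M1 * N0) = P * (M0 * N1) + P * (M1 * N0)"
    using c P by (intro mult_add_distrib_mat[of _ n n _ n]) auto
  also have "P * (M0 * N1) = P * M0 * N1" using c P by (intro assoc_mult_mat[symmetric]) auto
  also have "P * (M1 * N0) = P * M1 * P" unfolding N0 using c P by (intro assoc_mult_mat[symmetric]) auto
  finally have "P * (M0 * N1 + M1 * N0) = N1 + P * M1 * P" using P c by simp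
  hence z: "N1 + P * M1 * P = 0\<^sub>m n n" using e P by simp
  have "N1 = - (P * M1 * P)"
  proof (rule eq_matI)
    fix i j assume "i < dim_row (- (P * M1 * P))" "j < dim_col (- (P * M1 * P))"
    hence ij: "i < n" "j < n" using P c by auto
    have "(N1 + P * M1 * P) $$ (i, j) = 0" using z ij by simp
    moreover have "(N1 + P * M1 * P) $$ (i, j) = N1 $$ (i, j) + (P * M1 * P) $$ (i, j)"
      using ij P c by (intro index_add_mat) auto
    moreover have "(- (P * M1 * P)) $$ (i, j) = - ((P * M1 * P) $$ (i, j))"
      using ij P c by (intro index_uminus_mat) auto
    ultimately show "N1 $$ (i, j) = (- (P * M1 * P)) $$ (i, j)" by (simp add: add_eq_0_iff2)
  qed (use P c in auto)
  thus ?thesis using J N0 by simp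
qed

lemma glue_inverse:
  assumes B: "B \<in> carrier_mat n n"
  obtains N where "jet n N (1\<^sub>m n) (- B)" "glue n B * N = 1\<^sub>m n" "N * glue n B = 1\<^sub>m n"
proof -
  have "glue n B \<in> GL n inf_ring" using GL_inf_jet[OF jet_glue[OF B]] by simp
  then obtain N where N: "N \<in> GL n inf_ring" "glue n B * N = 1\<^sub>m n" "N * glue n B = 1\<^sub>m n" by (rule GL_inverse)
  have "jet n N (1\<^sub>m n) (- B)"
    using jet_inverse[OF jet_glue[OF B] GL_D(1)[OF N(1)] N(2), of "1\<^sub>m n"] B by simp
  thus ?thesis using that N by blast
qed

text \<open>
  Here \<open>N = (1 + t B')\<^sup>-\<^sup>1\<close>. The linear coefficient of \<open>(1 - t B') (M0 + t M1) (1 + t B)\<close> is the left-hand side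
  of the gluing condition.
\<close>

lemma jet_conj_glue:
  assumes N: "jet n N (1\<^sub>m n) (- B')" and M: "jet n M M0 M1"
    and B: "B \<in> carrier_mat n n" "B' \<in> carrier_mat n n"
  shows "jet n (N * M * glue n B) M0 (M1 + (M0 * B - B' * M0))"
proof -
  note c = jetD(2-4)[OF M]
  have "jet n (N * M * glue n B) (1\<^sub>m n * M0 * 1\<^sub>m n) (1\<^sub>m n * M0 * B + (1\<^sub>m n * M1 + (- B') * M0) * 1\<^sub>m n)"
    by (intro jet_mult N M jet_glue B)
  moreover have "1\<^sub>m n * M0 * B + (1\<^sub>m n * M1 + (- B') * M0) * 1\<^sub>m n = M0 * B + (M1 + (- B') * M0)"
    using c B by simp
  moreover have "M0 * B + (M1 + (- B') * M0) = M1 + (M0 * B - B' * M0)"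
  proof -
    have "X + (M1 + - Y) = M1 + (X - Y)" if "X \<in> carrier_mat n n" "Y \<in> carrier_mat n n" for X Y :: "complex mat"
      using that c by (intro eq_matI) auto
    from this[of "M0 * B" "B' * M0"] show ?thesis using c B by simp
  qed
  ultimately show ?thesis using c by simp
qed

section \<open>Diagonal matrices of powers of z\<close>

lemma expand_z_powi: "expand (z_fun powi k) = fls_shift k 1"
proof (cases "k \<ge> 0")
  case True
  then obtain m where "k = int m" using nonneg_int_cases by blast
  thus ?thesis by (simp add: expand_hom.hom_power expand_z fls_X_inv_power_conv_shift_1)
next
  case False
  then obtain m where m: "k = - int m" by (metis int_cases2 neg_0_le_iff_le of_nat_0_le_iff)
  show ?thesis
    by (simp add: m power_int_minus expand_hom.hom_inverse expand_hom.hom_power expand_z power_inverse[symmetric] fls_inverse_X_inv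
      fls_X_power_conv_shift_1)
qed

lemma tc_z_powi_mult: "tc (z_fun powi k * f) m = tc f (m + k)"
  by (simp add: expand_hom.hom_mult expand_z_powi fls_X_intpow_times_conv_shift(1)[of "- k", simplified])

lemma z_powi_cancel: "inverse (z_fun powi k) * (z_fun powi k * f) = f"
  using z_nonzero by (simp add: mult.assoc[symmetric])

lemma tc_z_mult: "tc (z_fun * f) m = tc f (m + 1)"
  using tc_z_powi_mult[of 1 f m] by simp

lemma z_in_regular: "z_fun \<in> regular_ring" by (simp add: regular_ring_def z_fun_def)

lemma const_in_regular: "const_fun c \<in> regular_ring" by (simp add: regular_ring_def const_fun_def)

lemma subring_power: "subring_set R \<Longrightarrow> a \<in> R \<Longrightarrow> a ^ k \<in> R"
  by (induction k) (auto simp: subring_set_def)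

lemma z_powi_regular: "0 \<le> k \<Longrightarrow> z_fun powi k \<in> regular_ring"
  using subring_power[OF subring_regular z_in_regular] by (simp add: power_int_def)

definition zdiag :: "nat \<Rightarrow> (nat \<Rightarrow> int) \<Rightarrow> ratfun mat" where
  "zdiag n a = Matrix.mat n n (\<lambda>(i, j). if i = j then z_fun powi a i else 0)"

lemma zdiag_carrier[simp]: "zdiag n a \<in> carrier_mat n n" "dim_row (zdiag n a) = n" "dim_col (zdiag n a) = n"
  by (simp_all add: zdiag_def)

lemma zdiag_mult:
  assumes "M \<in> carrier_mat n m" "i < n" "j < m"
  shows "(zdiag n a * M) $$ (i, j) = z_fun powi a i * M $$ (i, j)"
proof -
  have "(zdiag n a * M) $$ (i, j) = (\<Sum>l<n. (if i = l then z_fun powi a i else 0) * M $$ (l, j))"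
    using assms by (subst mat_mult_entry[of _ n n _ m]) (auto simp: zdiag_def intro!: sum.cong)
  also have "\<dots> = z_fun powi a i * M $$ (i, j)"
    using assms by (simp add: if_distrib[of "\<lambda>x. x * _"] sum.delta cong: if_cong)
  finally show ?thesis .
qed

lemma mult_zdiag:
  assumes "M \<in> carrier_mat m n" "i < m" "j < n"
  shows "(M * zdiag n a) $$ (i, j) = M $$ (i, j) * z_fun powi a j"
proof -
  have "(M * zdiag n a) $$ (i, j) = (\<Sum>l<n. M $$ (i, l) * (if l = j then z_fun powi a j else 0))"
    using assms by (subst mat_mult_entry[of _ m n _ n]) (auto simp: zdiag_def intro!: sum.cong)
  also have "\<dots> = M $$ (i, j) * z_fun powi a j"
    using assms by (simp add: if_distrib[of "\<lambda>x. _ * x"] sum.delta cong: if_cong)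
  finally show ?thesis .
qed

lemma zdiag_inverse: "zdiag n a * zdiag n (\<lambda>i. - a i) = 1\<^sub>m n" "zdiag n (\<lambda>i. - a i) * zdiag n a = 1\<^sub>m n"
proof -
  have "zdiag n a * zdiag n (\<lambda>i. - a i) = 1\<^sub>m n" for a
  proof (rule eq_matI)
    fix i j assume "i < dim_row (1\<^sub>m n :: ratfun mat)" "j < dim_col (1\<^sub>m n :: ratfun mat)"
    hence ij: "i < n" "j < n" by auto
    have "(zdiag n a * zdiag n (\<lambda>i. - a i)) $$ (i, j) = z_fun powi a i * zdiag n (\<lambda>i. - a i) $$ (i, j)"
      using ij by (intro zdiag_mult) auto
    also have "\<dots> = 1\<^sub>m n $$ (i, j)"
      using ij z_nonzero by (auto simp: zdiag_def power_int_minus)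
    finally show "(zdiag n a * zdiag n (\<lambda>i. - a i)) $$ (i, j) = 1\<^sub>m n $$ (i, j)" .
  qed auto
  from this[of a] this[of "\<lambda>i. - a i"]
  show "zdiag n a * zdiag n (\<lambda>i. - a i) = 1\<^sub>m n" "zdiag n (\<lambda>i. - a i) * zdiag n a = 1\<^sub>m n" by simp_all
qed

lemma det_zdiag: "det (zdiag n a) = z_fun powi (\<Sum>i<n. a i)"
proof -
  have "det (zdiag n a) = prod_list (diag_mat (zdiag n a))"
    by (rule det_upper_triangular[of _ n]) (auto simp: zdiag_def)
  also have "\<dots> = (\<Prod>i<n. z_fun powi a i)"
    by (simp add: diag_mat_def zdiag_def prod.list_conv_set_nth lessThan_atLeast0)
  also have "\<dots> = z_fun powi (\<Sum>i<n. a i)"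
    by (induction n) (simp_all add: power_int_add z_nonzero)
  finally show ?thesis .
qed

text \<open>
  The units of \<open>\<complex>[z]\<close> are constants, which have neither zero nor pole at the cusp.
\<close>

lemma GL_regular_det:
  assumes "A \<in> GL n regular_ring" shows "fls_subdegree (expand (det A)) = 0"
proof -
  obtain B where B: "B \<in> GL n regular_ring" "A * B = 1\<^sub>m n" using assms by (rule GL_inverse)
  have "det M \<in> regular_ring" if "M \<in> GL n regular_ring" for M
    using det_in_subring[OF subring_regular GL_D(2)[OF that]] mat_over_entry[OF GL_D(1)[OF that]] by blast
  then obtain p q where pq: "det A = to_fract p" "det B = to_fract q"
    using assms B unfolding regular_ring_def by blast
  have "det A * det B = 1" using det_mult[OF GL_D(2)[OF assms] GL_D(2)[OF B(1)]] B(2) by simp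
  hence "to_fract (p * q) = to_fract 1" by (simp add: pq)
  hence "p * q = 1" by (simp only: to_fract_eq_iff)
  hence "degree p + degree q = 0" by (metis degree_1 degree_mult_eq mult_eq_0_iff zero_neq_one)
  thus ?thesis by (simp add: pq expand_to_fract expand_poly_subdegree)
qed

lemma GL_inf_det:
  assumes "A \<in> GL n inf_ring" shows "fls_subdegree (expand (det A)) = 0" "det A \<in> inf_ring" "tc (det A) 0 \<noteq> 0"
proof -
  obtain B where B: "B \<in> GL n inf_ring" "A * B = 1\<^sub>m n" using assms by (rule GL_inverse)
  have d: "det M \<in> inf_ring" if "M \<in> GL n inf_ring" for M
    using det_in_subring[OF subring_inf GL_D(2)[OF that]] mat_over_entry[OF GL_D(1)[OF that]] by blast
  show "det A \<in> inf_ring" using d assms by blast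
  have "det A * det B = 1" using det_mult[OF GL_D(2)[OF assms] GL_D(2)[OF B(1)]] B(2) by simp
  hence "tc (det A) 0 * tc (det B) 0 = 1" using inf_ring_mult_coeffs(2)[OF d[OF assms] d[OF B(1)]] by simp
  thus nz: "tc (det A) 0 \<noteq> 0" by auto
  show "fls_subdegree (expand (det A)) = 0"
    by (rule fls_subdegree_eqI) (use nz d[OF assms] in \<open>auto simp: inf_ring_def\<close>)
qed

lemma GL_mono:
  assumes "R \<subseteq> S" "A \<in> GL n R" shows "A \<in> GL n S"
proof -
  have "mat_over n R \<subseteq> mat_over n S" using assms(1) by (auto simp: mat_over_def)
  thus ?thesis using assms(2) unfolding GL_def by blast
qed

lemma subdegree_expand_mult:
  "f \<noteq> 0 \<Longrightarrow> g \<noteq> 0 \<Longrightarrow> fls_subdegree (expand (f * g)) = fls_subdegree (expand f) + fls_subdegree (expand g)"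
  by (simp add: expand_hom.hom_mult)

lemma subdegree_z_powi: "fls_subdegree (expand (z_fun powi k)) = - k"
  by (simp add: expand_z_powi)

section \<open>Row reduction over the polynomial ring\<close>

definition row_op :: "nat \<Rightarrow> nat \<Rightarrow> (nat \<Rightarrow> ratfun) \<Rightarrow> ratfun mat" where
  "row_op n k r = Matrix.mat n n (\<lambda>(i, j). if i = k then r j else if i = j then 1 else 0)"

lemma row_op_carrier[simp]: "row_op n k r \<in> carrier_mat n n" by (simp add: row_op_def)

lemma row_op_mult:
  assumes "M \<in> carrier_mat n m" "i < n" "j < m"
  shows "(row_op n k r * M) $$ (i, j) = (if i = k then (\<Sum>l<n. r l * M $$ (l, j)) else M $$ (i, j))"
proof (cases "i = k")
  case True
  thus ?thesis using assms by (subst mat_mult_entry[of _ n n _ m]) (auto simp: row_op_def)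
next
  case False
  have "(row_op n k r * M) $$ (i, j) = (\<Sum>l<n. (if i = l then 1 else 0) * M $$ (l, j))"
    using assms False by (subst mat_mult_entry[of _ n n _ m]) (auto simp: row_op_def intro!: sum.cong)
  also have "\<dots> = M $$ (i, j)"
    using assms by (simp add: if_distrib[of "\<lambda>x. x * _"] sum.delta cong: if_cong)
  finally show ?thesis using False by simp
qed

lemma row_op_row_op:
  assumes k: "k < n" and r: "r k * s k = 1" "\<And>j. j < n \<Longrightarrow> j \<noteq> k \<Longrightarrow> r k * s j + r j = 0"
  shows "row_op n k r * row_op n k s = 1\<^sub>m n"
proof (rule eq_matI)
  fix i j assume "i < dim_row (1\<^sub>m n :: ratfun mat)" "j < dim_col (1\<^sub>m n :: ratfun mat)"
  hence ij: "i < n" "j < n" by auto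
  show "(row_op n k r * row_op n k s) $$ (i, j) = 1\<^sub>m n $$ (i, j)"
  proof (cases "i = k")
    case True
    have "(row_op n k r * row_op n k s) $$ (i, j) = (\<Sum>l<n. r l * row_op n k s $$ (l, j))"
      using ij True by (subst row_op_mult[of _ n n]) auto
    also have "\<dots> = r k * row_op n k s $$ (k, j) + (\<Sum>l\<in>{..<n} - {k}. r l * row_op n k s $$ (l, j))"
      using k by (subst sum.remove[of _ k]) auto
    also have "(\<Sum>l\<in>{..<n} - {k}. r l * row_op n k s $$ (l, j)) = (\<Sum>l\<in>{..<n} - {k}. if l = j then r j else 0)"
      using ij by (intro sum.cong) (auto simp: row_op_def)
    also have "\<dots> = (if j = k then 0 else r j)" using ij by (simp add: sum.delta)
    also have "r k * row_op n k s $$ (k, j) + (if j = k then 0 else r j) = 1\<^sub>m n $$ (i, j)"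
      using ij k r True by (auto simp: row_op_def)
    finally show ?thesis .
  next
    case False
    thus ?thesis using ij by (subst row_op_mult[of _ n n]) (auto simp: row_op_def)
  qed
qed (auto simp: row_op_def)

text \<open>
  Write \<open>h = D V\<close> with \<open>V\<close> over the normalization. A linear relation among the rows of the singular matrix \<open>V(0)\<close>
  becomes a combination of the rows of \<open>h\<close> with coefficients \<open>c i \<cdot> z^(a k - a i)\<close>. They lie in \<open>\<complex>[z]\<close> if \<open>k\<close> has the largest
  exponent among the rows in the relation; replacing the \<open>k\<close>-th row by this combination gains a factor \<open>t\<close> there.
\<close>

lemma row_reduction_step:
  fixes a :: "nat \<Rightarrow> int"
  assumes h: "h \<in> carrier_mat n n" and U: "zdiag n (\<lambda>i. - a i) * h \<in> mat_over n inf_ring"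
    and sing: "det (map_mat (\<lambda>f. tc f 0) (zdiag n (\<lambda>i. - a i) * h)) = 0"
  obtains E k where "E \<in> GL n regular_ring" "k < n"
    "zdiag n (\<lambda>i. - (a(k := a k - 1)) i) * (E * h) \<in> mat_over n inf_ring"
proof -
  define V where "V = zdiag n (\<lambda>i. - a i) * h"
  have Vc: "V \<in> carrier_mat n n" using h by (auto simp: V_def)
  have Ve: "V $$ (i, j) \<in> inf_ring" if "i < n" "j < n" for i j
    using U that unfolding V_def by (intro mat_over_entry)
  have hV: "h $$ (i, j) = z_fun powi a i * V $$ (i, j)" if "i < n" "j < n" for i j
    unfolding V_def using zdiag_mult[OF h that] z_nonzero by (simp add: power_int_minus)
  have "det (map_mat (\<lambda>f. tc f 0) V) = 0" "map_mat (\<lambda>f. tc f 0) V \<in> carrier_mat n n"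
    using sing Vc by (auto simp: V_def)
  from det_zero_left_kernel[OF this(2,1)]
  obtain c k0 where c0: "k0 < n" "c k0 \<noteq> 0" "\<forall>j<n. (\<Sum>i<n. c i * map_mat (\<lambda>f. tc f 0) V $$ (i, j)) = 0"
    by (elim exE conjE)
  note c = c0(1,2) c0(3)[rule_format]
  define S where "S = {i. i < n \<and> c i \<noteq> 0}"
  have S: "finite S" "S \<noteq> {}" using c by (auto simp: S_def)
  have "Max (a ` S) \<in> a ` S" using S by (intro Max_in) auto
  then obtain k where k: "k \<in> S" "a k = Max (a ` S)" by auto
  have kn: "k < n" and ck: "c k \<noteq> 0" using k by (auto simp: S_def)
  have amax: "a i \<le> a k" if "i < n" "c i \<noteq> 0" for i using k that S by (auto simp: S_def)
  define r where "r = (\<lambda>j. const_fun (c j) * z_fun powi (a k - a j))"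
  \<comment> \<open>The \<open>k\<close>-th row of the inverse operation.\<close>
  define s where "s = (\<lambda>j. if j = k then const_fun (1 / c k) else - const_fun (1 / c k) * r j)"
  have rk: "r k = const_fun (c k)" by (simp add: r_def)
  have cc: "const_fun (c k) * const_fun (1 / c k) = 1"
    using ck by (metis const_fun_hom.hom_mult const_fun_hom.hom_one nonzero_mult_divide_mult_cancel_left divide_self_if mult.right_neutral times_divide_eq_right)
  have rreg: "r j \<in> regular_ring" if "j < n" for j
  proof (cases "c j = 0")
    case True
    thus ?thesis using subring_regular by (simp add: r_def subring_set_def)
  next
    case False
    thus ?thesis using amax[OF that] subring_regular const_in_regular z_powi_regular[of "a k - a j"]
      by (auto simp: r_def subring_set_def)
  qed
  have sreg: "s j \<in> regular_ring" if "j < n" for j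
    using rreg[OF that] const_in_regular subring_regular by (auto simp: s_def subring_set_def)
  let ?E = "row_op n k r"
  have cx: "const_fun (c k) * (const_fun (1 / c k) * x) = x" for x
    using cc by (metis mult.assoc mult_1)
  have EE1: "?E * row_op n k s = 1\<^sub>m n"
    by (rule row_op_row_op[OF kn]) (simp_all add: rk s_def cc cx)
  have EE2: "row_op n k s * ?E = 1\<^sub>m n"
    by (rule row_op_row_op[OF kn]) (use cc in \<open>simp_all add: rk s_def mult.commute\<close>)
  have "?E \<in> GL n regular_ring"
  proof -
    have "row_op n k q \<in> mat_over n regular_ring" if "\<And>j. j < n \<Longrightarrow> q j \<in> regular_ring" for q
      using that subring_regular by (auto simp: mat_over_def row_op_def subring_set_def)
    from this[of r, OF rreg] this[of s, OF sreg] show ?thesis unfolding GL_def using EE1 EE2 by blast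
  qed
  moreover have "zdiag n (\<lambda>i. - (a(k := a k - 1)) i) * (?E * h) \<in> mat_over n inf_ring"
  proof -
    have Eh: "?E * h \<in> carrier_mat n n" by (rule mult_carrier_mat[OF row_op_carrier h])
    have "(zdiag n (\<lambda>i. - (a(k := a k - 1)) i) * (?E * h)) $$ (i, j) \<in> inf_ring" if ij: "i < n" "j < n" for i j
    proof (cases "i = k")
      case False
      thus ?thesis unfolding zdiag_mult[OF Eh ij] row_op_mult[OF h ij]
        using False hV[OF ij] Ve[OF ij] by (simp add: power_int_minus z_powi_cancel)
    next
      case True
      have "(zdiag n (\<lambda>i. - (a(k := a k - 1)) i) * (?E * h)) $$ (i, j) = z_fun powi (1 - a k) * (\<Sum>l<n. r l * h $$ (l, j))"
        unfolding zdiag_mult[OF Eh ij] row_op_mult[OF h ij] using True by simp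
      also have "\<dots> = z_fun powi (1 - a k) * (\<Sum>l<n. z_fun powi a k * (const_fun (c l) * V $$ (l, j)))"
      proof -
        have "r l * h $$ (l, j) = z_fun powi a k * (const_fun (c l) * V $$ (l, j))" if "l < n" for l
          using hV[OF that ij(2)] z_nonzero by (simp add: r_def power_int_diff)
        thus ?thesis by simp
      qed
      also have "\<dots> = z_fun * (\<Sum>l<n. const_fun (c l) * V $$ (l, j))"
        using z_nonzero by (simp add: sum_distrib_left[symmetric] power_int_diff)
      finally have eq: "(zdiag n (\<lambda>i. - (a(k := a k - 1)) i) * (?E * h)) $$ (i, j) = z_fun * (\<Sum>l<n. const_fun (c l) * V $$ (l, j))" .
      define f where "f = (\<Sum>l<n. const_fun (c l) * V $$ (l, j))"
      have f: "f \<in> inf_ring" unfolding f_def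
        using Ve ij const_in_inf subring_inf by (intro subring_sum[OF subring_inf]) (auto simp: subring_set_def)
      have "tc f 0 = (\<Sum>l<n. c l * map_mat (\<lambda>f. tc f 0) V $$ (l, j))"
        unfolding f_def expand_hom.hom_sum fls_nth_sum
        by (intro sum.cong refl) (use Ve Vc ij const_in_inf in \<open>auto simp: inf_ring_mult_coeffs expand_const\<close>)
      hence "tc f 0 = 0" using c(3) ij by simp
      hence "tc f (m + 1) = 0" if "m < 0" for m
        using f that by (cases "m = -1") (auto simp: inf_ring_def)
      hence "z_fun * f \<in> inf_ring" by (simp add: inf_ring_def tc_z_mult)
      thus ?thesis unfolding eq f_def .
    qed
    moreover have "zdiag n (\<lambda>i. - (a(k := a k - 1)) i) * (?E * h) \<in> carrier_mat n n"
      by (rule mult_carrier_mat[OF zdiag_carrier(1) Eh])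
    ultimately show ?thesis unfolding mat_over_def by blast
  qed
  ultimately show ?thesis using that[of ?E k] kn by simp
qed

text \<open>
  The sum of the exponents minus the degree of \<open>det h\<close> is the order of vanishing of \<open>det V\<close>. It is a natural number and
  drops at each reduction step, and at its minimum the leading matrix is invertible.
\<close>

lemma row_reduction:
  fixes a :: "nat \<Rightarrow> int"
  assumes "h \<in> carrier_mat n n" "det h \<noteq> 0" "zdiag n (\<lambda>i. - a i) * h \<in> mat_over n inf_ring"
  shows "\<exists>A \<in> GL n regular_ring. \<exists>a. \<exists>U \<in> GL n inf_ring. A * h = zdiag n a * U"
  using assms
proof (induction "nat ((\<Sum>i<n. a i) + fls_subdegree (expand (det h)))" arbitrary: a h rule: less_induct)
  case less
  define V where "V = zdiag n (\<lambda>i. - a i) * h"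
  have V: "V \<in> mat_over n inf_ring" using less.prems by (simp add: V_def)
  obtain V0 V1 where J: "jet n V V0 V1" using jet_exists[OF V] by blast
  have V0: "V0 = map_mat (\<lambda>f. tc f 0) V" using J by (simp add: jet_def)
  have hV: "h = zdiag n a * V"
    unfolding V_def using less.prems(1) zdiag_inverse(1)[of n a] by (simp flip: assoc_mult_mat[of _ n n _ n _ n])
  show ?case
  proof (cases "det V0 = 0")
    case False
    have "1\<^sub>m n \<in> GL n regular_ring" by (rule GL_one[OF subring_regular])
    moreover have "V \<in> GL n inf_ring" using GL_inf_jet[OF J False] .
    moreover have "1\<^sub>m n * h = zdiag n a * V" using hV less.prems(1) by simp
    ultimately show ?thesis by (intro bexI[of _ "1\<^sub>m n"] exI[of _ a] bexI[of _ V])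
  next
    case True
    have sing: "det (map_mat (\<lambda>f. tc f 0) (zdiag n (\<lambda>i. - a i) * h)) = 0" using True unfolding V0 V_def .
    obtain E k where E: "E \<in> GL n regular_ring" "k < n"
      "zdiag n (\<lambda>i. - (a(k := a k - 1)) i) * (E * h) \<in> mat_over n inf_ring"
      by (rule row_reduction_step[OF less.prems(1,3) sing])
    note Ec = GL_D(2)[OF E(1)]
    have dE: "det E \<noteq> 0" using GL_det[OF E(1)] .
    have det: "det (E * h) = det E * det h" using det_mult[OF Ec less.prems(1)] .
    have dV: "det V \<noteq> 0" "det h = z_fun powi (\<Sum>i<n. a i) * det V"
      using det_mult[OF zdiag_carrier(1) mat_over_carrier[OF V], of a] less.prems(2) by (auto simp: hV[symmetric] det_zdiag)
    have "fls_subdegree (expand (det h)) = - (\<Sum>i<n. a i) + fls_subdegree (expand (det V))"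
      unfolding dV(2) using dV(1) z_nonzero by (simp add: subdegree_expand_mult subdegree_z_powi)
    moreover have "fls_subdegree (expand (det V)) \<ge> 1"
    proof (rule fls_subdegree_geI)
      show "expand (det V) \<noteq> 0" using dV(1) by simp
      fix m :: int assume "m < 1"
      thus "tc (det V) m = 0"
        using jet_det[OF J] True by (cases "m = 0") (auto simp: inf_ring_def)
    qed
    ultimately have pos: "(\<Sum>i<n. a i) + fls_subdegree (expand (det h)) > 0" by simp
    have "(\<Sum>i<n. (a(k := a k - 1)) i) = (\<Sum>i<n. a i) - 1"
    proof -
      have "(\<Sum>i<n. (a(k := a k - 1)) i) = (a k - 1) + (\<Sum>i\<in>{..<n} - {k}. a i)"
        using E(2) by (subst sum.remove[of _ k]) (auto intro!: sum.cong)
      also have "\<dots> = (\<Sum>i<n. a i) - 1" using E(2) by (subst (2) sum.remove[of _ k]) auto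
      finally show ?thesis .
    qed
    moreover have "fls_subdegree (expand (det (E * h))) = fls_subdegree (expand (det h))"
      unfolding det using dE less.prems(2) GL_regular_det[OF E(1)] by (simp add: subdegree_expand_mult)
    ultimately have "nat ((\<Sum>i<n. (a(k := a k - 1)) i) + fls_subdegree (expand (det (E * h)))) < nat ((\<Sum>i<n. a i) + fls_subdegree (expand (det h)))"
      using pos by simp
    moreover have "E * h \<in> carrier_mat n n" "det (E * h) \<noteq> 0" using Ec less.prems(1,2) det dE by auto
    ultimately have "\<exists>A \<in> GL n regular_ring. \<exists>a. \<exists>U \<in> GL n inf_ring. A * (E * h) = zdiag n a * U"
      using less.hyps[OF _ _ _ E(3)] by simp
    then obtain A b U where A: "A \<in> GL n regular_ring" "U \<in> GL n inf_ring" "A * (E * h) = zdiag n b * U"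
      by (elim bexE exE)
    have "A * E \<in> GL n regular_ring" using GL_mult[OF subring_regular A(1) E(1)] .
    moreover have "A * E * h = zdiag n b * U"
      using A(3) assoc_mult_mat[OF GL_D(2)[OF A(1)] Ec less.prems(1)] by simp
    ultimately show ?thesis using A(2) by (intro bexI[of _ "A * E"] exI[of _ b] bexI[of _ U])
  qed
qed

text \<open>
  Row permutations serve to sort the exponents.
\<close>

definition perm_mat :: "nat \<Rightarrow> (nat \<Rightarrow> nat) \<Rightarrow> ratfun mat" where
  "perm_mat n \<sigma> = Matrix.mat n n (\<lambda>(i, j). if j = \<sigma> i then 1 else 0)"

lemma perm_mat_mult:
  assumes \<sigma>: "\<sigma> permutes {..<n}" and M: "M \<in> carrier_mat n m" "i < n" "j < m"
  shows "(perm_mat n \<sigma> * M) $$ (i, j) = M $$ (\<sigma> i, j)"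
proof -
  have s: "\<sigma> i < n" using permutes_in_image[OF \<sigma>, of i] M by simp
  have "(perm_mat n \<sigma> * M) $$ (i, j) = (\<Sum>l<n. (if l = \<sigma> i then 1 else 0) * M $$ (l, j))"
    using M by (subst mat_mult_entry[of _ n n _ m]) (auto simp: perm_mat_def)
  also have "\<dots> = M $$ (\<sigma> i, j)"
    using s by (simp add: if_distrib[of "\<lambda>x. x * _"] sum.delta cong: if_cong)
  finally show ?thesis .
qed

lemma perm_mat_GL:
  assumes \<sigma>: "\<sigma> permutes {..<n}" and R: "subring_set R"
  shows "perm_mat n \<sigma> \<in> GL n R"
proof -
  define Q :: "ratfun mat" where "Q = Matrix.mat n n (\<lambda>(i, j). if i = \<sigma> j then 1 else 0)"
  have c: "perm_mat n \<sigma> \<in> carrier_mat n n" "Q \<in> carrier_mat n n" by (simp_all add: perm_mat_def Q_def)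
  have PQ: "perm_mat n \<sigma> * Q = 1\<^sub>m n"
  proof (rule eq_matI)
    fix i j assume "i < dim_row (1\<^sub>m n :: ratfun mat)" "j < dim_col (1\<^sub>m n :: ratfun mat)"
    hence ij: "i < n" "j < n" by auto
    have "\<sigma> i < n" using permutes_in_image[OF \<sigma>, of i] ij by simp
    moreover have "\<sigma> i = \<sigma> j \<longleftrightarrow> i = j" using permutes_inj[OF \<sigma>] by (simp add: inj_eq)
    ultimately show "(perm_mat n \<sigma> * Q) $$ (i, j) = 1\<^sub>m n $$ (i, j)"
      unfolding perm_mat_mult[OF \<sigma> c(2) ij] using ij by (simp add: Q_def)
  qed (use c in auto)
  have "Q * perm_mat n \<sigma> = 1\<^sub>m n" by (rule mat_mult_left_right_inverse[OF c PQ])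
  moreover have "perm_mat n \<sigma> \<in> mat_over n R" "Q \<in> mat_over n R"
    using R by (auto simp: perm_mat_def Q_def mat_over_def subring_set_def)
  ultimately show ?thesis using PQ unfolding GL_def by blast
qed

lemma sorting_permutation:
  fixes a :: "nat \<Rightarrow> int"
  shows "\<exists>\<sigma>. \<sigma> permutes {..<n} \<and> (\<forall>i j. i \<le> j \<longrightarrow> j < n \<longrightarrow> a (\<sigma> i) \<le> a (\<sigma> j))"
proof -
  let ?xs = "map a [0..<n]"
  have "mset (sort ?xs) = mset ?xs" by simp
  then obtain \<sigma> where \<sigma>: "\<sigma> permutes {..<length ?xs}" "permute_list \<sigma> ?xs = sort ?xs"
    by (rule mset_eq_permutation)
  have p: "\<sigma> permutes {..<n}" using \<sigma>(1) by simp
  have "sort ?xs ! i = a (\<sigma> i)" if "i < n" for i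
    using that permutes_in_image[OF p, of i] by (simp flip: \<sigma>(2) add: permute_list_nth[OF \<sigma>(1)])
  moreover have "sort ?xs ! i \<le> sort ?xs ! j" if "i \<le> j" "j < n" for i j
    using sorted_nth_mono[of "sort ?xs" i j] that by simp
  ultimately have "a (\<sigma> i) \<le> a (\<sigma> j)" if "i \<le> j" "j < n" for i j
    using that by (metis le_less_trans)
  thus ?thesis using p by (intro exI[of _ \<sigma>]) auto
qed

text \<open>
  After row reduction and sorting, \<open>A g = D V\<close> with \<open>V = V0 + V1 t + \<dots>\<close> and \<open>V0\<close> invertible. Splitting off \<open>1 + t B\<close> with
  \<open>B = V1 V0\<^sup>-\<^sup>1\<close> from \<open>V\<close> leaves a matrix without linear term, which is absorbed by \<open>GL\<^sub>n(O)\<close>.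
\<close>

lemma normal_form:
  assumes g: "vector_bundle n g"
  obtains A a B C where "A \<in> GL n regular_ring" "C \<in> GL n cusp_ring" "B \<in> carrier_mat n n"
    "\<forall>i j. i \<le> j \<longrightarrow> j < n \<longrightarrow> a i \<le> a j" "A * g = zdiag n a * glue n B * C"
proof -
  have gc: "g \<in> carrier_mat n n" "det g \<noteq> 0" using g by (auto simp: vector_bundle_def)
  \<comment> \<open>A common bound for the pole orders of the entries, as starting value for the exponents.\<close>
  define N where "N = (\<Sum>i<n. \<Sum>j<n. nat (- fls_subdegree (expand (g $$ (i, j)))))"
  have "zdiag n (\<lambda>i. - int N) * g \<in> mat_over n inf_ring"
  proof -
    have "(zdiag n (\<lambda>i. - int N) * g) $$ (i, j) \<in> inf_ring" if ij: "i < n" "j < n" for i j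
    proof -
      have "nat (- fls_subdegree (expand (g $$ (i, j)))) \<le> (\<Sum>j<n. nat (- fls_subdegree (expand (g $$ (i, j)))))"
        using ij by (intro member_le_sum) auto
      also have "\<dots> \<le> N" unfolding N_def using ij
        by (intro member_le_sum[of i "{..<n}" "\<lambda>i. \<Sum>j<n. nat (- fls_subdegree (expand (g $$ (i, j))))"]) auto
      finally have "- int N \<le> fls_subdegree (expand (g $$ (i, j)))" by linarith
      thus ?thesis unfolding zdiag_mult[OF gc(1) ij] inf_ring_def by (auto simp: tc_z_powi_mult)
    qed
    thus ?thesis using gc by (auto simp: mat_over_def)
  qed
  from row_reduction[OF gc this] obtain A a U where
    A: "A \<in> GL n regular_ring" "U \<in> GL n inf_ring" "A * g = zdiag n a * U" by (elim bexE exE)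
  from sorting_permutation[of n a]
  obtain \<sigma> where \<sigma>0: "\<sigma> permutes {..<n}" "\<forall>i j. i \<le> j \<longrightarrow> j < n \<longrightarrow> a (\<sigma> i) \<le> a (\<sigma> j)"
    by (elim exE conjE)
  note \<sigma> = \<sigma>0(1) \<sigma>0(2)[rule_format]
  let ?P = "perm_mat n \<sigma>"
  note P = perm_mat_GL[OF \<sigma>(1)]
  note c = GL_D(2)[OF A(1)] GL_D(2)[OF A(2)] GL_D(2)[OF P[OF subring_inf]]
  have PA: "?P * A \<in> GL n regular_ring" using GL_mult[OF subring_regular P[OF subring_regular] A(1)] .
  define V where "V = ?P * U"
  have V: "V \<in> GL n inf_ring" unfolding V_def using GL_mult[OF subring_inf P[OF subring_inf] A(2)] .
  have PAg: "?P * A * g = zdiag n (a \<circ> \<sigma>) * V"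
  proof -
    have "?P * A * g = ?P * (zdiag n a * U)" using c gc A(3) by (simp add: assoc_mult_mat[of _ n n _ n _ n])
    also have "\<dots> = zdiag n (a \<circ> \<sigma>) * V"
    proof (rule eq_matI)
      fix i j assume "i < dim_row (zdiag n (a \<circ> \<sigma>) * V)" "j < dim_col (zdiag n (a \<circ> \<sigma>) * V)"
      hence ij: "i < n" "j < n" using V GL_D(2)[OF V] by auto
      have s: "\<sigma> i < n" using permutes_in_image[OF \<sigma>(1), of i] ij by simp
      have "(?P * (zdiag n a * U)) $$ (i, j) = (zdiag n a * U) $$ (\<sigma> i, j)"
        using c ij by (intro perm_mat_mult[OF \<sigma>(1), of _ n]) auto
      also have "\<dots> = z_fun powi a (\<sigma> i) * U $$ (\<sigma> i, j)"
        using zdiag_mult[OF c(2) s ij(2)] .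
      also have "\<dots> = (zdiag n (a \<circ> \<sigma>) * V) $$ (i, j)"
        using zdiag_mult[OF GL_D(2)[OF V] ij, of "a \<circ> \<sigma>"] perm_mat_mult[OF \<sigma>(1) c(2) ij] by (simp add: V_def)
      finally show "(?P * (zdiag n a * U)) $$ (i, j) = (zdiag n (a \<circ> \<sigma>) * V) $$ (i, j)" .
    qed (use c V GL_D(2)[OF V] in auto)
    finally show ?thesis .
  qed
  obtain V0 V1 where J: "jet n V V0 V1" using jet_exists[OF GL_D(1)[OF V]] by blast
  note Vc = jetD(2-4)[OF J]
  have "det V0 \<noteq> 0" using GL_inf_det(3)[OF V] jet_det(2)[OF J] by simp
  then obtain P0 where P0: "P0 \<in> carrier_mat n n" "P0 * V0 = 1\<^sub>m n" "V0 * P0 = 1\<^sub>m n"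
    using det_nonzero_inverse[OF Vc(1)] by blast
  define B where "B = V1 * P0"
  have B: "B \<in> carrier_mat n n" using Vc P0 by (auto simp: B_def)
  obtain N where N: "jet n N (1\<^sub>m n) (- B)" "glue n B * N = 1\<^sub>m n" "N * glue n B = 1\<^sub>m n"
    using glue_inverse[OF B] by blast
  have "B * V0 = V1" unfolding B_def using Vc P0 by (simp add: assoc_mult_mat[of _ n n _ n _ n])
  moreover have "jet n (N * V) (1\<^sub>m n * V0) (1\<^sub>m n * V1 + (- B) * V0)" using jet_mult[OF N(1) J] .
  moreover have "(- B) * V0 = - (B * V0)" using B Vc by (simp add: uminus_mult_left_mat)
  moreover have "V1 + - V1 = 0\<^sub>m n n" using Vc by (intro eq_matI) auto
  ultimately have "jet n (N * V) V0 (0\<^sub>m n n)" using Vc by simp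
  hence C: "N * V \<in> GL n cusp_ring" using GL_cusp_jet \<open>det V0 \<noteq> 0\<close> by blast
  have gl: "glue n B \<in> carrier_mat n n" using jetD(4)[OF jet_glue[OF B]] .
  have Nc: "N \<in> carrier_mat n n" using jetD(4)[OF N(1)] .
  have "zdiag n (a \<circ> \<sigma>) * glue n B * (N * V) = zdiag n (a \<circ> \<sigma>) * (glue n B * N) * V"
    using gl Nc Vc by (simp add: assoc_mult_mat[of _ n n _ n _ n])
  hence eq: "?P * A * g = zdiag n (a \<circ> \<sigma>) * glue n B * (N * V)"
    using PAg N Vc by simp
  have "\<forall>i j. i \<le> j \<longrightarrow> j < n \<longrightarrow> (a \<circ> \<sigma>) i \<le> (a \<circ> \<sigma>) j" using \<sigma>0(2) by simp
  from that[OF PA C B this eq] show ?thesis .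
qed

section \<open>Bundles up to twist by a line bundle\<close>

text \<open>
  The degree of the numerator minus that of the denominator is the order of the pole at infinity, for every
  representation as a fraction.
\<close>

lemma vb_degree_eq:
  assumes "det g \<noteq> 0" shows "vb_degree g = - fls_subdegree (expand (det g))"
  unfolding vb_degree_def
proof (rule the_equality)
  obtain p q where pq: "det g = Fraction_Field.Fract p q" "q \<noteq> 0" by (cases "det g") auto
  have p: "p \<noteq> 0" using assms pq by (auto simp: Zero_fract_def eq_fract)
  have sub: "fls_subdegree (expand (Fraction_Field.Fract p q)) = int (degree q) - int (degree p)" if "p \<noteq> 0" "q \<noteq> 0" for p q
    using that by (simp add: expand_Fract fls_divide_subdegree expand_poly_eq_0_iff expand_poly_subdegree)
  show "\<exists>p q. p \<noteq> 0 \<and> q \<noteq> 0 \<and> det g = Fraction_Field.Fract p q \<and> - fls_subdegree (expand (det g)) = int (degree p) - int (degree q)"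
    using p pq sub[OF p pq(2)] by (intro exI[of _ p] exI[of _ q]) simp
  fix k assume "\<exists>p q. p \<noteq> 0 \<and> q \<noteq> 0 \<and> det g = Fraction_Field.Fract p q \<and> k = int (degree p) - int (degree q)"
  then obtain p q where "p \<noteq> 0" "q \<noteq> 0" "det g = Fraction_Field.Fract p q" "k = int (degree p) - int (degree q)" by blast
  thus "k = - fls_subdegree (expand (det g))" using sub[of p q] by simp
qed

text \<open>
  Isomorphism of the bundles after tensoring one of them with the line bundle whose transition function is the scalar
  \<open>\<mu>\<close>.
\<close>

definition twist_equivalent :: "nat \<Rightarrow> ratfun mat \<Rightarrow> ratfun mat \<Rightarrow> bool" where
  "twist_equivalent n g g' \<longleftrightarrow>
     (\<exists>A \<in> GL n regular_ring. \<exists>C \<in> GL n cusp_ring. \<exists>\<mu>. \<mu> \<noteq> 0 \<and> A * g = \<mu> \<cdot>\<^sub>m (g' * C))"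

lemma smult_smult_mat: "a \<cdot>\<^sub>m (b \<cdot>\<^sub>m M) = (a * b :: 'a :: semigroup_mult) \<cdot>\<^sub>m M"
  by (rule eq_matI) (auto simp: mult.assoc)

lemma inverse_smult_mat: "a \<noteq> 0 \<Longrightarrow> inverse a \<cdot>\<^sub>m (a \<cdot>\<^sub>m M) = (M :: 'a :: field mat)"
  by (rule eq_matI) auto

text \<open>
  Endomorphisms of the stalk at the cusp are transported by conjugation with \<open>A\<close>; the scalar \<open>\<mu>\<close> cancels.
\<close>

lemma conj_stalk:
  fixes s g g' :: "ratfun mat"
  assumes A: "A \<in> carrier_mat n n" "B \<in> carrier_mat n n" "B * A = 1\<^sub>m n" "A * B = 1\<^sub>m n"
    and C: "C \<in> GL n cusp_ring" and \<mu>: "\<mu> \<noteq> 0" and g: "g \<in> carrier_mat n n" "g' \<in> carrier_mat n n"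
    and eq: "A * g = \<mu> \<cdot>\<^sub>m (g' * C)" and s: "s \<in> carrier_mat n n"
    and v: "v \<in> mat_over n cusp_ring" "s * g = g * v"
  shows "\<exists>w \<in> mat_over n cusp_ring. (A * s * B) * g' = g' * w"
proof -
  obtain D where D: "D \<in> GL n cusp_ring" "C * D = 1\<^sub>m n" "D * C = 1\<^sub>m n" using C by (rule GL_inverse)
  note c = GL_D(2)[OF C] GL_D(2)[OF D(1)] mat_over_carrier[OF v(1)]
  have g': "g' = inverse \<mu> \<cdot>\<^sub>m (A * g * D)"
  proof -
    have "A * g * D = \<mu> \<cdot>\<^sub>m (g' * C * D)"
      unfolding eq using c g by (intro mult_smult_assoc_mat[of _ n n]) auto
    also have "g' * C * D = g'" using c g D by (simp add: assoc_mult_mat[of _ n n _ n _ n])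
    finally show ?thesis using \<mu> by (simp add: inverse_smult_mat)
  qed
  have "A * s * B * (A * g * D) = A * s * (B * A) * g * D"
    using A(1,2) s g c by (simp add: assoc_mult_mat[of _ n n _ n _ n])
  also have "\<dots> = A * (s * g) * D" using A s g c by (simp add: assoc_mult_mat[of _ n n _ n _ n])
  also have "\<dots> = A * g * v * D" unfolding v(2) using A s g c by (simp add: assoc_mult_mat[of _ n n _ n _ n])
  also have "\<dots> = \<mu> \<cdot>\<^sub>m (g' * (C * v * D))"
    unfolding eq using c g
    by (simp add: mult_smult_assoc_mat[of _ n n] assoc_mult_mat[of _ n n _ n _ n])
  finally have eq2: "A * s * B * (A * g * D) = \<mu> \<cdot>\<^sub>m (g' * (C * v * D))" .
  have "A * s * B * g' = inverse \<mu> \<cdot>\<^sub>m (A * s * B * (A * g * D))"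
    by (subst g', rule mult_smult_distrib[of _ n n _ n]) (use A s g c in auto)
  also have "\<dots> = g' * (C * v * D)" unfolding eq2 using \<mu> by (rule inverse_smult_mat)
  finally have "A * s * B * g' = g' * (C * v * D)" .
  moreover have "C * v * D \<in> mat_over n cusp_ring"
    using mat_over_mult[OF subring_cusp] GL_D(1)[OF C] GL_D(1)[OF D(1)] v(1) by blast
  ultimately show ?thesis by blast
qed

lemma twist_equivalent_sym:
  assumes "twist_equivalent n g g'" and g: "g \<in> carrier_mat n n" "g' \<in> carrier_mat n n"
  shows "twist_equivalent n g' g"
proof -
  obtain A C \<mu> where A: "A \<in> GL n regular_ring" "C \<in> GL n cusp_ring" "\<mu> \<noteq> 0" "A * g = \<mu> \<cdot>\<^sub>m (g' * C)"
    using assms(1) unfolding twist_equivalent_def by (elim bexE exE conjE)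
  obtain B where B: "B \<in> GL n regular_ring" "A * B = 1\<^sub>m n" "B * A = 1\<^sub>m n" using A(1) by (rule GL_inverse)
  obtain D where D: "D \<in> GL n cusp_ring" "C * D = 1\<^sub>m n" "D * C = 1\<^sub>m n" using A(2) by (rule GL_inverse)
  note c = GL_D(2)[OF A(1)] GL_D(2)[OF A(2)] GL_D(2)[OF B(1)] GL_D(2)[OF D(1)]
  have "g * D = B * (A * g) * D" using B c g by (simp flip: assoc_mult_mat[of _ n n _ n _ n])
  also have "\<dots> = \<mu> \<cdot>\<^sub>m (B * g' * (C * D))" unfolding A(4) using c g
    by (simp add: mult_smult_assoc_mat[of _ n n] mult_smult_distrib[of _ n n _ n] assoc_mult_mat[of _ n n _ n _ n])
  finally have "g * D = \<mu> \<cdot>\<^sub>m (B * g')" using D c g by simp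
  hence "B * g' = inverse \<mu> \<cdot>\<^sub>m (g * D)" using A(3) by (simp add: inverse_smult_mat)
  thus ?thesis unfolding twist_equivalent_def using B(1) D(1) A(3) by (intro bexI exI conjI) auto
qed

lemma twist_equivalent_trans:
  assumes "twist_equivalent n g g'" "twist_equivalent n g' g''"
    and g: "g \<in> carrier_mat n n" "g' \<in> carrier_mat n n" "g'' \<in> carrier_mat n n"
  shows "twist_equivalent n g g''"
proof -
  obtain A C \<mu> where A: "A \<in> GL n regular_ring" "C \<in> GL n cusp_ring" "\<mu> \<noteq> 0" "A * g = \<mu> \<cdot>\<^sub>m (g' * C)"
    using assms(1) unfolding twist_equivalent_def by (elim bexE exE conjE)
  obtain A' C' \<mu>' where A': "A' \<in> GL n regular_ring" "C' \<in> GL n cusp_ring" "\<mu>' \<noteq> 0" "A' * g' = \<mu>' \<cdot>\<^sub>m (g'' * C')"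
    using assms(2) unfolding twist_equivalent_def by (elim bexE exE conjE)
  note c = GL_D(2)[OF A(1)] GL_D(2)[OF A(2)] GL_D(2)[OF A'(1)] GL_D(2)[OF A'(2)]
  have "A' * A * g = A' * (A * g)" using c g by (simp add: assoc_mult_mat[of _ n n _ n _ n])
  also have "\<dots> = \<mu> \<cdot>\<^sub>m (A' * g' * C)" unfolding A(4) using c g
    by (simp add: mult_smult_distrib[of _ n n _ n] assoc_mult_mat[of _ n n _ n _ n])
  also have "\<dots> = \<mu> \<cdot>\<^sub>m (\<mu>' \<cdot>\<^sub>m (g'' * (C' * C)))" unfolding A'(4) using c g
    by (simp add: mult_smult_assoc_mat[of _ n n] assoc_mult_mat[of _ n n _ n _ n])
  also have "\<dots> = (\<mu> * \<mu>') \<cdot>\<^sub>m (g'' * (C' * C))" by (rule smult_smult_mat)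
  finally have "A' * A * g = (\<mu> * \<mu>') \<cdot>\<^sub>m (g'' * (C' * C))" .
  moreover have "A' * A \<in> GL n regular_ring" "C' * C \<in> GL n cusp_ring"
    using GL_mult[OF subring_regular A'(1) A(1)] GL_mult[OF subring_cusp A'(2) A(2)] by auto
  ultimately show ?thesis unfolding twist_equivalent_def using A(3) A'(3)
    by (intro bexI[of _ "A' * A"] bexI[of _ "C' * C"] exI[of _ "\<mu> * \<mu>'"] conjI) auto
qed

lemma End_vb_transfer:
  assumes "twist_equivalent n g g'" and g: "g \<in> carrier_mat n n" "g' \<in> carrier_mat n n"
    and sc: "End_vb n g = {const_fun c \<cdot>\<^sub>m 1\<^sub>m n |c. True}" and u: "u \<in> End_vb n g'"
  shows "\<exists>c. u = const_fun c \<cdot>\<^sub>m 1\<^sub>m n"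
proof -
  obtain A C \<mu> where A: "A \<in> GL n regular_ring" "C \<in> GL n cusp_ring" "\<mu> \<noteq> 0" "A * g' = \<mu> \<cdot>\<^sub>m (g * C)"
    using twist_equivalent_sym[OF assms(1) g] unfolding twist_equivalent_def by (elim bexE exE conjE)
  obtain B where B: "B \<in> GL n regular_ring" "A * B = 1\<^sub>m n" "B * A = 1\<^sub>m n" using A(1) by (rule GL_inverse)
  note c = GL_D(2)[OF A(1)] GL_D(2)[OF B(1)]
  obtain v where u': "u \<in> mat_over n regular_ring" "v \<in> mat_over n cusp_ring" "u * g' = g' * v"
    using u by (auto simp: End_vb_def)
  note uc = mat_over_carrier[OF u'(1)]
  have "\<exists>w \<in> mat_over n cusp_ring. (A * u * B) * g = g * w"
    by (rule conj_stalk[OF c B(3,2) A(2,3) g(2,1) A(4) uc u'(2,3)])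
  moreover have "A * u * B \<in> mat_over n regular_ring"
    using mat_over_mult[OF subring_regular] GL_D(1)[OF A(1)] GL_D(1)[OF B(1)] u'(1) by blast
  ultimately have "A * u * B \<in> End_vb n g" by (simp add: End_vb_def)
  then obtain k where k: "A * u * B = const_fun k \<cdot>\<^sub>m 1\<^sub>m n" using sc by auto
  have "u = B * (A * u * B) * A"
  proof -
    have "B * (A * u * B) * A = (B * A) * u * (B * A)" using c uc by (simp add: assoc_mult_mat[of _ n n _ n _ n])
    thus ?thesis using B uc by simp
  qed
  also have "\<dots> = const_fun k \<cdot>\<^sub>m (B * A)" unfolding k using c
    by (simp add: mult_smult_distrib[of _ n n _ n] mult_smult_assoc_mat[of _ n n])
  finally show ?thesis using B by auto
qed

section \<open>Bundles in normal form\<close>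

lemma subring_diff: "subring_set R \<Longrightarrow> a \<in> R \<Longrightarrow> b \<in> R \<Longrightarrow> a - b \<in> R"
  unfolding subring_set_def by (metis add_uminus_conv_diff)

lemma conj_cancel:
  fixes D :: "'a :: comm_ring_1 mat"
  assumes c: "D \<in> carrier_mat n n" "D' \<in> carrier_mat n n" "w \<in> carrier_mat n n" "N \<in> carrier_mat n n"
      "X \<in> carrier_mat n n" "Y \<in> carrier_mat n n"
    and inv: "D' * D = 1\<^sub>m n" "Y * N = 1\<^sub>m n"
  shows "(D * w * D') * (D * X) = (D * Y) * (N * w * X)"
proof -
  have "(D * w * D') * (D * X) = D * w * (D' * D) * X" "(D * Y) * (N * w * X) = D * (Y * N) * w * X"
    using c by (simp_all add: assoc_mult_mat[of _ n n _ n _ n])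
  thus ?thesis using inv c by simp
qed

text \<open>
  A matrix whose jet in the frame \<open>D\<close> satisfies the gluing condition maps the stalk of \<open>D (1 + t B)\<close> to the stalk of
  \<open>D (1 + t B')\<close>.
\<close>

lemma stalk_conj_zdiag:
  assumes w: "jet n w M0 M1" and B: "B \<in> carrier_mat n n" "B' \<in> carrier_mat n n"
    and eq: "M1 + (M0 * B - B' * M0) = 0\<^sub>m n n"
  obtains v where "jet n v M0 (0\<^sub>m n n)"
    "(zdiag n a * w * zdiag n (\<lambda>i. - a i)) * (zdiag n a * glue n B) = (zdiag n a * glue n B') * v"
proof -
  obtain N where N: "jet n N (1\<^sub>m n) (- B')" "glue n B' * N = 1\<^sub>m n" using glue_inverse[OF B(2)] by blast
  let ?v = "N * w * glue n B" and ?D = "zdiag n a" and ?D' = "zdiag n (\<lambda>i. - a i)"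
  note c = jetD(4)[OF w] jetD(4)[OF N(1)] jetD(4)[OF jet_glue[OF B(1)]] jetD(4)[OF jet_glue[OF B(2)]]
    zdiag_carrier(1)[of n a] zdiag_carrier(1)[of n "\<lambda>i. - a i"]
  have "(?D * w * ?D') * (?D * glue n B) = (?D * glue n B') * ?v"
    by (rule conj_cancel[OF zdiag_carrier(1) zdiag_carrier(1) c(1-4) zdiag_inverse(2) N(2)])
  moreover have "jet n ?v M0 (0\<^sub>m n n)" using jet_conj_glue[OF N(1) w B] unfolding eq .
  ultimately show ?thesis by (intro that)
qed

lemma conj_zdiag_entry:
  assumes "w \<in> carrier_mat n n" "i < n" "j < n"
  shows "(zdiag n a * w * zdiag n (\<lambda>i. - a i)) $$ (i, j) = z_fun powi (a i - a j) * w $$ (i, j)"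
proof -
  have "(zdiag n a * w * zdiag n (\<lambda>i. - a i)) $$ (i, j) = (zdiag n a * w) $$ (i, j) * z_fun powi (- a j)"
    by (rule mult_zdiag[OF mult_carrier_mat[OF zdiag_carrier(1) assms(1)] assms(2,3)])
  also have "(zdiag n a * w) $$ (i, j) = z_fun powi a i * w $$ (i, j)" using assms by (intro zdiag_mult)
  finally show ?thesis using z_nonzero by (simp add: power_int_diff power_int_minus field_simps)
qed

lemma glue_scalar: "glue n (c \<cdot>\<^sub>m 1\<^sub>m n) = (1 + inverse z_fun * const_fun c) \<cdot>\<^sub>m 1\<^sub>m n"
  by (rule eq_matI) (auto simp: glue_def)

text \<open>
  The line bundle with transition function \<open>1 + c t\<close> has degree \<open>0\<close>; up to second order it adds \<open>c\<close> to \<open>B\<close>.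
\<close>

lemma twist_glue:
  assumes B: "B \<in> carrier_mat n n" and D: "D \<in> carrier_mat n n"
  shows "twist_equivalent n (D * glue n B) (D * glue n (B + c \<cdot>\<^sub>m 1\<^sub>m n))"
proof -
  define \<mu> where "\<mu> = 1 + inverse z_fun * const_fun c"
  have t: "tc \<mu> 0 = 1"
    by (simp add: \<mu>_def expand_hom.hom_add expand_hom.hom_mult expand_t expand_const fls_X_times_conv_shift)
  hence \<mu>: "\<mu> \<noteq> 0" by auto
  let ?S = "c \<cdot>\<^sub>m 1\<^sub>m n :: complex mat"
  have S: "?S \<in> carrier_mat n n" by simp
  have BS: "B + ?S \<in> carrier_mat n n" using B by simp
  obtain N where N: "jet n N (1\<^sub>m n) (- (B + ?S))" "glue n (B + ?S) * N = 1\<^sub>m n" "N * glue n (B + ?S) = 1\<^sub>m n"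
    using glue_inverse[OF BS] by blast
  define C where "C = N * (glue n B * glue n ?S)"
  have "jet n (glue n B * glue n ?S) (1\<^sub>m n * 1\<^sub>m n) (1\<^sub>m n * ?S + B * 1\<^sub>m n)"
    by (intro jet_mult jet_glue B S)
  hence J1: "jet n (glue n B * glue n ?S) (1\<^sub>m n) (?S + B)" using B by simp
  have "jet n C (1\<^sub>m n * 1\<^sub>m n) (1\<^sub>m n * (?S + B) + (- (B + ?S)) * 1\<^sub>m n)"
    unfolding C_def by (intro jet_mult N J1)
  moreover have "1\<^sub>m n * (?S + B) + (- (B + ?S)) * 1\<^sub>m n = 0\<^sub>m n n"
    using B by (intro eq_matI) auto
  ultimately have "jet n C (1\<^sub>m n) (0\<^sub>m n n)" by simp
  hence C: "C \<in> GL n cusp_ring" by (intro GL_cusp_jet) auto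
  note c = jetD(4)[OF N(1)] jetD(4)[OF jet_glue[OF B]] jetD(4)[OF jet_glue[OF S]] jetD(4)[OF jet_glue[OF BS]] GL_D(2)[OF C]
  have "D * glue n (B + ?S) * C = D * (glue n (B + ?S) * N) * (glue n B * glue n ?S)"
    unfolding C_def using c D by (simp add: assoc_mult_mat[of _ n n _ n _ n])
  also have "\<dots> = D * (glue n B * glue n ?S)" using N D by simp
  also have "\<dots> = \<mu> \<cdot>\<^sub>m (D * glue n B)"
    unfolding glue_scalar \<mu>_def[symmetric] using c D by (simp add: mult_smult_distrib[of _ n n _ n])
  finally have "D * glue n B = inverse \<mu> \<cdot>\<^sub>m (D * glue n (B + ?S) * C)"
    using \<mu> by (simp add: inverse_smult_mat)
  hence "1\<^sub>m n * (D * glue n B) = inverse \<mu> \<cdot>\<^sub>m (D * glue n (B + ?S) * C)"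
    using D c by simp
  thus ?thesis unfolding twist_equivalent_def
    using \<mu> GL_one[OF subring_regular] C by (intro bexI[of _ "1\<^sub>m n"] bexI[of _ C] exI[of _ "inverse \<mu>"] conjI) auto
qed

definition std_exponents :: "nat \<Rightarrow> nat \<Rightarrow> int" where
  "std_exponents e i = (if i < e then 0 else 1)"

text \<open>
  The bundle glued by \<open>B\<close> whose pull-back is the sum of \<open>e\<close> trivial bundles and \<open>n - e\<close> copies of \<open>O(1)\<close>.
\<close>

definition std_bundle :: "nat \<Rightarrow> nat \<Rightarrow> complex mat \<Rightarrow> ratfun mat" where
  "std_bundle n e B = zdiag n (std_exponents e) * glue n B"

lemma std_bundle_carrier: "B \<in> carrier_mat n n \<Longrightarrow> std_bundle n e B \<in> carrier_mat n n"
  unfolding std_bundle_def by (rule mult_carrier_mat[OF zdiag_carrier(1) jetD(4)[OF jet_glue]])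

definition hom_lift :: "nat \<Rightarrow> nat \<Rightarrow> complex mat \<Rightarrow> complex mat \<Rightarrow> complex mat \<Rightarrow> ratfun mat" where
  "hom_lift n e B B' F = zdiag n (std_exponents e) *
     (map_mat const_fun F + inverse z_fun \<cdot>\<^sub>m map_mat const_fun (- (F * B - B' * F))) *
     zdiag n (\<lambda>i. - std_exponents e i)"

text \<open>
  The homomorphism of bundles with value \<open>F\<close> at the cusp. Conjugation by \<open>D\<close> multiplies the lower left block by \<open>z\<close>;
  so the defect \<open>F B - B' F\<close>, which sits in this block with a factor \<open>t\<close>, becomes constant, and all entries are
  polynomials.
\<close>

lemma hom_lift_props:
  assumes F: "F \<in> homs n e B B'" and B: "B \<in> carrier_mat n n" "B' \<in> carrier_mat n n"
  shows "hom_lift n e B B' F \<in> mat_over n regular_ring"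
    and "\<exists>v. jet n v F (0\<^sub>m n n) \<and> hom_lift n e B B' F * std_bundle n e B = std_bundle n e B' * v"
    and "i < n \<Longrightarrow> j < n \<Longrightarrow> hom_lift n e B B' F $$ (i, j) =
      z_fun powi (std_exponents e i - std_exponents e j) *
      (const_fun (F $$ (i, j)) - inverse z_fun * const_fun ((F * B - B' * F) $$ (i, j)))"
    and "det (hom_lift n e B B' F) \<in> inf_ring" "tc (det (hom_lift n e B B' F)) 0 = det F"
proof -
  let ?a = "std_exponents e"
  define L where "L = F * B - B' * F"
  have c: "F \<in> carrier_mat n n" using F homs_carrier by blast
  have L: "L \<in> carrier_mat n n" "L \<in> corner n e" and bl: "F \<in> block_lower n e"
    using F c B by (auto simp: L_def homs_def)
  define w where "w = map_mat const_fun F + inverse z_fun \<cdot>\<^sub>m map_mat const_fun (- L)"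
  have J: "jet n w F (- L)" unfolding w_def using jet_const_t[of F n "- L"] c L by simp
  note wc = jetD(4)[OF J]
  have u: "hom_lift n e B B' F = zdiag n ?a * w * zdiag n (\<lambda>i. - ?a i)"
    by (simp add: hom_lift_def w_def L_def)
  have uc: "hom_lift n e B B' F \<in> carrier_mat n n"
    unfolding u by (intro mult_carrier_mat[of _ n n] zdiag_carrier wc)
  have we: "w $$ (i, j) = const_fun (F $$ (i, j)) - inverse z_fun * const_fun (L $$ (i, j))" if "i < n" "j < n" for i j
    using that c L by (simp add: w_def const_fun_hom.hom_uminus)
  show ent: "hom_lift n e B B' F $$ (i, j) =
      z_fun powi (?a i - ?a j) * (const_fun (F $$ (i, j)) - inverse z_fun * const_fun ((F * B - B' * F) $$ (i, j)))"
    if "i < n" "j < n" for i j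
    unfolding u conj_zdiag_entry[OF wc that] we[OF that] L_def ..
  have "hom_lift n e B B' F $$ (i, j) \<in> regular_ring" if ij: "i < n" "j < n" for i j
  proof -
    note e' = ent[OF ij, folded L_def]
    have L0: "L $$ (i, j) = 0" if "\<not> (e \<le> i \<and> j < e)" using L(2) ij that unfolding corner_def by blast
    have F0: "F $$ (i, j) = 0" if "i < e" "e \<le> j" using bl ij that unfolding block_lower_def by blast
    show ?thesis
    proof (cases "e \<le> i \<and> j < e")
      case True
      hence "hom_lift n e B B' F $$ (i, j) = z_fun * const_fun (F $$ (i, j)) - const_fun (L $$ (i, j))"
        unfolding e' using z_nonzero by (simp add: std_exponents_def field_simps)
      moreover have "z_fun * const_fun (F $$ (i, j)) \<in> regular_ring"
        using subring_regular const_in_regular z_in_regular unfolding subring_set_def by blast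
      ultimately show ?thesis using subring_diff[OF subring_regular] const_in_regular by simp
    next
      case False
      show ?thesis
      proof (cases "i < e \<and> e \<le> j")
        case True
        thus ?thesis unfolding e' using F0 L0[OF False] subring_regular by (simp add: subring_set_def)
      next
        case F2: False
        hence "?a i - ?a j = 0" using False by (auto simp: std_exponents_def)
        thus ?thesis unfolding e' using L0[OF False] const_in_regular by simp
      qed
    qed
  qed
  thus "hom_lift n e B B' F \<in> mat_over n regular_ring" using uc by (auto simp: mat_over_def)
  have "- L + (F * B - B' * F) = 0\<^sub>m n n" unfolding L_def[symmetric] using L by (intro eq_matI) auto
  obtain v where "jet n v F (0\<^sub>m n n)"
    "zdiag n ?a * w * zdiag n (\<lambda>i. - ?a i) * (zdiag n ?a * glue n B) = zdiag n ?a * glue n B' * v"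
    by (rule stalk_conj_zdiag[OF J B \<open>- L + (F * B - B' * F) = 0\<^sub>m n n\<close>])
  thus "\<exists>v. jet n v F (0\<^sub>m n n) \<and> hom_lift n e B B' F * std_bundle n e B = std_bundle n e B' * v"
    unfolding u std_bundle_def by (intro exI[of _ v] conjI)
  have "det (hom_lift n e B B' F) = det (zdiag n ?a) * det w * det (zdiag n (\<lambda>i. - ?a i))"
    unfolding u using wc by (simp add: det_mult[of _ n] mult_carrier_mat[OF zdiag_carrier(1)])
  also have "\<dots> = det (zdiag n ?a) * det (zdiag n (\<lambda>i. - ?a i)) * det w" by simp
  also have "det (zdiag n ?a) * det (zdiag n (\<lambda>i. - ?a i)) = 1"
    using det_mult[OF zdiag_carrier(1) zdiag_carrier(1), of n ?a "\<lambda>i. - ?a i"] by (simp add: zdiag_inverse)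
  finally have "det (hom_lift n e B B' F) = det w" by simp
  thus "det (hom_lift n e B B' F) \<in> inf_ring" "tc (det (hom_lift n e B B' F)) 0 = det F"
    using jet_det[OF J] by simp_all
qed

text \<open>
  Each endomorphism of \<open>B\<close> lifts to an endomorphism of the bundle, and \<open>F\<close> is recovered as its value at the cusp.
\<close>

lemma std_bundle_brick:
  assumes B: "B \<in> carrier_mat n n"
    and sc: "\<And>u. u \<in> End_vb n (std_bundle n e B) \<Longrightarrow> \<exists>c. u = const_fun c \<cdot>\<^sub>m 1\<^sub>m n"
  shows "brick n e B"
proof -
  have "\<exists>c. F = c \<cdot>\<^sub>m 1\<^sub>m n" if F: "F \<in> homs n e B B" for F
  proof -
    have c: "F \<in> carrier_mat n n" using F homs_carrier by blast
    from hom_lift_props(2)[OF F B B] obtain v where v: "jet n v F (0\<^sub>m n n)"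
      "hom_lift n e B B F * std_bundle n e B = std_bundle n e B * v" by (elim exE conjE)
    have "v \<in> mat_over n cusp_ring" using v(1) mat_over_cusp_iff_jet by blast
    hence "hom_lift n e B B F \<in> End_vb n (std_bundle n e B)"
      using hom_lift_props(1)[OF F B B] v(2) unfolding End_vb_def by blast
    from sc[OF this] obtain k where k: "hom_lift n e B B F = const_fun k \<cdot>\<^sub>m 1\<^sub>m n" by (elim exE)
    have "F = k \<cdot>\<^sub>m 1\<^sub>m n"
    proof (rule eq_matI)
      fix i j assume "i < dim_row (k \<cdot>\<^sub>m 1\<^sub>m n)" "j < dim_col (k \<cdot>\<^sub>m 1\<^sub>m n)"
      hence ij: "i < n" "j < n" by auto
      define m where "m = std_exponents e i - std_exponents e j"
      define L where "L = (F * B - B * F) $$ (i, j)"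
      have "z_fun powi m * (const_fun (F $$ (i, j)) - inverse z_fun * const_fun L) = (if i = j then const_fun k else 0)"
      proof -
        have "hom_lift n e B B F $$ (i, j) = (if i = j then const_fun k else 0)" unfolding k using ij by simp
        thus ?thesis using hom_lift_props(3)[OF F B B ij] unfolding m_def L_def by (rule trans[OF sym, rotated])
      qed
      hence "tc (z_fun powi m * (const_fun (F $$ (i, j)) - inverse z_fun * const_fun L)) (- m) = tc (if i = j then const_fun k else 0) (- m)"
        by simp
      moreover have "tc (z_fun powi m * (const_fun (F $$ (i, j)) - inverse z_fun * const_fun L)) (- m) = F $$ (i, j)"
        unfolding tc_z_powi_mult by (simp add: expand_hom.hom_minus expand_hom.hom_mult expand_const expand_t fls_X_times_conv_shift)
      moreover have "i = j \<Longrightarrow> m = 0" by (simp add: m_def)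
      ultimately show "F $$ (i, j) = (k \<cdot>\<^sub>m 1\<^sub>m n) $$ (i, j)" using ij by (auto simp: expand_const)
    qed (use c in auto)
    thus ?thesis by blast
  qed
  thus ?thesis using B unfolding brick_def by blast
qed

text \<open>
  A function without poles on the whole projective line is constant.
\<close>

lemma regular_inf_const:
  assumes "f \<in> regular_ring" "f \<in> inf_ring" shows "f = const_fun (tc f 0)"
proof -
  obtain p where p: "f = to_fract p" using assms(1) by (auto simp: regular_ring_def)
  have "degree p = 0"
  proof (rule ccontr)
    assume d: "degree p \<noteq> 0"
    have "tc f (- int (degree p)) = 0" using assms(2) d by (auto simp: inf_ring_def)
    hence "lead_coeff p = 0" by (simp add: p expand_to_fract expand_poly_nth)
    thus False using d by simp
  qed
  then obtain c where "p = [:c:]" by (rule degree_eq_zeroE)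
  thus ?thesis by (simp add: p expand_to_fract expand_poly_nth const_fun_def)
qed

lemma isomorphic_std_bundle:
  assumes iso: "isomorphic n e B B'" and B: "B \<in> carrier_mat n n" "B' \<in> carrier_mat n n"
  shows "twist_equivalent n (std_bundle n e B) (std_bundle n e B')"
proof -
  obtain F G where FG: "F \<in> homs n e B B'" "G \<in> homs n e B' B" "F * G = 1\<^sub>m n"
    using iso by (auto simp: isomorphic_def)
  have c: "F \<in> carrier_mat n n" "G \<in> carrier_mat n n" using FG homs_carrier by blast+
  have "det F * det G = 1" using det_mult[OF c] FG(3) by simp
  hence dF: "det F \<noteq> 0" by auto
  let ?u = "hom_lift n e B B' F"
  note u = hom_lift_props[OF FG(1) B]
  from u(2) obtain v where v: "jet n v F (0\<^sub>m n n)" "?u * std_bundle n e B = std_bundle n e B' * v"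
    by (elim exE conjE)
  have "v \<in> GL n cusp_ring" using GL_cusp_jet[OF v(1) dF] .
  moreover have "?u \<in> GL n regular_ring"
  proof (rule GL_I[OF subring_regular u(1)])
    have "det ?u \<in> regular_ring" using u(1) by (intro det_in_subring[OF subring_regular]) (auto simp: mat_over_def)
    hence d: "det ?u = const_fun (det F)" using regular_inf_const u(4,5) by metis
    show "det ?u \<noteq> 0" using dF by (simp add: d)
    have "inverse (const_fun (det F)) = const_fun (inverse (det F))" by (simp add: const_fun_hom.hom_inverse)
    thus "inverse (det ?u) \<in> regular_ring" unfolding d using const_in_regular by simp
  qed
  moreover have "?u * std_bundle n e B = 1 \<cdot>\<^sub>m (std_bundle n e B' * v)" unfolding v(2) by (intro eq_matI) auto
  ultimately show ?thesis unfolding twist_equivalent_def by (intro bexI[of _ ?u] bexI[of _ v] exI[of _ 1] conjI) auto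
qed

lemma brick_shift:
  assumes "brick n e B" shows "brick n e (B + c \<cdot>\<^sub>m 1\<^sub>m n)"
proof -
  have B: "B \<in> carrier_mat n n" using assms by (simp add: brick_def)
  have "F * (B + c \<cdot>\<^sub>m 1\<^sub>m n) - (B + c \<cdot>\<^sub>m 1\<^sub>m n) * F = F * B - B * F" if F: "F \<in> carrier_mat n n" for F
  proof -
    have "F * (B + c \<cdot>\<^sub>m 1\<^sub>m n) = F * B + c \<cdot>\<^sub>m F" "(B + c \<cdot>\<^sub>m 1\<^sub>m n) * F = B * F + c \<cdot>\<^sub>m F"
      using B F by (simp_all add: mult_add_distrib_mat[of _ n n _ n] add_mult_distrib_mat[of _ n n _ _ n]
          mult_smult_distrib[of _ n n _ n] mult_smult_assoc_mat[of _ n n])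
    moreover have "X + Z - (Y + Z) = X - Y" if "X \<in> carrier_mat n n" "Y \<in> carrier_mat n n" "Z \<in> carrier_mat n n" for X Y Z :: "complex mat"
      using that by (intro eq_matI) auto
    ultimately show ?thesis using B F by simp
  qed
  hence "homs n e (B + c \<cdot>\<^sub>m 1\<^sub>m n) (B + c \<cdot>\<^sub>m 1\<^sub>m n) = homs n e B B"
    unfolding homs_def by (auto dest: block_lower_carrier)
  thus ?thesis using assms B unfolding brick_def by auto
qed

lemma std_bundle_classification:
  assumes br: "brick n e B" "brick n e B'" and e: "e \<le> n" and n: "0 < n"
  shows "twist_equivalent n (std_bundle n e B) (std_bundle n e B')"
proof -
  have B: "B \<in> carrier_mat n n" "B' \<in> carrier_mat n n" using br by (auto simp: brick_def)
  define c where "c = (mtrace B' - mtrace B) / of_nat n"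
  have Bc: "B + c \<cdot>\<^sub>m 1\<^sub>m n \<in> carrier_mat n n" using B by simp
  have "mtrace (B + c \<cdot>\<^sub>m 1\<^sub>m n) = mtrace B'"
    using B n by (simp add: mtrace_add[of _ n] mtrace_smult[of _ n] mtrace_one c_def)
  hence "isomorphic n e (B + c \<cdot>\<^sub>m 1\<^sub>m n) B'"
    using brick_isomorphic[OF e brick_shift[OF br(1)] br(2)] by blast
  hence "twist_equivalent n (std_bundle n e (B + c \<cdot>\<^sub>m 1\<^sub>m n)) (std_bundle n e B')"
    using isomorphic_std_bundle Bc B by blast
  moreover have "twist_equivalent n (std_bundle n e B) (std_bundle n e (B + c \<cdot>\<^sub>m 1\<^sub>m n))"
    unfolding std_bundle_def by (rule twist_glue[OF B(1) zdiag_carrier(1)])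
  ultimately show ?thesis using twist_equivalent_trans[OF _ _ std_bundle_carrier[OF B(1)] std_bundle_carrier[OF Bc] std_bundle_carrier[OF B(2)]]
    by blast
qed

section \<open>Classification of the simple bundles\<close>

text \<open>
  If \<open>a i - a j \<ge> 2\<close>, then the matrix unit at \<open>(i, j)\<close> has a double zero at the cusp in the frame \<open>D\<close>. So it meets
  the gluing condition for every \<open>B\<close> and is an endomorphism of the bundle, but not a scalar.
\<close>

lemma exponent_gap:
  fixes a :: "nat \<Rightarrow> int"
  assumes B: "B \<in> carrier_mat n n" and ij: "i < n" "j < n"
    and sc: "\<And>u. u \<in> End_vb n (zdiag n a * glue n B) \<Longrightarrow> \<exists>c. u = const_fun c \<cdot>\<^sub>m 1\<^sub>m n"
  shows "a i - a j < 2"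
proof (rule ccontr)
  assume gap: "\<not> a i - a j < 2"
  hence neq: "i \<noteq> j" by auto
  define w where "w = Matrix.mat n n (\<lambda>(k, l). if k = i \<and> l = j then z_fun powi (a j - a i) else 0)"
  have z: "tc (z_fun powi (a j - a i)) m = 0" if "m \<le> 1" for m
    using that gap by (simp add: expand_z_powi)
  have J: "jet n w (0\<^sub>m n n) (0\<^sub>m n n)"
    by (rule jetI) (auto simp: w_def inf_ring_def z)
  have "0\<^sub>m n n + (0\<^sub>m n n * B - B * 0\<^sub>m n n) = (0\<^sub>m n n :: complex mat)" using B by simp (auto intro!: eq_matI)
  from stalk_conj_zdiag[OF J B B this] obtain v where v: "jet n v (0\<^sub>m n n) (0\<^sub>m n n)"
    "(zdiag n a * w * zdiag n (\<lambda>i. - a i)) * (zdiag n a * glue n B) = (zdiag n a * glue n B) * v" .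
  let ?u = "zdiag n a * w * zdiag n (\<lambda>i. - a i)"
  have uc: "?u \<in> carrier_mat n n" by (intro mult_carrier_mat[of _ n n] zdiag_carrier jetD(4)[OF J])
  have ue: "?u $$ (k, l) = (if k = i \<and> l = j then 1 else 0)" if "k < n" "l < n" for k l
    unfolding conj_zdiag_entry[OF jetD(4)[OF J] that] using that z_nonzero
    by (auto simp: w_def power_int_add[symmetric])
  have "?u \<in> mat_over n regular_ring"
    using uc subring_regular unfolding mat_over_def by (auto simp: ue subring_set_def simp del: index_mult_mat)
  moreover have "v \<in> mat_over n cusp_ring" using v(1) mat_over_cusp_iff_jet by blast
  ultimately have "?u \<in> End_vb n (zdiag n a * glue n B)" using v(2) unfolding End_vb_def by blast
  from sc[OF this] obtain c where c: "?u = const_fun c \<cdot>\<^sub>m 1\<^sub>m n" by (elim exE)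
  have "?u $$ (i, j) = 0" unfolding c using ij neq by simp
  thus False using ue[OF ij] by simp
qed

lemma subdegree_det_GL_cusp: "C \<in> GL n cusp_ring \<Longrightarrow> fls_subdegree (expand (det C)) = 0"
  by (rule GL_inf_det(1)[OF GL_mono[OF cusp_inf]])

text \<open>
  All exponents are \<open>b\<close> or \<open>b + 1\<close> with \<open>b = a 0\<close>, so \<open>d = n b + k\<close> with \<open>k < n\<close>. Because \<open>0 < d < n\<close>, this forces \<open>b = 0\<close> and
  \<open>k = d\<close>, and by monotonicity the \<open>d\<close> ones stand at the end.
\<close>

lemma sorted_exponents:
  fixes a :: "nat \<Rightarrow> int"
  assumes sorted: "\<And>i j. i \<le> j \<Longrightarrow> j < n \<Longrightarrow> a i \<le> a j" and gap: "\<And>i j. i < n \<Longrightarrow> j < n \<Longrightarrow> a i - a j < 2"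
    and sum: "(\<Sum>i<n. a i) = int d" and d: "0 < d" "d < n" and i: "i < n"
  shows "a i = std_exponents (n - d) i"
proof -
  define b where "b = a 0"
  define S where "S = {i. i < n \<and> a i = b + 1}"
  have ab: "a i = b + (if i \<in> S then 1 else 0)" if "i < n" for i
    using sorted[of 0 i] gap[of i 0] that by (auto simp: S_def b_def)
  have S: "finite S" "S \<subseteq> {..<n}" "0 \<notin> S" by (auto simp: S_def b_def)
  have "int d = (\<Sum>i<n. b + (if i \<in> S then 1 else 0))" unfolding sum[symmetric] by (intro sum.cong) (auto simp: ab)
  also have "\<dots> = int n * b + int (card S)"
    using S by (simp add: sum.distrib sum.If_cases Int_absorb1)
  finally have eq: "int d = int n * b + int (card S)" .
  have "card S < n"
  proof -
    have "S \<subseteq> {1..<n}" using S by (auto simp: Suc_le_eq intro!: Nat.gr0I)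
    hence "card S \<le> n - 1" using card_mono[of "{1..<n}" S] by simp
    thus ?thesis using d by simp
  qed
  have b0: "b = 0"
  proof (rule ccontr)
    assume "b \<noteq> 0"
    hence "b \<ge> 1 \<or> b \<le> -1" by arith
    hence "int n * 1 \<le> int n * b \<or> int n * b \<le> int n * (-1)"
      using mult_left_mono[of 1 b "int n"] mult_left_mono[of b "-1" "int n"] by auto
    moreover have "int d < int n" "int (card S) < int n" "0 \<le> int (card S)" "0 < int d"
      using d \<open>card S < n\<close> by simp_all
    ultimately show False using eq by linarith
  qed
  hence cS: "card S = d" using eq by simp
  show ?thesis
  proof (cases "i \<in> S")
    case True
    have "k \<in> S" if k: "i \<le> k" "k < n" for k
    proof -
      have "a i \<le> a k" using sorted k by simp
      moreover have "a i = b + 1" using True by (simp add: S_def)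
      moreover have "a k \<le> b + 1" using ab[OF k(2)] by (auto split: if_splits)
      ultimately have "a k = b + 1" by linarith
      thus ?thesis using k by (simp add: S_def)
    qed
    hence sub: "{i..<n} \<subseteq> S" by (meson atLeastLessThan_iff subsetI)
    have "n - i \<le> d" using card_mono[OF S(1) sub] by (simp add: cS)
    thus ?thesis using ab[OF i] True b0 i d by (simp add: std_exponents_def)
  next
    case False
    have "S \<subseteq> {i<..<n}"
    proof
      fix k assume k: "k \<in> S"
      have "\<not> k \<le> i"
      proof
        assume "k \<le> i"
        hence "a k \<le> a i" using sorted i by simp
        moreover have "a i = b" using ab[OF i] False by simp
        moreover have "a k = b + 1" using k by (simp add: S_def)
        ultimately show False by simp
      qed
      thus "k \<in> {i<..<n}" using k by (simp add: S_def)
    qed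
    hence "d \<le> card {i<..<n}" using cS card_mono[of "{i<..<n}" S] by simp
    also have "card {i<..<n} = n - Suc i" by simp
    finally have "i < n - d" using i d by linarith
    thus ?thesis using ab[OF i] False b0 by (simp add: std_exponents_def)
  qed
qed

lemma simple_normal_form:
  assumes g: "simple_bundle n (int d) g" and d: "0 < d" "d < n"
  obtains B where "brick n (n - d) B" "twist_equivalent n g (std_bundle n (n - d) B)"
proof -
  have vb: "vector_bundle n g" and deg: "vb_degree g = int d"
    and En: "End_vb n g = {const_fun c \<cdot>\<^sub>m 1\<^sub>m n |c. True}" using g by (auto simp: simple_bundle_def)
  have gc: "g \<in> carrier_mat n n" "det g \<noteq> 0" using vb by (auto simp: vector_bundle_def)
  obtain A a B C where A: "A \<in> GL n regular_ring" and C: "C \<in> GL n cusp_ring" and B: "B \<in> carrier_mat n n"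
    and srt0: "\<forall>i j. i \<le> j \<longrightarrow> j < n \<longrightarrow> a i \<le> a j" and eq: "A * g = zdiag n a * glue n B * C"
    by (rule normal_form[OF vb])
  note srt = srt0[rule_format]
  have gl: "glue n B \<in> GL n inf_ring" using GL_inf_jet[OF jet_glue[OF B]] by simp
  let ?g0 = "zdiag n a * glue n B"
  have g0c: "?g0 \<in> carrier_mat n n" by (rule mult_carrier_mat[OF zdiag_carrier(1) GL_D(2)[OF gl]])
  have "A * g = 1 \<cdot>\<^sub>m (?g0 * C)" unfolding eq by (intro eq_matI) auto
  hence tw: "twist_equivalent n g ?g0"
    unfolding twist_equivalent_def using A C by (intro bexI[of _ A] bexI[of _ C] exI[of _ 1] conjI) auto
  have sc: "\<exists>c. u = const_fun c \<cdot>\<^sub>m 1\<^sub>m n" if "u \<in> End_vb n ?g0" for u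
    using End_vb_transfer[OF tw gc(1) g0c En that] .
  have gap: "a i - a j < 2" if "i < n" "j < n" for i j
    by (rule exponent_gap[OF B that sc])
  have suma: "(\<Sum>i<n. a i) = int d"
  proof -
    have "det A * det g = z_fun powi (\<Sum>i<n. a i) * det (glue n B) * det C"
      using det_mult[OF GL_D(2)[OF A] gc(1)] det_mult[OF g0c GL_D(2)[OF C]]
        det_mult[OF zdiag_carrier(1) GL_D(2)[OF gl], of a] by (simp add: eq det_zdiag)
    hence "fls_subdegree (expand (det A * det g)) = fls_subdegree (expand (z_fun powi (\<Sum>i<n. a i) * det (glue n B) * det C))"
      by simp
    hence "fls_subdegree (expand (det g)) = - (\<Sum>i<n. a i)"
      using GL_det[OF A] gc(2) GL_det[OF gl] GL_det[OF C] z_nonzero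
      by (simp add: subdegree_expand_mult subdegree_z_powi GL_regular_det[OF A] GL_inf_det(1)[OF gl] subdegree_det_GL_cusp[OF C])
    thus ?thesis using deg vb_degree_eq[OF gc(2)] by simp
  qed
  have "a i = std_exponents (n - d) i" if "i < n" for i
    by (rule sorted_exponents[OF srt gap suma d that])
  hence "zdiag n a = zdiag n (std_exponents (n - d))" by (auto simp: zdiag_def intro!: eq_matI)
  hence g0: "?g0 = std_bundle n (n - d) B" by (simp add: std_bundle_def)
  have "brick n (n - d) B" by (rule std_bundle_brick[OF B sc[unfolded g0]])
  from that[OF this tw[unfolded g0]] show ?thesis .
qed

theorem simple_bundles_twist_equivalent:
  assumes "simple_bundle n (int d) g" "simple_bundle n (int d) g'" and d: "0 < d" "d < n"
  shows "twist_equivalent n g g'"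
proof -
  have gc: "g \<in> carrier_mat n n" "g' \<in> carrier_mat n n" using assms by (auto simp: simple_bundle_def vector_bundle_def)
  obtain B where B: "brick n (n - d) B" "twist_equivalent n g (std_bundle n (n - d) B)"
    by (rule simple_normal_form[OF assms(1) d])
  obtain B' where B': "brick n (n - d) B'" "twist_equivalent n g' (std_bundle n (n - d) B')"
    by (rule simple_normal_form[OF assms(2) d])
  have c: "std_bundle n (n - d) B \<in> carrier_mat n n" "std_bundle n (n - d) B' \<in> carrier_mat n n"
    using B(1) B'(1) std_bundle_carrier by (auto simp: brick_def)
  have "twist_equivalent n (std_bundle n (n - d) B) (std_bundle n (n - d) B')"
    using d by (intro std_bundle_classification B(1) B'(1)) auto
  from twist_equivalent_trans[OF B(2) this gc(1) c]
  show ?thesis using twist_equivalent_trans[OF _ twist_equivalent_sym[OF B'(2) gc(2) c(2)] gc(1) c(2) gc(2)] by blast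
qed

section \<open>Duality\<close>

text \<open>
  Given the inverse \<open>gi\<close> of a transition matrix \<open>g\<close>, the transposed inverse is the transition matrix of the dual
  bundle; the factor \<open>z\<close> is the transition function of a line bundle of degree \<open>1\<close>.
\<close>

definition dual_bundle :: "ratfun mat \<Rightarrow> ratfun mat" where
  "dual_bundle gi = z_fun \<cdot>\<^sub>m transpose_mat gi"

lemma transpose_mat_over: "A \<in> mat_over n R \<Longrightarrow> transpose_mat A \<in> mat_over n R"
  by (auto simp: mat_over_def)

lemma dual_stalk:
  assumes g: "g \<in> carrier_mat n n" "gi \<in> carrier_mat n n" "g * gi = 1\<^sub>m n" "gi * g = 1\<^sub>m n"
    and s: "s \<in> carrier_mat n n" "v \<in> carrier_mat n n"
  shows "s * g = g * v \<longleftrightarrow> transpose_mat s * dual_bundle gi = dual_bundle gi * transpose_mat v"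
proof -
  let ?t = "transpose_mat :: ratfun mat \<Rightarrow> ratfun mat"
  have "s * g = g * v \<longleftrightarrow> gi * s = v * gi"
  proof
    assume eq: "s * g = g * v"
    have "gi * s = gi * (s * g) * gi" using g s by (simp add: assoc_mult_mat[of _ n n _ n _ n])
    also have "\<dots> = (gi * g) * v * gi" unfolding eq using g(1,2) s by (simp add: assoc_mult_mat[of _ n n _ n _ n])
    finally show "gi * s = v * gi" using g s by simp
  next
    assume eq: "gi * s = v * gi"
    have "s * g = (g * gi) * s * g" using g s by simp
    also have "\<dots> = g * (gi * s) * g" using g(1,2) s by (simp add: assoc_mult_mat[of _ n n _ n _ n])
    also have "\<dots> = g * v * (gi * g)" unfolding eq using g(1,2) s by (simp add: assoc_mult_mat[of _ n n _ n _ n])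
    finally show "s * g = g * v" using g s by simp
  qed
  also have "\<dots> \<longleftrightarrow> ?t s * ?t gi = ?t gi * ?t v"
    using transpose_mult[of gi n n s n] transpose_mult[of v n n gi n] g s by (metis transpose_transpose)
  also have "\<dots> \<longleftrightarrow> z_fun \<cdot>\<^sub>m (?t s * ?t gi) = z_fun \<cdot>\<^sub>m (?t gi * ?t v)"
    using inverse_smult_mat[OF z_nonzero] by metis
  also have "z_fun \<cdot>\<^sub>m (?t s * ?t gi) = ?t s * dual_bundle gi"
    unfolding dual_bundle_def using g s by (intro mult_smult_distrib[symmetric, of _ n n _ n]) auto
  also have "z_fun \<cdot>\<^sub>m (?t gi * ?t v) = dual_bundle gi * ?t v"
    unfolding dual_bundle_def using g s by (intro mult_smult_assoc_mat[symmetric, of _ n n _ n]) auto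
  finally show ?thesis .
qed

lemma dual_simple:
  assumes gs: "simple_bundle n (int d) g" and d: "d \<le> n"
    and gi: "gi \<in> carrier_mat n n" "g * gi = 1\<^sub>m n" "gi * g = 1\<^sub>m n"
  shows "simple_bundle n (int (n - d)) (dual_bundle gi)"
proof -
  let ?h = "dual_bundle gi"
  have g: "g \<in> carrier_mat n n" "det g \<noteq> 0" "vb_degree g = int d"
    and En: "End_vb n g = {const_fun c \<cdot>\<^sub>m 1\<^sub>m n |c. True}"
    using gs by (auto simp: simple_bundle_def vector_bundle_def)
  have hc: "?h \<in> carrier_mat n n" using gi by (simp add: dual_bundle_def)
  have gg: "det g * det gi = 1" using det_mult[OF g(1) gi(1)] gi(2) by simp
  have dgi: "det gi \<noteq> 0" using gg by auto
  have dh: "det ?h = z_fun ^ n * det gi" using gi by (simp add: dual_bundle_def det_transpose[of _ n])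
  have dh0: "det ?h \<noteq> 0" using dgi z_nonzero by (simp add: dh)
  have "fls_subdegree (expand (det g)) + fls_subdegree (expand (det gi)) = 0"
    using subdegree_expand_mult[OF g(2) dgi] by (simp add: gg)
  hence "fls_subdegree (expand (det gi)) = int d" using vb_degree_eq[OF g(2)] g(3) by simp
  moreover have "fls_subdegree (expand (z_fun ^ n)) = - int n" using subdegree_z_powi[of "int n"] by simp
  ultimately have "fls_subdegree (expand (det ?h)) = - int n + int d"
    unfolding dh using subdegree_expand_mult[of "z_fun ^ n" "det gi"] z_nonzero dgi by simp
  hence deg: "vb_degree ?h = int (n - d)" using vb_degree_eq[OF dh0] d by simp
  have "End_vb n ?h = {const_fun c \<cdot>\<^sub>m 1\<^sub>m n |c. True}"
  proof (intro equalityI subsetI)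
    fix u assume "u \<in> End_vb n ?h"
    then obtain v where u: "u \<in> mat_over n regular_ring" "v \<in> mat_over n cusp_ring" "u * ?h = ?h * v"
      by (auto simp: End_vb_def)
    note uc = mat_over_carrier[OF u(1)] mat_over_carrier[OF u(2)]
    have "transpose_mat u * g = g * transpose_mat v"
      using dual_stalk[OF g(1) gi, of "transpose_mat u" "transpose_mat v"] u(3) uc by simp
    hence "transpose_mat u \<in> End_vb n g"
      using transpose_mat_over[OF u(1)] transpose_mat_over[OF u(2)] unfolding End_vb_def by blast
    then obtain c where "transpose_mat u = const_fun c \<cdot>\<^sub>m 1\<^sub>m n" using En by auto
    hence "transpose_mat (transpose_mat u) = transpose_mat (const_fun c \<cdot>\<^sub>m 1\<^sub>m n)" by (rule arg_cong)
    also have "transpose_mat (const_fun c \<cdot>\<^sub>m 1\<^sub>m n) = const_fun c \<cdot>\<^sub>m 1\<^sub>m n" by (auto intro!: eq_matI)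
    finally show "u \<in> {const_fun c \<cdot>\<^sub>m 1\<^sub>m n |c. True}" by auto
  next
    fix u assume "u \<in> {const_fun c \<cdot>\<^sub>m 1\<^sub>m n |c. True}"
    then obtain c where c: "u = const_fun c \<cdot>\<^sub>m 1\<^sub>m n" by blast
    have "u * ?h = ?h * u" unfolding c using hc
      by (simp add: mult_smult_distrib[of _ n n _ n] mult_smult_assoc_mat[of _ n n])
    moreover have "const_fun c \<in> cusp_ring" by (auto simp: cusp_ring_eq const_in_inf expand_const)
    hence "u \<in> mat_over n cusp_ring" unfolding c using subring_cusp by (auto simp: mat_over_def subring_set_def)
    moreover have "u \<in> mat_over n regular_ring" unfolding c using subring_regular const_in_regular
      by (auto simp: mat_over_def subring_set_def)
    ultimately show "u \<in> End_vb n ?h" unfolding End_vb_def by blast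
  qed
  thus ?thesis using hc dh0 deg by (simp add: simple_bundle_def vector_bundle_def)
qed

section \<open>Values and residues of sections\<close>

lemma rat_eval_Fract:
  assumes "poly q y \<noteq> 0" shows "rat_eval (Fraction_Field.Fract p q) y = poly p y / poly q y"
  unfolding rat_eval_def
proof (rule the_equality)
  show "\<exists>p' q'. Fraction_Field.Fract p q = Fraction_Field.Fract p' q' \<and> poly q' y \<noteq> 0 \<and> poly p y / poly q y = poly p' y / poly q' y"
    using assms by blast
  fix c assume "\<exists>p' q'. Fraction_Field.Fract p q = Fraction_Field.Fract p' q' \<and> poly q' y \<noteq> 0 \<and> c = poly p' y / poly q' y"
  then obtain p' q' where pq: "Fraction_Field.Fract p q = Fraction_Field.Fract p' q'" "poly q' y \<noteq> 0" "c = poly p' y / poly q' y" by blast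
  have "q \<noteq> 0" "q' \<noteq> 0" using assms pq by auto
  hence "p * q' = p' * q" using pq by (simp add: eq_fract)
  hence "poly (p * q') y = poly (p' * q) y" by simp
  thus "c = poly p y / poly q y" using pq(2,3) assms by (simp add: frac_eq_eq)
qed

lemma rat_eval_to_fract: "rat_eval (to_fract p) y = poly p y"
  by (simp add: to_fract_def rat_eval_Fract)

text \<open>
  The value at \<open>y\<close>; meaningful for matrices with polynomial entries.
\<close>

definition eval_mat :: "complex \<Rightarrow> ratfun mat \<Rightarrow> complex mat" where
  "eval_mat y M = map_mat (\<lambda>f. rat_eval f y) M"

lemma rat_eval_hom:
  assumes "f \<in> regular_ring" "g \<in> regular_ring"
  shows "rat_eval (f + g) y = rat_eval f y + rat_eval g y" "rat_eval (f * g) y = rat_eval f y * rat_eval g y"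
    "rat_eval (- f) y = - rat_eval f y" "rat_eval 0 y = 0" "rat_eval 1 y = 1" "rat_eval z_fun y = y" "rat_eval (const_fun c) y = c"
proof -
  obtain p q where pq: "f = to_fract p" "g = to_fract q" using assms by (auto simp: regular_ring_def)
  show "rat_eval (f + g) y = rat_eval f y + rat_eval g y" "rat_eval (f * g) y = rat_eval f y * rat_eval g y"
    "rat_eval (- f) y = - rat_eval f y"
    by (simp_all add: pq rat_eval_to_fract flip: to_fract_add to_fract_mult to_fract_uminus)
  show "rat_eval 0 y = 0" "rat_eval 1 y = 1" using rat_eval_to_fract[of 0 y] rat_eval_to_fract[of 1 y] by simp_all
  show "rat_eval z_fun y = y" "rat_eval (const_fun c) y = c" by (simp_all add: z_fun_def const_fun_def rat_eval_to_fract)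
qed

lemma rat_eval_sum:
  assumes "\<And>i. i \<in> I \<Longrightarrow> f i \<in> regular_ring"
  shows "rat_eval (sum f I) y = (\<Sum>i\<in>I. rat_eval (f i) y)"
  using assms
proof (induction I rule: infinite_finite_induct)
  case (insert x F)
  have "sum f F \<in> regular_ring" using insert.prems by (intro subring_sum[OF subring_regular]) auto
  thus ?case using insert by (simp add: rat_eval_hom)
qed (use rat_eval_hom(4) subring_regular in \<open>auto simp: subring_set_def\<close>)

lemma eval_mat_carrier: "M \<in> carrier_mat n n \<Longrightarrow> eval_mat y M \<in> carrier_mat n n"
  by (simp add: eval_mat_def)

lemma eval_mat_mult:
  assumes M: "M \<in> mat_over n regular_ring" "N \<in> mat_over n regular_ring"
  shows "eval_mat y (M * N) = eval_mat y M * eval_mat y N"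
proof (rule eq_matI)
  note c = M[THEN mat_over_carrier]
  fix i j assume "i < dim_row (eval_mat y M * eval_mat y N)" "j < dim_col (eval_mat y M * eval_mat y N)"
  hence ij: "i < n" "j < n" using c by (auto simp: eval_mat_def)
  have reg: "M $$ (i, l) \<in> regular_ring" "N $$ (l, j) \<in> regular_ring" if "l < n" for l
    using M that ij by (auto simp: mat_over_def)
  have "eval_mat y (M * N) $$ (i, j) = rat_eval ((M * N) $$ (i, j)) y"
    using c ij by (simp add: eval_mat_def)
  also have "\<dots> = (\<Sum>l<n. rat_eval (M $$ (i, l) * N $$ (l, j)) y)"
    unfolding mat_mult_entry[OF c ij] using reg subring_regular by (intro rat_eval_sum) (auto simp: subring_set_def)
  also have "\<dots> = (\<Sum>l<n. eval_mat y M $$ (i, l) * eval_mat y N $$ (l, j))"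
    using reg c ij by (intro sum.cong) (auto simp: rat_eval_hom eval_mat_def)
  also have "\<dots> = (eval_mat y M * eval_mat y N) $$ (i, j)"
    by (rule mat_mult_entry[symmetric, OF eval_mat_carrier[OF c(1)] eval_mat_carrier[OF c(2)] ij])
  finally show "eval_mat y (M * N) $$ (i, j) = (eval_mat y M * eval_mat y N) $$ (i, j)" .
qed (use M[THEN mat_over_carrier] in \<open>auto simp: eval_mat_def\<close>)

lemma eval_mat_one: "eval_mat y (1\<^sub>m n) = 1\<^sub>m n"
  using rat_eval_hom(4,5)[OF z_in_regular z_in_regular]
  by (auto simp: eval_mat_def intro!: eq_matI)

lemma mtrace_eval:
  assumes "M \<in> mat_over n regular_ring" shows "mtrace (eval_mat y M) = rat_eval (mtrace M) y"
proof -
  note c = mat_over_carrier[OF assms]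
  have "rat_eval (mtrace M) y = (\<Sum>i<n. rat_eval (M $$ (i, i)) y)"
    unfolding mtrace_entries[OF c] by (rule rat_eval_sum) (use mat_over_entry[OF assms] in auto)
  also have "\<dots> = mtrace (eval_mat y M)"
    unfolding mtrace_entries[OF eval_mat_carrier[OF c]] using c by (simp add: eval_mat_def)
  finally show ?thesis by simp
qed

lemma eval_holomorphic:
  assumes "f \<in> regular_ring" shows "(\<lambda>y. rat_eval f y) holomorphic_on S"
proof -
  obtain p where "f = to_fract p" using assms by (auto simp: regular_ring_def)
  thus ?thesis by (simp add: rat_eval_to_fract) (intro holomorphic_intros)
qed

text \<open>
  For a section \<open>s\<close> with a simple pole at \<open>x\<close> this is polynomial, its value at \<open>x\<close> is the residue, and its value at
  another point \<open>y\<close> is \<open>y - x\<close> times the value of \<open>s\<close>.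
\<close>

definition numer :: "complex \<Rightarrow> ratfun mat \<Rightarrow> ratfun mat" where
  "numer x s = (z_fun - const_fun x) \<cdot>\<^sub>m s"

lemma z_minus_const: "z_fun - const_fun x = to_fract [:- x, 1:]"
  by (simp add: z_fun_def const_fun_def flip: to_fract_diff)

lemma z_minus_const_nonzero: "z_fun - const_fun x \<noteq> 0"
  unfolding z_minus_const by (simp only: to_fract_eq_0_iff) simp

lemma simple_pole_eval:
  assumes "(z_fun - const_fun x) * f \<in> regular_ring"
  shows "y \<noteq> x \<Longrightarrow> rat_eval f y = rat_eval ((z_fun - const_fun x) * f) y / (y - x)"
    and "residue (rat_eval f) x = rat_eval ((z_fun - const_fun x) * f) x"
proof -
  obtain p where p: "(z_fun - const_fun x) * f = to_fract p" using assms by (auto simp: regular_ring_def)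
  have "f = to_fract p / (z_fun - const_fun x)"
    using z_minus_const_nonzero[of x] p by (simp add: field_simps)
  hence f: "f = Fraction_Field.Fract p [:- x, 1:]"
    by (simp add: z_minus_const to_fract_def)
  have ev: "rat_eval f y = poly p y / (y - x)" if "y \<noteq> x" for y
    using that rat_eval_Fract[of "[:- x, 1:]" y p] by (simp add: f)
  thus "y \<noteq> x \<Longrightarrow> rat_eval f y = rat_eval ((z_fun - const_fun x) * f) y / (y - x)"
    by (simp add: p rat_eval_to_fract)
  have "residue (rat_eval f) x = residue (\<lambda>w. poly p w / (w - x)) x"
    by (rule residue_cong) (auto simp: eventually_at_filter ev intro!: always_eventually)
  also have "\<dots> = poly p x"
    by (rule residue_simple[of UNIV]) (auto intro!: holomorphic_intros)
  finally show "residue (rat_eval f) x = rat_eval ((z_fun - const_fun x) * f) x"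
    by (simp add: p rat_eval_to_fract)
qed

lemma
  assumes s: "s \<in> carrier_mat n n" "numer x s \<in> mat_over n regular_ring"
  shows res_map_numer: "res_map x s = eval_mat x (numer x s)"
    and ev_map_numer: "y \<noteq> x \<Longrightarrow> ev_map y s = inverse (y - x) \<cdot>\<^sub>m eval_mat y (numer x s)"
proof -
  have reg: "(z_fun - const_fun x) * s $$ (i, j) \<in> regular_ring" if "i < n" "j < n" for i j
    using mat_over_entry[OF s(2) that] s(1) that by (simp add: numer_def)
  show "res_map x s = eval_mat x (numer x s)"
    using s(1) simple_pole_eval(2)[OF reg] by (intro eq_matI) (auto simp: res_map_def eval_mat_def numer_def)
  assume "y \<noteq> x"
  thus "ev_map y s = inverse (y - x) \<cdot>\<^sub>m eval_mat y (numer x s)"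
    using s(1) simple_pole_eval(1)[OF reg] by (intro eq_matI) (auto simp: ev_map_def eval_mat_def numer_def divide_inverse mult.commute)
qed

lemma H0_Ad_iff: "s \<in> H0_Ad n g x \<longleftrightarrow> s \<in> carrier_mat n n \<and> mtrace s = 0 \<and> numer x s \<in> mat_over n regular_ring \<and>
  (\<exists>v \<in> mat_over n cusp_ring. s * g = g * v)"
  by (simp add: H0_Ad_def numer_def)

lemma H0_Ad_sl:
  assumes "s \<in> H0_Ad n g x" shows "eval_mat y (numer x s) \<in> sl n"
proof -
  have s: "s \<in> carrier_mat n n" "mtrace s = 0" "numer x s \<in> mat_over n regular_ring"
    using assms by (auto simp: H0_Ad_iff)
  have "mtrace (numer x s) = 0" unfolding numer_def using s by (simp add: mtrace_smult[of _ n])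
  hence "mtrace (eval_mat y (numer x s)) = 0"
    using mtrace_eval[OF s(3)] rat_eval_hom(4)[OF z_in_regular z_in_regular] by simp
  thus ?thesis using s by (simp add: sl_def eval_mat_def numer_def)
qed

lemma sl_smult: "A \<in> sl n \<Longrightarrow> c \<cdot>\<^sub>m A \<in> sl n"
  by (auto simp: sl_def mtrace_smult[of _ n])

lemma sl_add: "A \<in> sl n \<Longrightarrow> B \<in> sl n \<Longrightarrow> A + B \<in> sl n"
  by (auto simp: sl_def mtrace_add[of _ n])

text \<open>
  One combined statement for sums and multiples, so that residues and values are seen to be linear at once.
\<close>

lemma H0_Ad_lincomb:
  assumes s: "s1 \<in> H0_Ad n g x" "s2 \<in> H0_Ad n g x" and g: "g \<in> carrier_mat n n"
  shows "s1 + const_fun c \<cdot>\<^sub>m s2 \<in> H0_Ad n g x"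
    and "eval_mat y (numer x (s1 + const_fun c \<cdot>\<^sub>m s2)) = eval_mat y (numer x s1) + c \<cdot>\<^sub>m eval_mat y (numer x s2)"
proof -
  have s1: "s1 \<in> carrier_mat n n" "mtrace s1 = 0" "numer x s1 \<in> mat_over n regular_ring"
    and s2: "s2 \<in> carrier_mat n n" "mtrace s2 = 0" "numer x s2 \<in> mat_over n regular_ring"
    using s by (auto simp: H0_Ad_iff)
  obtain v1 v2 where v: "v1 \<in> mat_over n cusp_ring" "s1 * g = g * v1" "v2 \<in> mat_over n cusp_ring" "s2 * g = g * v2"
    using s by (auto simp: H0_Ad_iff)
  note vc = mat_over_carrier[OF v(1)] mat_over_carrier[OF v(3)]
  have numer: "numer x (s1 + const_fun c \<cdot>\<^sub>m s2) = numer x s1 + const_fun c \<cdot>\<^sub>m numer x s2"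
    using s1 s2 by (intro eq_matI) (auto simp: numer_def algebra_simps)
  have "mtrace (s1 + const_fun c \<cdot>\<^sub>m s2) = 0" using s1 s2 by (simp add: mtrace_add[of _ n] mtrace_smult[of _ n])
  moreover have "numer x (s1 + const_fun c \<cdot>\<^sub>m s2) \<in> mat_over n regular_ring" unfolding numer
    using s1(3) s2(3) subring_regular const_in_regular by (auto simp: mat_over_def subring_set_def)
  moreover have "(s1 + const_fun c \<cdot>\<^sub>m s2) * g = g * (v1 + const_fun c \<cdot>\<^sub>m v2)"
    using s1 s2 g v vc by (simp add: add_mult_distrib_mat[of _ n n _ _ n] mult_add_distrib_mat[of _ n n _ n]
      mult_smult_distrib[of _ n n _ n] mult_smult_assoc_mat[of _ n n])
  moreover have "const_fun c \<in> cusp_ring" by (auto simp: cusp_ring_eq const_in_inf expand_const)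
  hence "v1 + const_fun c \<cdot>\<^sub>m v2 \<in> mat_over n cusp_ring"
    using v(1,3) subring_cusp by (auto simp: mat_over_def subring_set_def)
  ultimately show "s1 + const_fun c \<cdot>\<^sub>m s2 \<in> H0_Ad n g x" using s1 s2 unfolding H0_Ad_iff by auto
  show "eval_mat y (numer x (s1 + const_fun c \<cdot>\<^sub>m s2)) = eval_mat y (numer x s1) + c \<cdot>\<^sub>m eval_mat y (numer x s2)"
  proof (rule eq_matI)
    fix i j assume "i < dim_row (eval_mat y (numer x s1) + c \<cdot>\<^sub>m eval_mat y (numer x s2))"
      "j < dim_col (eval_mat y (numer x s1) + c \<cdot>\<^sub>m eval_mat y (numer x s2))"
    hence ij: "i < n" "j < n" using s2 by (auto simp: eval_mat_def numer_def)
    have r: "numer x s1 $$ (i, j) \<in> regular_ring" "numer x s2 $$ (i, j) \<in> regular_ring"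
      using mat_over_entry[OF s1(3) ij] mat_over_entry[OF s2(3) ij] by auto
    have r': "const_fun c * numer x s2 $$ (i, j) \<in> regular_ring"
      using r const_in_regular subring_regular by (auto simp: subring_set_def)
    have "eval_mat y (numer x (s1 + const_fun c \<cdot>\<^sub>m s2)) $$ (i, j) = rat_eval (numer x s1 $$ (i, j) + const_fun c * numer x s2 $$ (i, j)) y"
      unfolding numer using ij mat_over_carrier[OF s1(3)] mat_over_carrier[OF s2(3)] by (simp add: eval_mat_def)
    also have "\<dots> = rat_eval (numer x s1 $$ (i, j)) y + c * rat_eval (numer x s2 $$ (i, j)) y"
      using rat_eval_hom(1)[OF r(1) r'] rat_eval_hom(2)[OF const_in_regular r(2)] rat_eval_hom(7)[OF r] by simp
    also have "\<dots> = (eval_mat y (numer x s1) + c \<cdot>\<^sub>m eval_mat y (numer x s2)) $$ (i, j)"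
      using ij mat_over_carrier[OF s1(3)] mat_over_carrier[OF s2(3)] by (simp add: eval_mat_def)
    finally show "eval_mat y (numer x (s1 + const_fun c \<cdot>\<^sub>m s2)) $$ (i, j) = (eval_mat y (numer x s1) + c \<cdot>\<^sub>m eval_mat y (numer x s2)) $$ (i, j)" .
  qed (use s1 s2 in \<open>auto simp: eval_mat_def numer_def\<close>)
qed

text \<open>
  Without residue the section has no pole, so it is a global endomorphism, hence a scalar, and the trace
  shows that the scalar is \<open>0\<close>.
\<close>

lemma H0_Ad_res_zero:
  assumes s: "s \<in> H0_Ad n g x" and r: "eval_mat x (numer x s) = 0\<^sub>m n n" and n: "0 < n"
    and sc: "\<And>u. u \<in> End_vb n g \<Longrightarrow> \<exists>c. u = const_fun c \<cdot>\<^sub>m 1\<^sub>m n"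
  shows "s = 0\<^sub>m n n"
proof -
  have s': "s \<in> carrier_mat n n" "mtrace s = 0" "numer x s \<in> mat_over n regular_ring" "\<exists>v \<in> mat_over n cusp_ring. s * g = g * v"
    using s by (auto simp: H0_Ad_iff)
  have "s $$ (i, j) \<in> regular_ring" if ij: "i < n" "j < n" for i j
  proof -
    obtain p where p: "(z_fun - const_fun x) * s $$ (i, j) = to_fract p"
      using mat_over_entry[OF s'(3) ij] s'(1) ij by (auto simp: numer_def regular_ring_def)
    have "eval_mat x (numer x s) $$ (i, j) = 0" using r ij by simp
    hence "poly p x = 0" using s'(1) ij by (simp add: eval_mat_def numer_def p rat_eval_to_fract)
    then obtain q where "p = [:- x, 1:] * q" by (auto simp: poly_eq_0_iff_dvd)
    hence "(z_fun - const_fun x) * s $$ (i, j) = (z_fun - const_fun x) * to_fract q"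
      using p by (simp only: z_minus_const to_fract_mult)
    hence "s $$ (i, j) = to_fract q" using z_minus_const_nonzero[of x] by simp
    thus ?thesis by (simp add: regular_ring_def)
  qed
  hence "s \<in> End_vb n g" using s' by (auto simp: End_vb_def mat_over_def)
  from sc[OF this] obtain c where c: "s = const_fun c \<cdot>\<^sub>m 1\<^sub>m n" by (elim exE)
  have "const_fun c * of_nat n = 0" using s'(2) unfolding c by (simp add: mtrace_smult[of _ n] mtrace_one)
  moreover have "(of_nat n :: ratfun) = const_fun (of_nat n)" by (simp add: const_fun_hom.hom_of_nat)
  ultimately have "c = 0" using n by (simp flip: const_fun_hom.hom_mult)
  thus ?thesis unfolding c by (intro eq_matI) auto
qed

section \<open>The residue map is bijective\<close>

text \<open>
  Linear algebra on functions on a finite set \<open>I\<close>: the hypotheses say that \<open>T\<close> induces a linear endomorphism of the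
  space of these functions, and injectivity is turned into surjectivity by means of the matrix of \<open>T\<close> in an
  enumeration of \<open>I\<close>.
\<close>

lemma linear_injective_imp_surjective_on:
  fixes T :: "('i \<Rightarrow> complex) \<Rightarrow> 'i \<Rightarrow> complex"
  assumes I: "finite I"
    and add: "\<And>f g i. i \<in> I \<Longrightarrow> T (\<lambda>j. f j + g j) i = T f i + T g i"
    and scale: "\<And>c f i. i \<in> I \<Longrightarrow> T (\<lambda>j. c * f j) i = c * T f i"
    and cong: "\<And>f g i. i \<in> I \<Longrightarrow> (\<forall>j\<in>I. f j = g j) \<Longrightarrow> T f i = T g i"
    and inj: "\<And>f. \<forall>i\<in>I. T f i = 0 \<Longrightarrow> \<forall>i\<in>I. f i = 0"
  shows "\<exists>f. \<forall>i\<in>I. T f i = h i"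
proof -
  define \<delta> where "\<delta> = (\<lambda>j k :: 'i. if k = j then 1 else 0 :: complex)"
  have zero: "T (\<lambda>j. 0) i = 0" if "i \<in> I" for i using scale[OF that, of 0 "\<lambda>j. 0"] by simp
  have part: "T (\<lambda>k. if k \<in> J then f k else 0) i = (\<Sum>j\<in>J. f j * T (\<delta> j) i)" if i: "i \<in> I" and J: "finite J" "J \<subseteq> I" for f i J
    using J
  proof (induction J rule: finite_induct)
    case empty
    thus ?case using zero[OF i] by simp
  next
    case (insert x J)
    have eq: "(\<lambda>k. if k \<in> insert x J then f k else 0) = (\<lambda>k. f x * \<delta> x k + (if k \<in> J then f k else 0))"
      using insert.hyps by (auto simp: \<delta>_def fun_eq_iff)
    have "T (\<lambda>k. if k \<in> insert x J then f k else 0) i = T (\<lambda>k. f x * \<delta> x k) i + T (\<lambda>k. if k \<in> J then f k else 0) i"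
      unfolding eq by (rule add[OF i])
    also have "T (\<lambda>k. f x * \<delta> x k) i = f x * T (\<delta> x) i" by (rule scale[OF i])
    finally show ?case using insert by simp
  qed
  have T: "T f i = (\<Sum>j\<in>I. f j * T (\<delta> j) i)" if i: "i \<in> I" for f i
    using part[OF i I subset_refl, of f] cong[OF i, of f "\<lambda>k. if k \<in> I then f k else 0"] by simp
  define N where "N = card I"
  from ex_bij_betw_nat_finite[OF I] obtain b where b: "bij_betw b {..<N} I"
    unfolding N_def lessThan_atLeast0 by (elim exE)
  define b' where "b' = the_inv_into {..<N} b"
  have bI: "b k \<in> I" if "k < N" for k using b that by (auto simp: bij_betw_def)
  have b'b: "b' (b k) = k" if "k < N" for k
    unfolding b'_def using b that by (intro the_inv_into_f_f) (auto simp: bij_betw_def)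
  have bb': "\<exists>k<N. i = b k" if "i \<in> I" for i
  proof -
    have "i \<in> b ` {..<N}" using bij_betw_imp_surj_on[OF b] that by simp
    thus ?thesis by auto
  qed
  have Tb: "T f i = (\<Sum>k<N. f (b k) * T (\<delta> (b k)) i)" if i: "i \<in> I" for f i
    using T[OF i, of f] sum.reindex_bij_betw[OF b, of "\<lambda>j. f j * T (\<delta> j) i"] by (rule trans[OF _ sym])
  define M where "M = Matrix.mat N N (\<lambda>(k, l). T (\<delta> (b l)) (b k))"
  have Mc: "M \<in> carrier_mat N N" by (simp add: M_def)
  have "det M \<noteq> 0"
  proof
    assume "det M = 0"
    from iffD1[OF det_zero_iff_kernel[OF Mc] this]
    obtain v j0 where j0: "j0 < N" "v j0 \<noteq> 0" and v: "\<forall>i<N. (\<Sum>j<N. M $$ (i, j) * v j) = 0"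
      by (elim exE conjE)
    define f where "f = (\<lambda>i. v (b' i))"
    have "T f i = 0" if i: "i \<in> I" for i
    proof -
      obtain k where k: "k < N" "i = b k" using bb'[OF i] by blast
      have "T f i = (\<Sum>j<N. M $$ (k, j) * v j)"
        by (subst Tb[OF i], intro sum.cong) (use k in \<open>auto simp: f_def b'b M_def mult.commute\<close>)
      thus ?thesis using v k by simp
    qed
    hence "\<forall>i\<in>I. T f i = 0" by (rule ballI)
    from inj[OF this] have "f (b j0) = 0" using bI[OF j0(1)] by (rule bspec)
    thus False using b'b[OF j0(1)] j0(2) by (simp add: f_def)
  qed
  then obtain P where P: "P \<in> carrier_mat N N" "P * M = 1\<^sub>m N" "M * P = 1\<^sub>m N"
    by (rule det_nonzero_inverse[OF Mc])
  define v where "v = (\<lambda>k. \<Sum>l<N. P $$ (k, l) * h (b l))"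
  define f where "f = (\<lambda>i. v (b' i))"
  have "T f i = h i" if i: "i \<in> I" for i
  proof -
    obtain k where k: "k < N" "i = b k" using bb'[OF i] by blast
    have "T f i = (\<Sum>j<N. M $$ (k, j) * v j)"
      by (subst Tb[OF i], intro sum.cong) (use k in \<open>auto simp: f_def b'b M_def mult.commute\<close>)
    also have "\<dots> = (\<Sum>j<N. \<Sum>l<N. M $$ (k, j) * P $$ (j, l) * h (b l))"
      by (simp add: v_def sum_distrib_left mult.assoc)
    also have "\<dots> = (\<Sum>l<N. (\<Sum>j<N. M $$ (k, j) * P $$ (j, l)) * h (b l))"
      by (subst sum.swap) (simp add: sum_distrib_right)
    also have "\<dots> = (\<Sum>l<N. (if k = l then 1 else 0) * h (b l))"
    proof (rule sum.cong[OF refl])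
      fix l assume "l \<in> {..<N}"
      hence l: "l < N" by simp
      have "(\<Sum>j<N. M $$ (k, j) * P $$ (j, l)) = (M * P) $$ (k, l)"
        by (rule mat_mult_entry[symmetric, OF Mc P(1) k(1) l])
      also have "\<dots> = (if k = l then 1 else 0)" unfolding P(3) using k l by simp
      finally show "(\<Sum>j<N. M $$ (k, j) * P $$ (j, l)) * h (b l) = (if k = l then 1 else 0) * h (b l)" by simp
    qed
    also have "\<dots> = h i" using k by (simp add: if_distrib[of "\<lambda>x. x * _"] sum.delta cong: if_cong)
    finally show ?thesis .
  qed
  thus ?thesis by (intro exI[of _ f] ballI)
qed

text \<open>
  The sections of the endomorphisms of \<open>std_bundle\<close> with a simple pole at \<open>x\<close>, before the gluing condition is imposed, are
  parametrized by two matrices \<open>X\<close> and \<open>P\<close>. If \<open>F\<close> is the numerator of the section \<open>s\<close>, then the entries of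
  \<open>D\<^sup>-\<^sup>1 F D / z\<close> are polynomials in \<open>t\<close> of degree at most \<open>2\<close>: the constant coefficients form \<open>X\<close>, the linear ones
  \<open>sec_next\<close> and the quadratic ones \<open>sec_low\<close>. The upper right block has a constant coefficient only, and the lower left
  block has all three; so the upper right entries of \<open>P\<close> store the quadratic coefficients, in transposed
  position.
\<close>

definition sec_next :: "nat \<Rightarrow> complex mat \<Rightarrow> nat \<Rightarrow> nat \<Rightarrow> complex" where
  "sec_next e P i j = (if i < e \<and> e \<le> j then 0 else P $$ (i, j))"

definition sec_low :: "nat \<Rightarrow> complex mat \<Rightarrow> nat \<Rightarrow> nat \<Rightarrow> complex" where
  "sec_low e P i j = (if e \<le> i \<and> j < e then P $$ (j, i) else 0)"

definition sec_local :: "nat \<Rightarrow> complex mat \<Rightarrow> complex mat \<Rightarrow> nat \<Rightarrow> nat \<Rightarrow> ratfun" where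
  "sec_local e X P i j = const_fun (X $$ (i, j)) + inverse z_fun * const_fun (sec_next e P i j) +
     inverse z_fun ^ 2 * const_fun (sec_low e P i j)"

definition sec_numer :: "nat \<Rightarrow> complex mat \<Rightarrow> complex mat \<Rightarrow> nat \<Rightarrow> nat \<Rightarrow> ratfun" where
  "sec_numer e X P i j = z_fun powi (1 + std_exponents e i - std_exponents e j) * sec_local e X P i j"

text \<open>
  The value at \<open>x\<close> of the numerator, written out in the three cases for its degree in \<open>z\<close>.
\<close>

definition sec_val :: "nat \<Rightarrow> complex \<Rightarrow> complex mat \<Rightarrow> complex mat \<Rightarrow> nat \<Rightarrow> nat \<Rightarrow> complex" where
  "sec_val e x X P i j = (if i < e \<and> e \<le> j then X $$ (i, j)
     else if e \<le> i \<and> j < e then x^2 * X $$ (i, j) + x * P $$ (i, j) + P $$ (j, i)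
     else x * X $$ (i, j) + P $$ (i, j))"

lemma sec_local_coeffs:
  "sec_local e X P i j \<in> inf_ring" "tc (sec_local e X P i j) 0 = X $$ (i, j)" "tc (sec_local e X P i j) 1 = sec_next e P i j"
  "tc (sec_local e X P i j) 2 = sec_low e P i j"
proof -
  have "tc (sec_local e X P i j) k = (if k = 0 then X $$ (i, j) else if k = 1 then sec_next e P i j
    else if k = 2 then sec_low e P i j else 0)" for k
    by (auto simp: sec_local_def expand_hom.hom_add expand_hom.hom_mult expand_hom.hom_power expand_const expand_t
      fls_X_times_conv_shift fls_X_power_times_conv_shift)
  thus "sec_local e X P i j \<in> inf_ring" "tc (sec_local e X P i j) 0 = X $$ (i, j)" "tc (sec_local e X P i j) 1 = sec_next e P i j"
    "tc (sec_local e X P i j) 2 = sec_low e P i j" by (auto simp: inf_ring_def)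
qed

lemma sec_numer_eval:
  "sec_numer e X P i j \<in> regular_ring" "rat_eval (sec_numer e X P i j) y = sec_val e y X P i j"
proof -
  note R = subring_regular[unfolded subring_set_def] const_in_regular z_in_regular
  consider "i < e" "e \<le> j" | "e \<le> i" "j < e" | "\<not> (i < e \<and> e \<le> j)" "\<not> (e \<le> i \<and> j < e)" by linarith
  hence "\<exists>f. sec_numer e X P i j = f \<and> f \<in> regular_ring \<and> rat_eval f y = sec_val e y X P i j"
  proof cases
    case 1
    thus ?thesis using R by (intro exI[of _ "const_fun (X $$ (i, j))"])
      (auto simp: sec_numer_def sec_local_def sec_next_def sec_low_def sec_val_def std_exponents_def rat_eval_hom(7))
  next
    case 2
    let ?f = "(z_fun * z_fun) * const_fun (X $$ (i, j)) + z_fun * const_fun (P $$ (i, j)) + const_fun (P $$ (j, i))"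
    have "sec_numer e X P i j = ?f"
      using 2 z_nonzero by (simp add: sec_numer_def sec_local_def sec_next_def sec_low_def std_exponents_def power2_eq_square field_simps)
    moreover have "?f \<in> regular_ring" using R by blast
    moreover have "rat_eval ?f y = sec_val e y X P i j"
    proof -
      have r: "z_fun * z_fun \<in> regular_ring" "(z_fun * z_fun) * const_fun (X $$ (i, j)) \<in> regular_ring" "z_fun * const_fun (P $$ (i, j)) \<in> regular_ring"
        "(z_fun * z_fun) * const_fun (X $$ (i, j)) + z_fun * const_fun (P $$ (i, j)) \<in> regular_ring" using R by blast+
      show ?thesis using 2 by (simp add: rat_eval_hom(1,2,6,7)[OF r(4) const_in_regular] rat_eval_hom(1)[OF r(2,3)]
        rat_eval_hom(2)[OF r(1) const_in_regular] rat_eval_hom(2)[OF z_in_regular z_in_regular] rat_eval_hom(2)[OF z_in_regular const_in_regular]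
        rat_eval_hom(6,7)[OF r(1) r(1)] sec_val_def power2_eq_square)
    qed
    ultimately show ?thesis by blast
  next
    case 3
    let ?f = "z_fun * const_fun (X $$ (i, j)) + const_fun (P $$ (i, j))"
    have "std_exponents e i = std_exponents e j" using 3 by (auto simp: std_exponents_def)
    hence "sec_numer e X P i j = ?f"
      using 3 z_nonzero by (auto simp: sec_numer_def sec_local_def sec_next_def sec_low_def field_simps)
    moreover have "?f \<in> regular_ring" using R by blast
    moreover have "rat_eval ?f y = sec_val e y X P i j"
    proof -
      have r: "z_fun * const_fun (X $$ (i, j)) \<in> regular_ring" using R by blast
      show ?thesis using 3 by (auto simp: rat_eval_hom(1)[OF r const_in_regular]
        rat_eval_hom(2)[OF z_in_regular const_in_regular] rat_eval_hom(6,7)[OF r r] sec_val_def)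
    qed
    ultimately show ?thesis by blast
  qed
  thus "sec_numer e X P i j \<in> regular_ring" "rat_eval (sec_numer e X P i j) y = sec_val e y X P i j" by auto
qed

definition pole_section :: "nat \<Rightarrow> nat \<Rightarrow> complex \<Rightarrow> complex mat \<Rightarrow> complex mat \<Rightarrow> ratfun mat" where
  "pole_section n e x X P = inverse (z_fun - const_fun x) \<cdot>\<^sub>m Matrix.mat n n (\<lambda>(i, j). sec_numer e X P i j)"

lemma pole_section_numer:
  "numer x (pole_section n e x X P) = Matrix.mat n n (\<lambda>(i, j). sec_numer e X P i j)"
  unfolding numer_def pole_section_def using inverse_smult_mat[of "inverse (z_fun - const_fun x)"] z_minus_const_nonzero[of x]
  by simp

text \<open>
  Since \<open>z / (z - x) = 1 + x t + \<dots>\<close>, the section has the jet \<open>X + (x X + sec_next) t\<close> in the frame \<open>D\<close>, and the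
  hypothesis is its gluing condition.
\<close>

lemma pole_section_stalk:
  assumes B: "B \<in> carrier_mat n n" and X: "X \<in> carrier_mat n n"
    and eq: "\<And>i j. i < n \<Longrightarrow> j < n \<Longrightarrow> sec_next e P i j + x * X $$ (i, j) + (X * B - B * X) $$ (i, j) = 0"
  shows "\<exists>v \<in> mat_over n cusp_ring. pole_section n e x X P * std_bundle n e B = std_bundle n e B * v"
proof -
  \<comment> \<open>The function \<open>z / (z - x)\<close>.\<close>
  define q where "q = inverse (1 - inverse z_fun * const_fun x)"
  have t0: "1 - inverse z_fun * const_fun x \<in> inf_ring"
    using subring_diff[OF subring_inf] subring_inf t_in_inf const_in_inf unfolding subring_set_def by blast
  have t: "tc (1 - inverse z_fun * const_fun x) 0 = 1" "tc (1 - inverse z_fun * const_fun x) 1 = - x"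
    by (simp_all add: expand_hom.hom_minus expand_hom.hom_mult expand_const expand_t fls_X_times_conv_shift)
  have q: "q \<in> inf_ring" unfolding q_def using inf_ring_inverse[OF t0] t by simp
  have nz: "1 - inverse z_fun * const_fun x \<noteq> 0" using t(1) by auto
  have qq: "q * (1 - inverse z_fun * const_fun x) = 1" using nz by (simp add: q_def)
  have "tc q 0 * 1 = 1" using inf_ring_mult_coeffs(2)[OF q t0] unfolding qq t by simp
  hence q0: "tc q 0 = 1" by simp
  have "tc q 0 * (- x) + tc q 1 * 1 = 0" using inf_ring_mult_coeffs(3)[OF q t0] unfolding qq t by simp
  hence q1: "tc q 1 = x" using q0 by simp
  have zq: "inverse (z_fun - const_fun x) * z_fun = q"
    unfolding q_def using z_nonzero z_minus_const_nonzero[of x] nz by (simp add: field_simps)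
  define w where "w = Matrix.mat n n (\<lambda>(i, j). sec_local e X P i j * q)"
  define M1 where "M1 = Matrix.mat n n (\<lambda>(i, j). X $$ (i, j) * x + sec_next e P i j)"
  have J: "jet n w X M1"
  proof (rule jetI)
    fix i j assume ij: "i < n" "j < n"
    show "w $$ (i, j) \<in> inf_ring \<and> tc (w $$ (i, j)) 0 = X $$ (i, j) \<and> tc (w $$ (i, j)) 1 = M1 $$ (i, j)"
      using ij inf_ring_mult_coeffs[OF sec_local_coeffs(1)[of e X P i j] q] sec_local_coeffs(2,3)[of e X P i j] q0 q1
      by (simp add: w_def M1_def)
  qed (use X in \<open>auto simp: w_def M1_def\<close>)
  have "M1 + (X * B - B * X) = 0\<^sub>m n n"
  proof (rule eq_matI)
    fix i j assume "i < dim_row (0\<^sub>m n n :: complex mat)" "j < dim_col (0\<^sub>m n n :: complex mat)"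
    hence ij: "i < n" "j < n" by auto
    have "(M1 + (X * B - B * X)) $$ (i, j) = M1 $$ (i, j) + (X * B - B * X) $$ (i, j)"
      using ij B X by (intro index_add_mat) auto
    thus "(M1 + (X * B - B * X)) $$ (i, j) = 0\<^sub>m n n $$ (i, j)"
      using eq[OF ij] ij by (simp add: M1_def mult.commute add.commute)
  qed (use B X in \<open>auto simp: M1_def\<close>)
  from stalk_conj_zdiag[OF J B B this, of "std_exponents e"] obtain v where v: "jet n v X (0\<^sub>m n n)"
    "(zdiag n (std_exponents e) * w * zdiag n (\<lambda>i. - std_exponents e i)) * (zdiag n (std_exponents e) * glue n B) = (zdiag n (std_exponents e) * glue n B) * v" .
  have "pole_section n e x X P = zdiag n (std_exponents e) * w * zdiag n (\<lambda>i. - std_exponents e i)"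
  proof (rule eq_matI)
    fix i j assume "i < dim_row (zdiag n (std_exponents e) * w * zdiag n (\<lambda>i. - std_exponents e i))"
      "j < dim_col (zdiag n (std_exponents e) * w * zdiag n (\<lambda>i. - std_exponents e i))"
    hence ij: "i < n" "j < n" by auto
    have "z_fun powi (1 + std_exponents e i - std_exponents e j) = z_fun * z_fun powi (std_exponents e i - std_exponents e j)"
      using z_nonzero by (simp add: power_int_add add_diff_eq[symmetric] del: add_diff_eq)
    hence "pole_section n e x X P $$ (i, j) = (inverse (z_fun - const_fun x) * z_fun) *
        z_fun powi (std_exponents e i - std_exponents e j) * sec_local e X P i j"
      using ij by (simp add: pole_section_def sec_numer_def mult_ac)
    also have "\<dots> = z_fun powi (std_exponents e i - std_exponents e j) * w $$ (i, j)"
      unfolding zq using ij by (simp add: w_def mult_ac)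
    finally show "pole_section n e x X P $$ (i, j) = (zdiag n (std_exponents e) * w * zdiag n (\<lambda>i. - std_exponents e i)) $$ (i, j)"
      unfolding conj_zdiag_entry[OF jetD(4)[OF J] ij] .
  qed (auto simp: pole_section_def)
  moreover have "v \<in> mat_over n cusp_ring" using v(1) mat_over_cusp_iff_jet by blast
  ultimately show ?thesis using v(2) unfolding std_bundle_def by (intro bexI[of _ v]) simp
qed

lemma pole_section_H0:
  assumes B: "B \<in> carrier_mat n n" and X: "X \<in> carrier_mat n n"
    and eq: "\<And>i j. i < n \<Longrightarrow> j < n \<Longrightarrow> sec_next e P i j + x * X $$ (i, j) + (X * B - B * X) $$ (i, j) = 0"
    and tr: "(\<Sum>i<n. X $$ (i, i)) = 0" "(\<Sum>i<n. P $$ (i, i)) = 0"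
  shows "pole_section n e x X P \<in> H0_Ad n (std_bundle n e B) x"
    and "eval_mat y (numer x (pole_section n e x X P)) = Matrix.mat n n (\<lambda>(i, j). sec_val e y X P i j)"
proof -
  let ?s = "pole_section n e x X P"
  have sc: "?s \<in> carrier_mat n n" by (simp add: pole_section_def)
  have "sec_numer e X P i i = z_fun * const_fun (X $$ (i, i)) + const_fun (P $$ (i, i))" for i
    using z_nonzero by (cases "i < e") (simp_all add: sec_numer_def sec_local_def sec_next_def sec_low_def field_simps)
  hence "(\<Sum>i<n. sec_numer e X P i i) = z_fun * const_fun (\<Sum>i<n. X $$ (i, i)) + const_fun (\<Sum>i<n. P $$ (i, i))"
    by (simp add: sum.distrib sum_distrib_left const_fun_hom.hom_sum)
  hence "(\<Sum>i<n. sec_numer e X P i i) = 0" by (simp add: tr)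
  hence "mtrace ?s = 0"
    by (simp add: mtrace_entries[OF sc]) (simp add: pole_section_def flip: sum_distrib_left)
  thus "?s \<in> H0_Ad n (std_bundle n e B) x"
    unfolding H0_Ad_iff pole_section_numer
    using sc pole_section_stalk[OF B X eq] sec_numer_eval(1) by (auto simp: mat_over_def)
  show "eval_mat y (numer x ?s) = Matrix.mat n n (\<lambda>(i, j). sec_val e y X P i j)"
    unfolding pole_section_numer by (auto simp: eval_mat_def sec_numer_eval(2) intro!: eq_matI)
qed

text \<open>
  Dimension count. The pairs \<open>(X, P)\<close> and the pairs (gluing defect, residue) both form spaces of dimension \<open>2 n\<^sup>2\<close>.
  The map between them has a kernel, spanned by the scalars \<open>z - x\<close>; adding the trace of \<open>X\<close> as a scalar to
  the defect removes it. The modified map is injective because the bundle is simple, hence surjective. If its first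
  component vanishes and the second one is traceless, then taking traces shows that \<open>X\<close> is traceless, so that the
  modification vanishes too and the section lies in \<open>H\<^sup>0(Ad(x))\<close>.
\<close>

lemma std_bundle_residue_onto:
  assumes B: "B \<in> carrier_mat n n" and n: "0 < n" and c: "c \<in> sl n"
    and sc: "\<And>u. u \<in> End_vb n (std_bundle n e B) \<Longrightarrow> \<exists>c. u = const_fun c \<cdot>\<^sub>m 1\<^sub>m n"
  shows "\<exists>s \<in> H0_Ad n (std_bundle n e B) x. eval_mat x (numer x s) = c"
proof -
  define I where "I = (UNIV :: bool set) \<times> {..<n} \<times> {..<n}"
  define MX where "MX = (\<lambda>f :: bool \<times> nat \<times> nat \<Rightarrow> complex. Matrix.mat n n (\<lambda>(i, j). f (True, i, j)))"
  define MP where "MP = (\<lambda>f :: bool \<times> nat \<times> nat \<Rightarrow> complex. Matrix.mat n n (\<lambda>(i, j). f (False, i, j)))"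
  define nxt where "nxt = (\<lambda>(f :: bool \<times> nat \<times> nat \<Rightarrow> complex) i j. if i < e \<and> e \<le> j then 0 else f (False, i, j))"
  define val where "val = (\<lambda>(f :: bool \<times> nat \<times> nat \<Rightarrow> complex) i j. if i < e \<and> e \<le> j then f (True, i, j)
     else if e \<le> i \<and> j < e then x^2 * f (True, i, j) + x * f (False, i, j) + f (False, j, i)
     else x * f (True, i, j) + f (False, i, j))"
  define com where "com = (\<lambda>(f :: bool \<times> nat \<times> nat \<Rightarrow> complex) i j.
     (\<Sum>l<n. f (True, i, l) * B $$ (l, j)) - (\<Sum>l<n. B $$ (i, l) * f (True, l, j)))"
  define trc where "trc = (\<lambda>(f :: bool \<times> nat \<times> nat \<Rightarrow> complex) (i :: nat) j. if i = j then \<Sum>l<n. f (True, l, l) else 0 :: complex)"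
  define T where "T = (\<lambda>(f :: bool \<times> nat \<times> nat \<Rightarrow> complex) (b, i, j).
     if b then nxt f i j + x * f (True, i, j) + com f i j + trc f i j else val f i j)"
  have lin: "nxt (\<lambda>k. f k + g k) i j = nxt f i j + nxt g i j" "val (\<lambda>k. f k + g k) i j = val f i j + val g i j"
    "com (\<lambda>k. f k + g k) i j = com f i j + com g i j" "trc (\<lambda>k. f k + g k) i j = trc f i j + trc g i j" for f g i j
    by (simp_all add: nxt_def val_def com_def trc_def algebra_simps sum.distrib)
  have scl: "nxt (\<lambda>k. a * f k) i j = a * nxt f i j" "val (\<lambda>k. a * f k) i j = a * val f i j"
    "com (\<lambda>k. a * f k) i j = a * com f i j" "trc (\<lambda>k. a * f k) i j = a * trc f i j" for a f i j
    by (simp_all add: nxt_def val_def com_def trc_def algebra_simps sum_distrib_left)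
  have cng: "nxt f i j = nxt g i j" "val f i j = val g i j" "com f i j = com g i j" "trc f i j = trc g i j"
    if "\<forall>k\<in>I. f k = g k" "i < n" "j < n" for f g i j
  proof -
    have eq: "f (b, k, l) = g (b, k, l)" if "k < n" "l < n" for b k l using \<open>\<forall>k\<in>I. f k = g k\<close> that by (simp add: I_def)
    show "nxt f i j = nxt g i j" "val f i j = val g i j" using that(2,3) by (simp_all add: nxt_def val_def eq)
    show "com f i j = com g i j" "trc f i j = trc g i j" using that(2,3) by (simp_all add: com_def trc_def eq)
  qed
  have mats: "MX f \<in> carrier_mat n n" "MP f \<in> carrier_mat n n" for f by (simp_all add: MX_def MP_def)
  have rel: "nxt f i j = sec_next e (MP f) i j" "val f i j = sec_val e x (MX f) (MP f) i j"
    "com f i j = (MX f * B - B * MX f) $$ (i, j)" if "i < n" "j < n" for f i j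
  proof -
    show "nxt f i j = sec_next e (MP f) i j" "val f i j = sec_val e x (MX f) (MP f) i j"
      using that by (simp_all add: nxt_def val_def sec_next_def sec_val_def MX_def MP_def)
    have "(MX f * B - B * MX f) $$ (i, j) = (MX f * B) $$ (i, j) - (B * MX f) $$ (i, j)"
      using that B mats[of f] by (intro index_minus_mat) auto
    also have "\<dots> = com f i j"
      unfolding mat_mult_entry[OF mats(1) B that] mat_mult_entry[OF B mats(1) that] com_def using that by (simp add: MX_def)
    finally show "com f i j = (MX f * B - B * MX f) $$ (i, j)" by simp
  qed
  have key: "pole_section n e x (MX f) (MP f) \<in> H0_Ad n (std_bundle n e B) x"
      "eval_mat x (numer x (pole_section n e x (MX f) (MP f))) = Matrix.mat n n (\<lambda>(i, j). sec_val e x (MX f) (MP f) i j)"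
    if T0: "\<And>i j. i < n \<Longrightarrow> j < n \<Longrightarrow> T f (True, i, j) = 0" and V0: "(\<Sum>i<n. val f i i) = 0" for f
  proof -
    have ids: "(\<Sum>i<n. com f i i) = 0"
    proof -
      have "(\<Sum>i<n. com f i i) = (\<Sum>i<n. (MX f * B - B * MX f) $$ (i, i))" using rel(3) by simp
      also have "\<dots> = mtrace (MX f * B - B * MX f)" using B mats[of f] by (intro mtrace_entries[symmetric]) auto
      also have "\<dots> = 0" using mtrace_minus[of "MX f * B" n "B * MX f"] mtrace_comm[OF mats(1) B] B mats[of f] by auto
      finally show ?thesis .
    qed
    define tX where "tX = (\<Sum>i<n. f (True, i, i))"
    define tP where "tP = (\<Sum>i<n. f (False, i, i))"
    \<comment> \<open>On the diagonal the defect and the residue both involve \<open>x X + P\<close>, so their traces determine that of \<open>X\<close>.\<close>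
    have diag: "nxt f i i = f (False, i, i)" "val f i i = x * f (True, i, i) + f (False, i, i)" "trc f i i = tX" for i
      by (cases "i < e"; simp add: nxt_def val_def trc_def tX_def)+
    have Td: "T f (True, i, i) = f (False, i, i) + x * f (True, i, i) + com f i i + tX" for i
      by (simp add: T_def diag)
    have "(\<Sum>i<n. T f (True, i, i)) = 0" using T0 by simp
    moreover have "(\<Sum>i<n. T f (True, i, i)) = tP + x * tX + (\<Sum>i<n. com f i i) + of_nat n * tX"
      unfolding Td sum.distrib tP_def sum_distrib_left[symmetric] by (simp add: tX_def)
    moreover have xt: "x * tX + tP = 0" using V0 unfolding diag(2) sum.distrib sum_distrib_left[symmetric] tX_def tP_def .
    ultimately have "of_nat n * tX = 0" unfolding ids by (simp add: add.commute)
    hence tX0: "tX = 0" using n by simp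
    hence tP0: "tP = 0" using xt by simp
    have t: "trc f i j = 0" for i j using tX0 by (simp add: trc_def tX_def)
    have eq: "sec_next e (MP f) i j + x * MX f $$ (i, j) + (MX f * B - B * MX f) $$ (i, j) = 0" if "i < n" "j < n" for i j
      using T0[OF that] rel[OF that, of f] that t[of i j] by (simp add: T_def MX_def del: index_minus_mat index_mult_mat)
    have trs: "(\<Sum>i<n. MX f $$ (i, i)) = 0" "(\<Sum>i<n. MP f $$ (i, i)) = 0"
      using tX0 tP0 by (simp_all add: MX_def MP_def tX_def tP_def)
    show "pole_section n e x (MX f) (MP f) \<in> H0_Ad n (std_bundle n e B) x"
      "eval_mat x (numer x (pole_section n e x (MX f) (MP f))) = Matrix.mat n n (\<lambda>(i, j). sec_val e x (MX f) (MP f) i j)"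
      by (rule pole_section_H0[OF B mats(1) eq trs]; assumption)+
  qed
  have "\<exists>f. \<forall>k\<in>I. T f k = (case k of (b, i, j) \<Rightarrow> if b then 0 else c $$ (i, j))"
  proof (rule linear_injective_imp_surjective_on)
    show "finite I" by (simp add: I_def)
    show "T (\<lambda>j. f j + g j) i = T f i + T g i" for f g i
      by (cases i) (simp add: T_def lin algebra_simps)
    show "T (\<lambda>j. a * f j) i = a * T f i" for a f i
      by (cases i) (simp add: T_def scl algebra_simps)
    show "T f i = T g i" if iI: "i \<in> I" and fg: "\<forall>j\<in>I. f j = g j" for f g i
    proof -
      obtain b k l where i: "i = (b, k, l)" by (cases i)
      hence kl: "k < n" "l < n" using iI by (simp_all add: I_def)
      have "f (True, k, l) = g (True, k, l)" using fg kl by (simp add: I_def)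
      thus ?thesis using cng[OF fg kl] by (simp add: T_def i)
    qed
    show "\<forall>i\<in>I. f i = 0" if z: "\<forall>i\<in>I. T f i = 0" for f
    proof -
      have z1: "T f (True, i, j) = 0" "val f i j = 0" if "i < n" "j < n" for i j
      proof -
        have "(True, i, j) \<in> I" "(False, i, j) \<in> I" using that by (auto simp: I_def)
        hence "T f (True, i, j) = 0" "T f (False, i, j) = 0" using z by blast+
        thus "T f (True, i, j) = 0" "val f i j = 0" by (simp_all add: T_def)
      qed
      have V0: "(\<Sum>i<n. val f i i) = 0" using z1(2) by simp
      let ?s = "pole_section n e x (MX f) (MP f)"
      have k: "?s \<in> H0_Ad n (std_bundle n e B) x"
        "eval_mat x (numer x ?s) = Matrix.mat n n (\<lambda>(i, j). sec_val e x (MX f) (MP f) i j)"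
        by (rule key[OF z1(1) V0]; assumption)+
      have "eval_mat x (numer x ?s) = 0\<^sub>m n n"
        unfolding k(2) by (rule eq_matI) (simp_all add: rel(2)[symmetric] z1(2))
      from H0_Ad_res_zero[OF k(1) this n sc] have "?s = 0\<^sub>m n n" .
      hence "numer x ?s = 0\<^sub>m n n" by (auto simp: numer_def intro!: eq_matI)
      hence nm: "Matrix.mat n n (\<lambda>(i, j). sec_numer e (MX f) (MP f) i j) = 0\<^sub>m n n" unfolding pole_section_numer .
      have sn: "sec_numer e (MX f) (MP f) i j = 0" if "i < n" "j < n" for i j
      proof -
        have "Matrix.mat n n (\<lambda>(i, j). sec_numer e (MX f) (MP f) i j) $$ (i, j) = 0\<^sub>m n n $$ (i, j)" by (simp only: nm)
        thus ?thesis using that by simp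
      qed
      have sh: "sec_local e (MX f) (MP f) i j = 0" if "i < n" "j < n" for i j
        using sn[OF that] z_nonzero by (simp add: sec_numer_def)
      have XP: "MX f $$ (i, j) = 0" "sec_next e (MP f) i j = 0" "sec_low e (MP f) i j = 0" if "i < n" "j < n" for i j
        using sec_local_coeffs(2-4)[of e "MX f" "MP f" i j] unfolding sh[OF that] by simp_all
      have "f (False, i, j) = 0" if ij: "i < n" "j < n" for i j
      proof (cases "i < e \<and> e \<le> j")
        case True
        thus ?thesis using XP(3)[OF ij(2,1)] ij by (simp add: sec_low_def MP_def)
      next
        case False
        thus ?thesis using XP(2)[OF ij] ij by (simp add: sec_next_def MP_def split: if_splits)
      qed
      moreover have "f (True, i, j) = 0" if "i < n" "j < n" for i j using XP(1)[OF that] that by (simp add: MX_def)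
      ultimately have "f (b, i, j) = 0" if "i < n" "j < n" for b i j using that by (cases b) auto
      thus ?thesis by (auto simp: I_def)
    qed
  qed
  then obtain f where f: "\<forall>k\<in>I. T f k = (case k of (b, i, j) \<Rightarrow> if b then 0 else c $$ (i, j))" by (elim exE)
  have f1: "T f (True, i, j) = 0" "val f i j = c $$ (i, j)" if "i < n" "j < n" for i j
  proof -
    have "(True, i, j) \<in> I" "(False, i, j) \<in> I" using that by (auto simp: I_def)
    from f[rule_format, OF this(1)] f[rule_format, OF this(2)]
    show "T f (True, i, j) = 0" "val f i j = c $$ (i, j)" by (simp_all add: T_def)
  qed
  have cc: "c \<in> carrier_mat n n" "mtrace c = 0" using c by (auto simp: sl_def)
  have V0: "(\<Sum>i<n. val f i i) = 0" using cc f1(2) by (simp add: mtrace_entries[of _ n])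
  have k: "pole_section n e x (MX f) (MP f) \<in> H0_Ad n (std_bundle n e B) x"
    "eval_mat x (numer x (pole_section n e x (MX f) (MP f))) = Matrix.mat n n (\<lambda>(i, j). sec_val e x (MX f) (MP f) i j)"
    by (rule key[OF f1(1) V0]; assumption)+
  have "eval_mat x (numer x (pole_section n e x (MX f) (MP f))) = c"
    unfolding k(2) by (rule eq_matI) (use cc in \<open>simp_all add: rel(2)[symmetric] f1(2)\<close>)
  thus ?thesis using k(1) by blast
qed

lemma eval_mat_inverse:
  assumes "A \<in> GL n regular_ring" "B \<in> GL n regular_ring" "A * B = 1\<^sub>m n"
  shows "eval_mat y A * eval_mat y B = 1\<^sub>m n"
  using eval_mat_mult[OF GL_D(1)[OF assms(1)] GL_D(1)[OF assms(2)], of y] by (simp add: assms(3) eval_mat_one)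

lemma H0_Ad_conj:
  assumes A: "A \<in> GL n regular_ring" "B \<in> GL n regular_ring" "A * B = 1\<^sub>m n" "B * A = 1\<^sub>m n"
    and C: "C \<in> GL n cusp_ring" "\<mu> \<noteq> 0" and eq: "A * g = \<mu> \<cdot>\<^sub>m (g' * C)"
    and g: "g \<in> carrier_mat n n" "g' \<in> carrier_mat n n" and s: "s \<in> H0_Ad n g x"
  shows "A * s * B \<in> H0_Ad n g' x"
    and "eval_mat y (numer x (A * s * B)) = eval_mat y A * eval_mat y (numer x s) * eval_mat y B"
proof -
  have s': "s \<in> carrier_mat n n" "mtrace s = 0" "numer x s \<in> mat_over n regular_ring"
    using s by (auto simp: H0_Ad_iff)
  obtain v where v: "v \<in> mat_over n cusp_ring" "s * g = g * v" using s by (auto simp: H0_Ad_iff)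
  note c = GL_D(2)[OF A(1)] GL_D(2)[OF A(2)]
  have numer: "numer x (A * s * B) = A * numer x s * B"
    unfolding numer_def using c s' by (simp add: mult_smult_distrib[of _ n n _ n] mult_smult_assoc_mat[of _ n n])
  have reg: "A * numer x s \<in> mat_over n regular_ring" using mat_over_mult[OF subring_regular GL_D(1)[OF A(1)] s'(3)] .
  have "mtrace (A * s * B) = 0" using mtrace_conj[OF c(1) s'(1) c(2) A(4)] s' by simp
  moreover have "A * numer x s * B \<in> mat_over n regular_ring" using mat_over_mult[OF subring_regular reg GL_D(1)[OF A(2)]] .
  moreover have "A * s * B \<in> carrier_mat n n" using c s' by auto
  ultimately show "A * s * B \<in> H0_Ad n g' x" unfolding H0_Ad_iff numer
    using conj_stalk[OF c A(4,3) C g eq s'(1) v] by blast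
  show "eval_mat y (numer x (A * s * B)) = eval_mat y A * eval_mat y (numer x s) * eval_mat y B"
    unfolding numer eval_mat_mult[OF reg GL_D(1)[OF A(2)]] eval_mat_mult[OF GL_D(1)[OF A(1)] s'(3)] ..
qed

text \<open>
  Injectivity holds for every simple bundle; surjectivity is carried over from the normal form by conjugation.
\<close>

lemma simple_residue_bij:
  assumes gs: "simple_bundle n (int d) g" and d: "0 < d" "d < n"
  shows "bij_betw (res_map x) (H0_Ad n g x) (sl n)"
proof -
  have gc: "g \<in> carrier_mat n n" and En: "End_vb n g = {const_fun c \<cdot>\<^sub>m 1\<^sub>m n |c. True}"
    using gs by (auto simp: simple_bundle_def vector_bundle_def)
  have n: "0 < n" using d by simp
  have res: "res_map x s = eval_mat x (numer x s)" if "s \<in> H0_Ad n g x" for s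
    using that res_map_numer[of s n x] by (auto simp: H0_Ad_iff)
  have "inj_on (res_map x) (H0_Ad n g x)"
  proof (rule inj_onI)
    fix s1 s2 assume s: "s1 \<in> H0_Ad n g x" "s2 \<in> H0_Ad n g x" and eq: "res_map x s1 = res_map x s2"
    have c: "s1 \<in> carrier_mat n n" "s2 \<in> carrier_mat n n" using s by (auto simp: H0_Ad_iff)
    note l = H0_Ad_lincomb[OF s gc, where c = "-1"]
    have "eval_mat x (numer x (s1 + const_fun (-1) \<cdot>\<^sub>m s2)) = 0\<^sub>m n n"
      unfolding l(2) using eq c unfolding res[OF s(1)] res[OF s(2)]
      by (simp add: numer_def eval_mat_def) (intro eq_matI, auto)
    from H0_Ad_res_zero[OF l(1) this n] have z: "s1 + const_fun (-1) \<cdot>\<^sub>m s2 = 0\<^sub>m n n" using En by auto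
    show "s1 = s2"
    proof (rule eq_matI)
      fix i j assume "i < dim_row s2" "j < dim_col s2"
      hence ij: "i < n" "j < n" using c by auto
      have "(s1 + const_fun (-1) \<cdot>\<^sub>m s2) $$ (i, j) = 0" using z ij by simp
      thus "s1 $$ (i, j) = s2 $$ (i, j)" using ij c by (simp add: const_fun_hom.hom_uminus)
    qed (use c in auto)
  qed
  moreover have "res_map x ` H0_Ad n g x = sl n"
  proof (intro equalityI subsetI)
    fix c assume "c \<in> res_map x ` H0_Ad n g x"
    thus "c \<in> sl n" using res H0_Ad_sl by auto
  next
    fix c assume c: "c \<in> sl n"
    obtain B where B: "brick n (n - d) B" "twist_equivalent n g (std_bundle n (n - d) B)"
      by (rule simple_normal_form[OF gs d])
    have Bc: "B \<in> carrier_mat n n" using B(1) by (simp add: brick_def)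
    note g0c = std_bundle_carrier[OF Bc, of "n - d"]
    have sc: "\<exists>c. u = const_fun c \<cdot>\<^sub>m 1\<^sub>m n" if "u \<in> End_vb n (std_bundle n (n - d) B)" for u
      using End_vb_transfer[OF B(2) gc g0c En that] .
    obtain A C \<mu> where A: "A \<in> GL n regular_ring" "C \<in> GL n cusp_ring" "\<mu> \<noteq> 0"
      "A * std_bundle n (n - d) B = \<mu> \<cdot>\<^sub>m (g * C)"
      using twist_equivalent_sym[OF B(2) gc g0c] unfolding twist_equivalent_def by (elim bexE exE conjE)
    obtain A' where A': "A' \<in> GL n regular_ring" "A * A' = 1\<^sub>m n" "A' * A = 1\<^sub>m n" using A(1) by (rule GL_inverse)
    define P where "P = eval_mat x A"
    define P' where "P' = eval_mat x A'"
    have P: "P \<in> carrier_mat n n" "P' \<in> carrier_mat n n" "P * P' = 1\<^sub>m n" "P' * P = 1\<^sub>m n"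
      using eval_mat_inverse[OF A(1) A'(1,2)] eval_mat_inverse[OF A'(1) A(1) A'(3)] GL_D(2)[OF A(1)] GL_D(2)[OF A'(1)]
      by (simp_all add: P_def P'_def eval_mat_carrier)
    have cc: "c \<in> carrier_mat n n" "mtrace c = 0" using c by (auto simp: sl_def)
    have "P' * c * P \<in> sl n" using mtrace_conj[OF P(2) cc(1) P(1,3)] P cc by (simp add: sl_def)
    from std_bundle_residue_onto[OF Bc n this sc] obtain s where
      s: "s \<in> H0_Ad n (std_bundle n (n - d) B) x" "eval_mat x (numer x s) = P' * c * P" by blast
    note h = H0_Ad_conj[OF A(1) A'(1-3) A(2,3,4) g0c gc s(1)]
    have "res_map x (A * s * A') = P * (P' * c * P) * P'"
      unfolding res[OF h(1)] h(2) s(2) P_def P'_def ..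
    also have "\<dots> = (P * P') * c * (P * P')" using P(1,2) cc by (simp add: assoc_mult_mat[of _ n n _ n _ n])
    also have "\<dots> = c" using P cc by simp
    finally have "res_map x (A * s * A') = c" .
    thus "c \<in> res_map x ` H0_Ad n g x" using imageI[OF h(1), of "res_map x"] by simp
  qed
  ultimately show ?thesis by (simp add: bij_betw_def)
qed

section \<open>Tensors and endomorphisms\<close>

definition trace_form :: "nat \<Rightarrow> complex mat \<Rightarrow> complex mat \<Rightarrow> complex" where
  "trace_form n a c = (\<Sum>i<n. \<Sum>j<n. a $$ (i, j) * c $$ (j, i))"

lemma trace_form_mult:
  assumes "a \<in> carrier_mat n n" "c \<in> carrier_mat n n" shows "trace_form n a c = mtrace (a * c)"
proof -
  have "mtrace (a * c) = (\<Sum>i<n. (a * c) $$ (i, i))" using assms by (intro mtrace_entries) auto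
  also have "\<dots> = trace_form n a c"
    unfolding trace_form_def by (intro sum.cong refl mat_mult_entry[OF assms]) auto
  finally show ?thesis by simp
qed

lemma tensor_endo_sum:
  assumes "k < n" "l < n"
  shows "tensor_endo n (tensor_sum n m a b) c $$ (k, l) = (\<Sum>\<mu><m. trace_form n (a \<mu>) c * b \<mu> $$ (k, l))"
proof -
  have "tensor_endo n (tensor_sum n m a b) c $$ (k, l) = (\<Sum>i<n. \<Sum>j<n. \<Sum>\<mu><m. a \<mu> $$ (i, j) * c $$ (j, i) * b \<mu> $$ (k, l))"
    using assms by (simp add: tensor_endo_def tensor_sum_def sum_distrib_right sum_distrib_left mult_ac)
  also have "\<dots> = (\<Sum>i<n. \<Sum>\<mu><m. \<Sum>j<n. a \<mu> $$ (i, j) * c $$ (j, i) * b \<mu> $$ (k, l))"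
    by (intro sum.cong refl sum.swap)
  also have "\<dots> = (\<Sum>\<mu><m. \<Sum>i<n. \<Sum>j<n. a \<mu> $$ (i, j) * c $$ (j, i) * b \<mu> $$ (k, l))"
    by (rule sum.swap)
  also have "\<dots> = (\<Sum>\<mu><m. trace_form n (a \<mu>) c * b \<mu> $$ (k, l))"
    by (simp add: trace_form_def sum_distrib_right)
  finally show ?thesis .
qed

lemma tensor_endo_carrier[simp]: "tensor_endo n R c \<in> carrier_mat n n"
  "dim_row (tensor_endo n R c) = n" "dim_col (tensor_endo n R c) = n"
  by (simp_all add: tensor_endo_def)

text \<open>
  The image of a matrix unit under the projection along the scalar matrices.
\<close>

definition sl_unit :: "nat \<Rightarrow> nat \<Rightarrow> nat \<Rightarrow> complex mat" where
  "sl_unit n p q = Matrix.mat n n (\<lambda>(i, j). (if i = p \<and> j = q then 1 else 0) -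
     (if p = q \<and> i = j then 1 / of_nat n else 0))"

lemma sl_unit_sl: "0 < n \<Longrightarrow> p < n \<Longrightarrow> q < n \<Longrightarrow> sl_unit n p q \<in> sl n"
proof -
  assume n: "0 < n" "p < n" "q < n"
  have "mtrace (sl_unit n p q) = (\<Sum>i<n. (if i = p \<and> i = q then 1 else 0) - (if p = q then 1 / of_nat n else 0))"
    by (simp add: sl_unit_def mtrace_def)
  also have "\<dots> = (if p = q then 1 else 0) - (if p = q then 1 else 0)"
    using n by (cases "p = q") (auto simp: sum_subtractf intro!: sum.neutral)
  finally show ?thesis by (simp add: sl_def sl_unit_def)
qed

text \<open>
  The projected matrix units are dual to the matrix entries for the trace form on \<open>sl\<^sub>n\<close>; this gives both uniqueness and
  existence of tensors with a prescribed endomorphism.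
\<close>

lemma trace_form_sl_unit:
  assumes "a \<in> sl n" "p < n" "q < n" shows "trace_form n a (sl_unit n p q) = a $$ (q, p)"
proof -
  have a: "a \<in> carrier_mat n n" "mtrace a = 0" using assms by (auto simp: sl_def)
  have "trace_form n a (sl_unit n p q) =
      (\<Sum>i<n. \<Sum>j<n. (if j = p then if i = q then a $$ (i, j) else 0 else 0) - (if j = i then if p = q then a $$ (i, i) / of_nat n else 0 else 0))"
    unfolding trace_form_def using assms by (intro sum.cong refl) (auto simp: sl_unit_def algebra_simps)
  also have "\<dots> = a $$ (q, p) - (\<Sum>i<n. if p = q then a $$ (i, i) / of_nat n else 0)"
    using assms by (simp add: sum_subtractf sum.delta)
  also have "(\<Sum>i<n. if p = q then a $$ (i, i) / of_nat n else 0) = 0"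
    using a by (cases "p = q") (simp_all add: mtrace_entries[of _ n] flip: sum_divide_distrib)
  finally show ?thesis by simp
qed

lemma trace_form_comm: "trace_form n a c = trace_form n c a"
  unfolding trace_form_def by (subst sum.swap) (simp add: mult.commute)

text \<open>
  The coordinates of a tensor in \<open>sl\<^sub>n \<otimes> sl\<^sub>n\<close> are the entries of the images of the projected matrix units.
\<close>

lemma tensor_unique:
  assumes R: "R \<in> sl_tensor_sl n" "S \<in> sl_tensor_sl n" and n: "0 < n"
    and eq: "\<And>c. c \<in> sl n \<Longrightarrow> tensor_endo n R c = tensor_endo n S c"
  shows "R = S"
proof -
  have entry: "Q i j k l = (if i < n \<and> j < n \<and> k < n \<and> l < n then tensor_endo n Q (sl_unit n j i) $$ (k, l) else 0)"
    if Q: "Q \<in> sl_tensor_sl n" for Q i j k l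
  proof -
    obtain m a b where ab: "Q = tensor_sum n m a b" "\<forall>\<mu><m. a \<mu> \<in> sl n \<and> b \<mu> \<in> sl n"
      using Q by (auto simp: sl_tensor_sl_def)
    show ?thesis
    proof (cases "i < n \<and> j < n \<and> k < n \<and> l < n")
      case True
      hence "tensor_endo n Q (sl_unit n j i) $$ (k, l) = (\<Sum>\<mu><m. a \<mu> $$ (i, j) * b \<mu> $$ (k, l))"
        unfolding ab(1) by (subst tensor_endo_sum) (use ab(2) in \<open>auto simp: trace_form_sl_unit\<close>)
      thus ?thesis using True by (simp add: ab(1) tensor_sum_def)
    qed (auto simp: ab(1) tensor_sum_def)
  qed
  show ?thesis
  proof (intro ext)
    fix i j k l
    show "R i j k l = S i j k l"
      unfolding entry[OF R(1), of i j k l] entry[OF R(2), of i j k l] using eq sl_unit_sl[OF n] by auto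
  qed
qed

text \<open>
  The canonical tensor: the sum of dual basis elements tensored with the images under \<open>L\<close>.
\<close>

lemma tensor_exists:
  assumes n: "0 < n" and L: "\<And>c. c \<in> sl n \<Longrightarrow> L c \<in> sl n"
    and lin: "\<And>a b c. a \<in> sl n \<Longrightarrow> b \<in> sl n \<Longrightarrow> L (a + c \<cdot>\<^sub>m b) = L a + c \<cdot>\<^sub>m L b"
  shows "\<exists>R \<in> sl_tensor_sl n. \<forall>c \<in> sl n. tensor_endo n R c = L c"
proof -
  define N where "N = card ({..<n} \<times> {..<n})"
  have "finite ({..<n} \<times> {..<n})" by simp
  from ex_bij_betw_nat_finite[OF this] obtain h where h: "bij_betw h {..<N} ({..<n} \<times> {..<n})"
    unfolding N_def lessThan_atLeast0 by (elim exE)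
  define a where "a = (\<lambda>\<mu>. sl_unit n (snd (h \<mu>)) (fst (h \<mu>)))"
  define u where "u = (\<lambda>\<mu>. sl_unit n (fst (h \<mu>)) (snd (h \<mu>)))"
  define b where "b = (\<lambda>\<mu>. L (u \<mu>))"
  have mu: "fst (h \<mu>) < n" "snd (h \<mu>) < n" if "\<mu> < N" for \<mu>
    using bij_betwE[OF h] that by (auto simp: mem_Times_iff)
  have ab: "\<forall>\<mu><N. a \<mu> \<in> sl n \<and> b \<mu> \<in> sl n" and u: "\<And>\<mu>. \<mu> < N \<Longrightarrow> u \<mu> \<in> sl n"
    using mu sl_unit_sl[OF n] L by (auto simp: a_def b_def u_def)
  have z: "0\<^sub>m n n \<in> sl n" by (auto simp: sl_def mtrace_def)
  have L0: "L (0\<^sub>m n n) = 0\<^sub>m n n"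
  proof -
    have c: "L (0\<^sub>m n n) \<in> carrier_mat n n" using L[OF z] by (simp add: sl_def)
    have "0\<^sub>m n n + (-1) \<cdot>\<^sub>m 0\<^sub>m n n = (0\<^sub>m n n :: complex mat)" by (intro eq_matI) auto
    hence "L (0\<^sub>m n n) = L (0\<^sub>m n n) + (-1) \<cdot>\<^sub>m L (0\<^sub>m n n)" using lin[OF z z, of "-1"] by simp
    also have "\<dots> = 0\<^sub>m n n" using c by (intro eq_matI) auto
    finally show ?thesis .
  qed
  define G where "G = (\<lambda>(t :: nat \<Rightarrow> complex) (u :: nat \<Rightarrow> complex mat) m. Matrix.mat n n (\<lambda>(k, l). \<Sum>\<mu><m. t \<mu> * u \<mu> $$ (k, l)))"
  have comb: "G t u m \<in> sl n \<and> L (G t u m) = G t (\<lambda>\<mu>. L (u \<mu>)) m"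
    if "\<And>\<mu>. \<mu> < m \<Longrightarrow> u \<mu> \<in> sl n" for t u m
    using that
  proof (induction m)
    case 0
    have "G t u 0 = 0\<^sub>m n n" for u by (auto simp: G_def intro!: eq_matI)
    thus ?case using z L0 by simp
  next
    case (Suc m)
    have um: "u m \<in> sl n" and IH: "G t u m \<in> sl n" "L (G t u m) = G t (\<lambda>\<mu>. L (u \<mu>)) m" using Suc by auto
    have S: "G t w (Suc m) = G t w m + t m \<cdot>\<^sub>m w m" if "w m \<in> carrier_mat n n" for w
      using that by (auto simp: G_def intro!: eq_matI)
    have e1: "G t u (Suc m) = G t u m + t m \<cdot>\<^sub>m u m" using um by (intro S) (simp add: sl_def)
    have "L (u m) \<in> carrier_mat n n" using L[OF um] by (simp add: sl_def)
    hence e2: "G t (\<lambda>\<mu>. L (u \<mu>)) (Suc m) = G t (\<lambda>\<mu>. L (u \<mu>)) m + t m \<cdot>\<^sub>m L (u m)" by (intro S)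
    show ?case unfolding e1 e2 using lin[OF IH(1) um] IH sl_add[OF IH(1) sl_smult[OF um]] by simp
  qed
  have "tensor_endo n (tensor_sum n N a b) c = L c" if c: "c \<in> sl n" for c
  proof -
    have cc: "c \<in> carrier_mat n n" "mtrace c = 0" using c by (auto simp: sl_def)
    define t where "t = (\<lambda>\<mu>. c $$ (fst (h \<mu>), snd (h \<mu>)))"
    have tr: "trace_form n (a \<mu>) c = t \<mu>" if "\<mu> < N" for \<mu>
      unfolding a_def t_def using trace_form_sl_unit[OF c] mu[OF that] by (subst trace_form_comm) simp
    have "tensor_endo n (tensor_sum n N a b) c = G t (\<lambda>\<mu>. L (u \<mu>)) N"
      by (rule eq_matI) (auto simp: tensor_endo_sum tr G_def b_def)
    also have "\<dots> = L (G t u N)"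
      using comb[of N u t] u by simp
    also have "G t u N = c"
    proof (rule eq_matI)
      fix k l assume "k < dim_row c" "l < dim_col c"
      hence kl: "k < n" "l < n" using cc by auto
      have "G t u N $$ (k, l) = (\<Sum>\<mu><N. (\<lambda>(p, q). c $$ (p, q) * sl_unit n p q $$ (k, l)) (h \<mu>))"
        using kl by (simp add: G_def t_def u_def case_prod_unfold)
      also have "\<dots> = (\<Sum>(p, q)\<in>{..<n} \<times> {..<n}. c $$ (p, q) * sl_unit n p q $$ (k, l))"
        by (rule sum.reindex_bij_betw[OF h])
      also have "\<dots> = (\<Sum>p<n. \<Sum>q<n. c $$ (p, q) * sl_unit n p q $$ (k, l))"
        by (rule sum.cartesian_product[symmetric])
      also have "\<dots> = trace_form n c (sl_unit n l k)"
        unfolding trace_form_def using kl by (intro sum.cong refl arg_cong2[where f = times]) (auto simp: sl_unit_def)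
      also have "\<dots> = c $$ (k, l)" by (rule trace_form_sl_unit[OF c kl(2,1)])
      finally show "G t u N $$ (k, l) = c $$ (k, l)" .
    qed (use cc in \<open>auto simp: G_def\<close>)
    finally show ?thesis .
  qed
  thus ?thesis using ab by (intro bexI[of _ "tensor_sum n N a b"]) (auto simp: sl_tensor_sl_def)
qed

lemma transpose_smult_mat: "transpose_mat (c \<cdot>\<^sub>m A) = c \<cdot>\<^sub>m transpose_mat A"
  by (rule eq_matI) auto

section \<open>The solution attached to a simple bundle\<close>

lemma ev_map_sl:
  assumes "s \<in> H0_Ad n g x" "y \<noteq> x"
  shows "ev_map y s = inverse (y - x) \<cdot>\<^sub>m eval_mat y (numer x s)" "ev_map y s \<in> sl n"
proof -
  show e: "ev_map y s = inverse (y - x) \<cdot>\<^sub>m eval_mat y (numer x s)"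
    using assms ev_map_numer[of s n x y] by (auto simp: H0_Ad_iff)
  show "ev_map y s \<in> sl n" unfolding e by (intro sl_smult H0_Ad_sl[OF assms(1)])
qed

lemma res_map_eval: "s \<in> H0_Ad n g x \<Longrightarrow> res_map x s = eval_mat x (numer x s)"
  using res_map_numer[of s n x] by (auto simp: H0_Ad_iff)

text \<open>
  The tensor in the definition of the solution exists because the inverse of the residue map is linear.
\<close>

lemma r_sol_spec:
  assumes gs: "simple_bundle n (int d) g" and d: "0 < d" "d < n" and xy: "y \<noteq> x"
  shows "r_sol n g x y \<in> sl_tensor_sl n"
    and "\<And>c. c \<in> sl n \<Longrightarrow> tensor_endo n (r_sol n g x y) c = ev_map y (inv_into (H0_Ad n g x) (res_map x) c)"
proof -
  let ?H = "H0_Ad n g x"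
  define L where "L = (\<lambda>c. ev_map y (inv_into ?H (res_map x) c))"
  have gc: "g \<in> carrier_mat n n" using gs by (auto simp: simple_bundle_def vector_bundle_def)
  have n: "0 < n" using d by simp
  have bij: "bij_betw (res_map x) ?H (sl n)" by (rule simple_residue_bij[OF gs d])
  have inv: "inv_into ?H (res_map x) c \<in> ?H" "res_map x (inv_into ?H (res_map x) c) = c" if "c \<in> sl n" for c
    using bij that by (auto simp: bij_betw_def inv_into_into f_inv_into_f)
  have Lsl: "L c \<in> sl n" if "c \<in> sl n" for c unfolding L_def by (rule ev_map_sl(2)[OF inv(1)[OF that] xy])
  have lin: "L (a + c \<cdot>\<^sub>m b) = L a + c \<cdot>\<^sub>m L b" if ab: "a \<in> sl n" "b \<in> sl n" for a b c
  proof -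
    define s1 where "s1 = inv_into ?H (res_map x) a"
    define s2 where "s2 = inv_into ?H (res_map x) b"
    have s: "s1 \<in> ?H" "s2 \<in> ?H" "res_map x s1 = a" "res_map x s2 = b"
      using inv ab by (simp_all add: s1_def s2_def)
    note l = H0_Ad_lincomb[OF s(1,2) gc, where c = c]
    have "res_map x (s1 + const_fun c \<cdot>\<^sub>m s2) = a + c \<cdot>\<^sub>m b"
      unfolding res_map_eval[OF l(1)] l(2) using s(3,4) by (simp add: res_map_eval[OF s(1)] res_map_eval[OF s(2)])
    hence "inv_into ?H (res_map x) (a + c \<cdot>\<^sub>m b) = s1 + const_fun c \<cdot>\<^sub>m s2"
      using bij_betw_imp_inj_on[OF bij] l(1) by (intro inv_into_f_eq)
    hence "L (a + c \<cdot>\<^sub>m b) = inverse (y - x) \<cdot>\<^sub>m (eval_mat y (numer x s1) + c \<cdot>\<^sub>m eval_mat y (numer x s2))"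
      unfolding L_def using ev_map_sl(1)[OF l(1) xy] l(2) by simp
    also have "\<dots> = inverse (y - x) \<cdot>\<^sub>m eval_mat y (numer x s1) + c \<cdot>\<^sub>m (inverse (y - x) \<cdot>\<^sub>m eval_mat y (numer x s2))"
      using H0_Ad_sl[OF s(1), of y] H0_Ad_sl[OF s(2), of y] by (intro eq_matI) (auto simp: sl_def algebra_simps)
    also have "\<dots> = L a + c \<cdot>\<^sub>m L b"
      unfolding L_def s1_def[symmetric] s2_def[symmetric] ev_map_sl(1)[OF s(1) xy] ev_map_sl(1)[OF s(2) xy] ..
    finally show ?thesis .
  qed
  obtain R where R: "R \<in> sl_tensor_sl n" "\<forall>c\<in>sl n. tensor_endo n R c = L c"
    using tensor_exists[OF n Lsl lin] by blast
  have "r_sol n g x y = R"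
    unfolding r_sol_def
  proof (rule the_equality)
    show "R \<in> sl_tensor_sl n \<and> (\<forall>c\<in>sl n. tensor_endo n R c = ev_map y (inv_into ?H (res_map x) c))"
      using R by (simp add: L_def)
    fix S assume S: "S \<in> sl_tensor_sl n \<and> (\<forall>c\<in>sl n. tensor_endo n S c = ev_map y (inv_into ?H (res_map x) c))"
    show "S = R" by (rule tensor_unique[OF _ R(1) n]) (use S R in \<open>auto simp: L_def\<close>)
  qed
  thus "r_sol n g x y \<in> sl_tensor_sl n" "\<And>c. c \<in> sl n \<Longrightarrow> tensor_endo n (r_sol n g x y) c = ev_map y (inv_into ?H (res_map x) c)"
    using R by (auto simp: L_def)
qed

section \<open>The gauge transformation\<close>

text \<open>
  The outer automorphism of \<open>sl\<^sub>n\<close> followed by conjugation.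
\<close>

definition neg_transpose_conj :: "complex mat \<Rightarrow> complex mat \<Rightarrow> complex mat \<Rightarrow> complex mat" where
  "neg_transpose_conj P P' a = - (P * transpose_mat a * P')"

lemma neg_transpose_conj_entry:
  assumes "P \<in> carrier_mat n n" "P' \<in> carrier_mat n n" "a \<in> carrier_mat n n" "k < n" "l < n"
  shows "neg_transpose_conj P P' a $$ (k, l) = - (\<Sum>q<n. \<Sum>p<n. P $$ (k, p) * a $$ (q, p) * P' $$ (q, l))"
proof -
  have t: "transpose_mat a \<in> carrier_mat n n" "P * transpose_mat a \<in> carrier_mat n n" using assms by auto
  have "neg_transpose_conj P P' a $$ (k, l) = - ((P * transpose_mat a * P') $$ (k, l))"
    unfolding neg_transpose_conj_def using assms t by (intro index_uminus_mat) auto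
  also have "(P * transpose_mat a * P') $$ (k, l) = (\<Sum>q<n. (P * transpose_mat a) $$ (k, q) * P' $$ (q, l))"
    by (rule mat_mult_entry[OF t(2) assms(2,4,5)])
  also have "\<dots> = (\<Sum>q<n. (\<Sum>p<n. P $$ (k, p) * a $$ (q, p)) * P' $$ (q, l))"
    using assms by (intro sum.cong refl) (subst mat_mult_entry[OF assms(1) t(1) assms(4)], auto)
  finally show ?thesis by (simp add: sum_distrib_right)
qed

lemma neg_transpose_conj_carrier:
  "P \<in> carrier_mat n n \<Longrightarrow> P' \<in> carrier_mat n n \<Longrightarrow> a \<in> carrier_mat n n \<Longrightarrow> neg_transpose_conj P P' a \<in> carrier_mat n n"
  by (auto simp: neg_transpose_conj_def)

context
  fixes P P' :: "complex mat" and n :: nat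
  assumes P: "P \<in> carrier_mat n n" "P' \<in> carrier_mat n n" "P * P' = 1\<^sub>m n" "P' * P = 1\<^sub>m n"
begin

lemma neg_transpose_conj_sl: "a \<in> sl n \<Longrightarrow> neg_transpose_conj P P' a \<in> sl n"
  using mtrace_conj[OF P(1) _ P(2,4), of "transpose_mat a"] P
  by (auto simp: sl_def neg_transpose_conj_def mtrace_uminus[of _ n] mtrace_transpose)

lemma neg_transpose_conj_inverse:
  assumes a: "a \<in> carrier_mat n n"
  shows "neg_transpose_conj P P' (neg_transpose_conj (transpose_mat P) (transpose_mat P') a) = a"
proof -
  have "transpose_mat (neg_transpose_conj (transpose_mat P) (transpose_mat P') a) = - (P' * a * P)"
  proof -
    have "transpose_mat (transpose_mat P * transpose_mat a * transpose_mat P') = P' * (a * P)"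
      using P(1,2) a by (simp add: transpose_mult[of _ n n _ n])
    also have "\<dots> = P' * a * P" using P(1,2) a by (simp add: assoc_mult_mat[of _ n n _ n _ n])
    finally show ?thesis unfolding neg_transpose_conj_def by (simp add: transpose_uminus)
  qed
  hence "neg_transpose_conj P P' (neg_transpose_conj (transpose_mat P) (transpose_mat P') a) = - (P * (- (P' * a * P)) * P')"
    by (simp add: neg_transpose_conj_def)
  also have "\<dots> = P * (P' * a * P) * P'" using P(1,2) a by simp
  also have "\<dots> = (P * P') * a * (P * P')" using P(1,2) a by (simp add: assoc_mult_mat[of _ n n _ n _ n])
  also have "\<dots> = a" using P a by simp
  finally show ?thesis .
qed

text \<open>
  The automorphism preserves the trace form: its adjoint is its inverse.
\<close>

lemma neg_transpose_conj_trace_form: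
  assumes a: "a \<in> carrier_mat n n" and c: "c \<in> carrier_mat n n"
  shows "trace_form n (neg_transpose_conj P P' a) c = trace_form n a (neg_transpose_conj (transpose_mat P) (transpose_mat P') c)"
proof -
  have "trace_form n (neg_transpose_conj P P' a) c = mtrace (neg_transpose_conj P P' a * c)"
    using a c P by (intro trace_form_mult neg_transpose_conj_carrier)
  also have "neg_transpose_conj P P' a * c = - (P * transpose_mat a * P' * c)"
    unfolding neg_transpose_conj_def using P(1,2) a c by simp
  also have "mtrace \<dots> = - mtrace (P * (transpose_mat a * (P' * c)))"
    using P(1,2) a c by (simp add: mtrace_uminus[of _ n] assoc_mult_mat[of _ n n _ n _ n])
  also have "mtrace (P * (transpose_mat a * (P' * c))) = mtrace (transpose_mat a * (P' * c) * P)"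
    using P(1,2) a c by (intro mtrace_comm) auto
  also have "transpose_mat a * (P' * c) * P = transpose_mat (transpose_mat (P' * c * P) * a)"
    using P(1,2) a c by (simp add: transpose_mult[of _ n n _ n] assoc_mult_mat[of _ n n _ n _ n])
  also have "mtrace \<dots> = mtrace (transpose_mat (P' * c * P) * a)"
    using P(1,2) a c by (intro mtrace_transpose[of _ n]) auto
  also have "\<dots> = mtrace (a * transpose_mat (P' * c * P))"
    using P(1,2) a c by (intro mtrace_comm[of _ n n]) auto
  also have "transpose_mat (P' * c * P) = transpose_mat P * transpose_mat c * transpose_mat P'"
    using P(1,2) a c by (simp add: transpose_mult[of _ n n _ n] assoc_mult_mat[of _ n n _ n _ n])
  finally have e: "trace_form n (neg_transpose_conj P P' a) c = - mtrace (a * (transpose_mat P * transpose_mat c * transpose_mat P'))" .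
  have "trace_form n a (neg_transpose_conj (transpose_mat P) (transpose_mat P') c) =
      mtrace (a * (- (transpose_mat P * transpose_mat c * transpose_mat P')))"
    unfolding neg_transpose_conj_def using P(1,2) a c by (intro trace_form_mult) auto
  also have "\<dots> = - mtrace (a * (transpose_mat P * transpose_mat c * transpose_mat P'))"
    using P(1,2) a c by (simp add: mtrace_uminus[of _ n])
  finally show ?thesis using e by simp
qed

end

lemma neg_transpose_conj_lie_aut:
  assumes P: "P \<in> carrier_mat n n" "P' \<in> carrier_mat n n" "P * P' = 1\<^sub>m n" "P' * P = 1\<^sub>m n"
  shows "lie_aut n (neg_transpose_conj P P')"
proof -
  let ?f = "neg_transpose_conj P P'" and ?t = "transpose_mat :: complex mat \<Rightarrow> complex mat"
  let ?g = "neg_transpose_conj (?t P) (?t P')"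
  have Pt: "?t P \<in> carrier_mat n n" "?t P' \<in> carrier_mat n n" "?t P * ?t P' = 1\<^sub>m n" "?t P' * ?t P = 1\<^sub>m n"
    using P(1,2) transpose_mult[OF P(1,2), symmetric] transpose_mult[OF P(2,1), symmetric] by (simp_all add: P(3,4))
  have fg: "?f (?g a) = a" if "a \<in> sl n" for a using neg_transpose_conj_inverse[OF P] that by (simp add: sl_def)
  have gf: "?g (?f a) = a" if "a \<in> sl n" for a
    using neg_transpose_conj_inverse[OF Pt, of a] that by (simp add: sl_def)
  have bij: "bij_betw ?f (sl n) (sl n)"
    using fg gf neg_transpose_conj_sl[OF P] neg_transpose_conj_sl[OF Pt]
    by (intro bij_betw_byWitness[where f' = ?g]) auto
  have add: "?f (a + b) = ?f a + ?f b" if "a \<in> carrier_mat n n" "b \<in> carrier_mat n n" for a b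
  proof -
    have "P * ?t (a + b) * P' = P * ?t a * P' + P * ?t b * P'"
      using P(1,2) that by (simp add: transpose_add[of _ n n] mult_add_distrib_mat[of _ n n _ n] add_mult_distrib_mat[of _ n n _ _ n])
    moreover have "- (X + Y) = - X + - Y" if "X \<in> carrier_mat n n" "Y \<in> carrier_mat n n" for X Y :: "complex mat"
      using that by (intro eq_matI) auto
    ultimately show ?thesis unfolding neg_transpose_conj_def using P(1,2) that by simp
  qed
  have scl: "?f (c \<cdot>\<^sub>m a) = c \<cdot>\<^sub>m ?f a" if "a \<in> carrier_mat n n" for a c
  proof -
    have "P * ?t (c \<cdot>\<^sub>m a) * P' = c \<cdot>\<^sub>m (P * ?t a * P')"
      using P(1,2) that by (simp add: transpose_smult_mat mult_smult_distrib[of _ n n _ n] mult_smult_assoc_mat[of _ n n])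
    moreover have "- (c \<cdot>\<^sub>m X) = c \<cdot>\<^sub>m (- X)" for X :: "complex mat" by (intro eq_matI) auto
    ultimately show ?thesis unfolding neg_transpose_conj_def by simp
  qed
  have brk: "?f (a * b - b * a) = ?f a * ?f b - ?f b * ?f a" if ab: "a \<in> carrier_mat n n" "b \<in> carrier_mat n n" for a b
  proof -
    have mul: "?f x * ?f y = P * (?t x * ?t y) * P'" if "x \<in> carrier_mat n n" "y \<in> carrier_mat n n" for x y
    proof -
      have "?f x * ?f y = (P * ?t x * P') * (P * ?t y * P')"
        unfolding neg_transpose_conj_def using P(1,2) that by simp
      also have "\<dots> = P * ?t x * (P' * P) * ?t y * P'" using P(1,2) that by (simp add: assoc_mult_mat[of _ n n _ n _ n])
      also have "\<dots> = P * (?t x * ?t y) * P'" unfolding P(4) using P(1,2) that by (simp add: assoc_mult_mat[of _ n n _ n _ n])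
      finally show ?thesis .
    qed
    have "?t (a * b - b * a) = ?t b * ?t a - ?t a * ?t b"
      using ab by (simp add: transpose_minus[of _ n n] transpose_mult[of _ n n _ n])
    hence "?f (a * b - b * a) = - (P * (?t b * ?t a - ?t a * ?t b) * P')" by (simp add: neg_transpose_conj_def)
    also have "P * (?t b * ?t a - ?t a * ?t b) * P' = P * (?t b * ?t a) * P' - P * (?t a * ?t b) * P'"
    proof -
      have "P * (?t b * ?t a - ?t a * ?t b) = P * (?t b * ?t a) - P * (?t a * ?t b)"
        using P ab by (intro mult_minus_distrib_mat[of _ n n _ n]) auto
      thus ?thesis using P(1,2) ab by (simp only:) (intro minus_mult_distrib_mat[of _ n n _ _ n], auto)
    qed
    also have "\<dots> = ?f b * ?f a - ?f a * ?f b" using mul ab by simp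
    also have "- \<dots> = ?f a * ?f b - ?f b * ?f a"
    proof -
      have "- (X - Y) = Y - X" if "X \<in> carrier_mat n n" "Y \<in> carrier_mat n n" for X Y :: "complex mat"
        using that by (intro eq_matI) auto
      note swap = this
      have "?f a \<in> carrier_mat n n" "?f b \<in> carrier_mat n n"
        using neg_transpose_conj_carrier[OF P(1,2)] ab by blast+
      thus ?thesis by (intro swap mult_carrier_mat)
    qed
    finally show ?thesis .
  qed
  show ?thesis
    unfolding lie_aut_def by (intro conjI ballI allI bij add scl brk) (simp_all add: sl_def)
qed

lemma H0_Ad_dual:
  assumes g: "g \<in> carrier_mat n n" "gi \<in> carrier_mat n n" "g * gi = 1\<^sub>m n" "gi * g = 1\<^sub>m n"
    and s: "s \<in> H0_Ad n g x"
  shows "- transpose_mat s \<in> H0_Ad n (dual_bundle gi) x"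
    and "eval_mat y (numer x (- transpose_mat s)) = - transpose_mat (eval_mat y (numer x s))"
proof -
  have s': "s \<in> carrier_mat n n" "mtrace s = 0" "numer x s \<in> mat_over n regular_ring"
    using s by (auto simp: H0_Ad_iff)
  obtain v where v: "v \<in> mat_over n cusp_ring" "s * g = g * v" using s by (auto simp: H0_Ad_iff)
  note vc = mat_over_carrier[OF v(1)]
  have numer: "numer x (- transpose_mat s) = - transpose_mat (numer x s)"
    using s' by (auto simp: numer_def intro!: eq_matI)
  have reg: "- transpose_mat (numer x s) \<in> mat_over n regular_ring"
    using s'(3) subring_regular by (auto simp: mat_over_def subring_set_def)
  have hc: "dual_bundle gi \<in> carrier_mat n n" using g by (simp add: dual_bundle_def)
  have "transpose_mat s * dual_bundle gi = dual_bundle gi * transpose_mat v"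
    using dual_stalk[OF g s'(1) vc] v(2) by simp
  hence "(- transpose_mat s) * dual_bundle gi = dual_bundle gi * (- transpose_mat v)"
    using s' vc hc by simp
  moreover have "- transpose_mat v \<in> mat_over n cusp_ring"
    using v(1) subring_cusp by (auto simp: mat_over_def subring_set_def)
  moreover have "mtrace (- transpose_mat s) = 0" using s' by (simp add: mtrace_uminus[of _ n] mtrace_transpose)
  ultimately show "- transpose_mat s \<in> H0_Ad n (dual_bundle gi) x"
    unfolding H0_Ad_iff numer using reg s' by auto
  show "eval_mat y (numer x (- transpose_mat s)) = - transpose_mat (eval_mat y (numer x s))"
  proof (rule eq_matI)
    fix i j assume "i < dim_row (- transpose_mat (eval_mat y (numer x s)))" "j < dim_col (- transpose_mat (eval_mat y (numer x s)))"
    hence ij: "i < n" "j < n" using s' by (auto simp: eval_mat_def numer_def)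
    have "rat_eval (- (numer x s $$ (j, i))) y = - rat_eval (numer x s $$ (j, i)) y"
      using rat_eval_hom(3)[OF mat_over_entry[OF s'(3) ij(2,1)] z_in_regular] .
    thus "eval_mat y (numer x (- transpose_mat s)) $$ (i, j) = (- transpose_mat (eval_mat y (numer x s))) $$ (i, j)"
      unfolding numer using ij mat_over_carrier[OF s'(3)] by (simp add: eval_mat_def)
  qed (use s' in \<open>auto simp: eval_mat_def numer_def\<close>)
qed

text \<open>
  If \<open>r = \<Sum> a\<^sub>\<mu> \<otimes> b\<^sub>\<mu>\<close>, then the tensor \<open>\<Sum> \<phi>(x) a\<^sub>\<mu> \<otimes> \<phi>(y) b\<^sub>\<mu>\<close> sends \<open>c\<close> to
  \<open>\<phi>(y) (ev\<^sub>y (res\<^sub>x\<^sup>-\<^sup>1 (\<phi>(x)\<^sup>-\<^sup>1 c)))\<close>, since \<open>\<phi>(x)\<close> preserves the trace form. As \<open>\<Phi>\<close> is compatible with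
  residues and values through \<open>\<phi>\<close>, this is the value at \<open>y\<close> of the section of the second bundle with residue \<open>c\<close> at \<open>x\<close>.
\<close>

lemma gauge_equivalentI:
  assumes g: "simple_bundle n (int d) g" "simple_bundle n (int d') g'" and d: "0 < d" "d < n" "0 < d'" "d' < n"
    and A: "A \<in> GL n regular_ring" "A' \<in> GL n regular_ring" "A * A' = 1\<^sub>m n" "A' * A = 1\<^sub>m n"
    and \<Phi>: "\<And>x s. s \<in> H0_Ad n g x \<Longrightarrow> \<Phi> s \<in> H0_Ad n g' x"
    and \<Phi>_eval: "\<And>x y s. s \<in> H0_Ad n g x \<Longrightarrow>
      eval_mat y (numer x (\<Phi> s)) = neg_transpose_conj (eval_mat y A) (eval_mat y A') (eval_mat y (numer x s))"
  shows "gauge_equivalent n (r_sol n g) (r_sol n g')"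
proof -
  define \<phi> where "\<phi> = (\<lambda>z. neg_transpose_conj (eval_mat z A) (eval_mat z A'))"
  have n: "0 < n" using d by simp
  have Ac: "A \<in> carrier_mat n n" "A' \<in> carrier_mat n n" using A(1,2)[THEN GL_D(2)] .
  have P: "eval_mat z A \<in> carrier_mat n n" "eval_mat z A' \<in> carrier_mat n n"
    "eval_mat z A * eval_mat z A' = 1\<^sub>m n" "eval_mat z A' * eval_mat z A = 1\<^sub>m n" for z
    using Ac eval_mat_inverse[OF A(1,2,3)] eval_mat_inverse[OF A(2,1,4)] by (auto simp: eval_mat_carrier)
  have hol: "(\<lambda>z. \<phi> z a $$ (i, j)) holomorphic_on ball 0 1" if a: "a \<in> sl n" and ij: "i < n" "j < n" for a i j
  proof -
    have ac: "a \<in> carrier_mat n n" using a by (simp add: sl_def)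
    have eq: "(\<lambda>z. \<phi> z a $$ (i, j)) = (\<lambda>z. - (\<Sum>q<n. \<Sum>p<n. rat_eval (A $$ (i, p)) z * a $$ (q, p) * rat_eval (A' $$ (q, j)) z))"
      unfolding \<phi>_def neg_transpose_conj_entry[OF P(1,2) ac ij] using Ac ij by (simp add: eval_mat_def)
    show ?thesis unfolding eq
      using mat_over_entry[OF GL_D(1)[OF A(1)]] mat_over_entry[OF GL_D(1)[OF A(2)]] ij
      by (intro holomorphic_intros eval_holomorphic) auto
  qed
  have tens: "tensor_map n (\<phi> x) (\<phi> y) (r_sol n g x y) (r_sol n g' x y)" if xy: "x \<noteq> y" for x y
  proof -
    have yx: "y \<noteq> x" using xy by simp
    note R = r_sol_spec[OF g(1) d(1,2) yx] and R' = r_sol_spec[OF g(2) d(3,4) yx]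
    obtain m a b where ab: "r_sol n g x y = tensor_sum n m a b" "\<forall>\<mu><m. a \<mu> \<in> sl n \<and> b \<mu> \<in> sl n"
      using R(1) by (auto simp: sl_tensor_sl_def)
    define S where "S = tensor_sum n m (\<lambda>\<mu>. \<phi> x (a \<mu>)) (\<lambda>\<mu>. \<phi> y (b \<mu>))"
    have \<phi>sl: "\<phi> z c \<in> sl n" if "c \<in> sl n" for z c unfolding \<phi>_def by (rule neg_transpose_conj_sl[OF P that])
    have Ssl: "S \<in> sl_tensor_sl n" unfolding S_def sl_tensor_sl_def
      using ab(2) \<phi>sl by (intro CollectI exI[of _ m] exI[of _ "\<lambda>\<mu>. \<phi> x (a \<mu>)"] exI[of _ "\<lambda>\<mu>. \<phi> y (b \<mu>)"]) auto
    have "S = r_sol n g' x y"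
    proof (rule tensor_unique[OF Ssl R'(1) n])
      fix c assume c: "c \<in> sl n"
      have cc: "c \<in> carrier_mat n n" using c by (simp add: sl_def)
      define \<psi>c where "\<psi>c = neg_transpose_conj (transpose_mat (eval_mat x A)) (transpose_mat (eval_mat x A')) c"
      have Pt: "transpose_mat (eval_mat x A) \<in> carrier_mat n n" "transpose_mat (eval_mat x A') \<in> carrier_mat n n"
        "transpose_mat (eval_mat x A) * transpose_mat (eval_mat x A') = 1\<^sub>m n"
        "transpose_mat (eval_mat x A') * transpose_mat (eval_mat x A) = 1\<^sub>m n"
        using P(1,2) transpose_mult[OF P(1,2), of x x, symmetric] transpose_mult[OF P(2,1), of x x, symmetric]
        by (simp_all add: P(3,4))
      have \<psi>: "\<psi>c \<in> sl n" unfolding \<psi>c_def by (rule neg_transpose_conj_sl[OF Pt c])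
      have \<phi>\<psi>: "\<phi> x \<psi>c = c" unfolding \<phi>_def \<psi>c_def by (rule neg_transpose_conj_inverse[OF P cc])
      have bij: "bij_betw (res_map x) (H0_Ad n g x) (sl n)" "bij_betw (res_map x) (H0_Ad n g' x) (sl n)"
        using simple_residue_bij[OF g(1) d(1,2)] simple_residue_bij[OF g(2) d(3,4)] by auto
      define s where "s = inv_into (H0_Ad n g x) (res_map x) \<psi>c"
      have s: "s \<in> H0_Ad n g x" "res_map x s = \<psi>c"
        using bij(1) \<psi> by (auto simp: s_def bij_betw_def inv_into_into f_inv_into_f)
      have "res_map x (\<Phi> s) = c"
        unfolding res_map_eval[OF \<Phi>[OF s(1)]] \<Phi>_eval[OF s(1)] using s(2) \<phi>\<psi>
        by (simp add: res_map_eval[OF s(1)] \<phi>_def)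
      hence inv': "inv_into (H0_Ad n g' x) (res_map x) c = \<Phi> s"
        using bij_betw_imp_inj_on[OF bij(2)] \<Phi>[OF s(1)] by (intro inv_into_f_eq)
      show "tensor_endo n S c = tensor_endo n (r_sol n g' x y) c"
      proof (rule eq_matI)
        fix k l assume "k < dim_row (tensor_endo n (r_sol n g' x y) c)" "l < dim_col (tensor_endo n (r_sol n g' x y) c)"
        hence kl: "k < n" "l < n" by auto
        let ?P = "eval_mat y A" and ?P' = "eval_mat y A'"
        have bc: "b \<mu> \<in> carrier_mat n n" "a \<mu> \<in> carrier_mat n n" if "\<mu> < m" for \<mu> using ab(2) that by (auto simp: sl_def)
        have lin: "neg_transpose_conj ?P ?P' (tensor_endo n (tensor_sum n m a b) \<psi>c) $$ (k, l) =
            (\<Sum>\<mu><m. trace_form n (a \<mu>) \<psi>c * neg_transpose_conj ?P ?P' (b \<mu>) $$ (k, l))"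
        proof -
          let ?t = "\<lambda>\<mu>. trace_form n (a \<mu>) \<psi>c"
          have "neg_transpose_conj ?P ?P' (tensor_endo n (tensor_sum n m a b) \<psi>c) $$ (k, l) =
            - (\<Sum>q<n. \<Sum>p<n. ?P $$ (k, p) * (\<Sum>\<mu><m. ?t \<mu> * b \<mu> $$ (q, p)) * ?P' $$ (q, l))"
            unfolding neg_transpose_conj_entry[OF P(1,2) tensor_endo_carrier(1) kl]
            by (intro arg_cong[where f = uminus] sum.cong refl) (simp add: tensor_endo_sum)
          also have "\<dots> = - (\<Sum>q<n. \<Sum>p<n. \<Sum>\<mu><m. ?t \<mu> * (?P $$ (k, p) * b \<mu> $$ (q, p) * ?P' $$ (q, l)))"
            by (simp add: sum_distrib_left sum_distrib_right mult_ac)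
          also have "\<dots> = - (\<Sum>q<n. \<Sum>\<mu><m. \<Sum>p<n. ?t \<mu> * (?P $$ (k, p) * b \<mu> $$ (q, p) * ?P' $$ (q, l)))"
            by (intro arg_cong[where f = uminus] sum.cong refl sum.swap)
          also have "\<dots> = - (\<Sum>\<mu><m. \<Sum>q<n. \<Sum>p<n. ?t \<mu> * (?P $$ (k, p) * b \<mu> $$ (q, p) * ?P' $$ (q, l)))"
            by (intro arg_cong[where f = uminus] sum.swap)
          also have "\<dots> = (\<Sum>\<mu><m. ?t \<mu> * neg_transpose_conj ?P ?P' (b \<mu>) $$ (k, l))"
            by (subst sum_negf[symmetric], intro sum.cong refl) (simp add: neg_transpose_conj_entry[OF P(1,2) bc(1) kl] sum_distrib_left)
          finally show ?thesis .
        qed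
        have tf: "trace_form n (\<phi> x (a \<mu>)) c = trace_form n (a \<mu>) \<psi>c" if "\<mu> < m" for \<mu>
          unfolding \<phi>_def \<psi>c_def by (rule neg_transpose_conj_trace_form[OF P bc(2)[OF that] cc])
        have "tensor_endo n S c $$ (k, l) = (\<Sum>\<mu><m. trace_form n (\<phi> x (a \<mu>)) c * \<phi> y (b \<mu>) $$ (k, l))"
          unfolding S_def by (rule tensor_endo_sum[OF kl])
        also have "\<dots> = (\<Sum>\<mu><m. trace_form n (a \<mu>) \<psi>c * \<phi> y (b \<mu>) $$ (k, l))"
          by (intro sum.cong refl) (simp add: tf)
        also have "\<dots> = \<phi> y (tensor_endo n (tensor_sum n m a b) \<psi>c) $$ (k, l)"
          unfolding \<phi>_def by (rule lin[symmetric])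
        also have "tensor_endo n (tensor_sum n m a b) \<psi>c = ev_map y s"
          using R(2)[OF \<psi>] unfolding ab(1) s_def .
        also have "\<phi> y (ev_map y s) = ev_map y (\<Phi> s)"
        proof -
          have "\<phi> y (ev_map y s) = inverse (y - x) \<cdot>\<^sub>m \<phi> y (eval_mat y (numer x s))"
            unfolding ev_map_sl(1)[OF s(1) yx] \<phi>_def
            using neg_transpose_conj_lie_aut[OF P, of y] H0_Ad_sl[OF s(1), of y] unfolding lie_aut_def by blast
          also have "\<dots> = ev_map y (\<Phi> s)"
            unfolding ev_map_sl(1)[OF \<Phi>[OF s(1)] yx] \<Phi>_eval[OF s(1)] \<phi>_def ..
          finally show ?thesis .
        qed
        also have "ev_map y (\<Phi> s) = tensor_endo n (r_sol n g' x y) c"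
          using R'(2)[OF c] unfolding inv' by simp
        finally show "tensor_endo n S c $$ (k, l) = tensor_endo n (r_sol n g' x y) c $$ (k, l)" .
      qed auto
    qed
    thus ?thesis unfolding tensor_map_def using ab unfolding S_def
      by (intro exI[of _ m] exI[of _ a] exI[of _ b]) auto
  qed
  show ?thesis unfolding gauge_equivalent_def
  proof (intro exI[of _ 1] conjI exI[of _ \<phi>] ballI allI impI)
    show "lie_aut n (\<phi> z)" for z unfolding \<phi>_def by (rule neg_transpose_conj_lie_aut[OF P])
    show "(\<lambda>z. \<phi> z a $$ (i, j)) holomorphic_on ball 0 1" if "a \<in> sl n" "i < n" "j < n" for a i j
      by (rule hol[OF that])
    show "tensor_map n (\<phi> x) (\<phi> y) (r_sol n g x y) (r_sol n g' x y)" if "x \<noteq> y" for x y by (rule tens[OF that])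
  qed simp
qed

theorem proposition9p11:
  fixes n d e :: nat
  assumes "0 < d" and "d < n" and "coprime n d" and "e = n - d"
    and "r \<in> r_solutions n d" and "r' \<in> r_solutions n e"
  shows "gauge_equivalent n r r'"
proof -
  obtain g g' where g: "r = r_sol n g" "simple_bundle n (int d) g"
    and g': "r' = r_sol n g'" "simple_bundle n (int e) g'"
    using assms(5,6) by (auto simp: r_solutions_def)
  have e: "0 < e" "e < n" using assms by auto
  have gc: "g \<in> carrier_mat n n" "det g \<noteq> 0" "g' \<in> carrier_mat n n"
    using g g' by (auto simp: simple_bundle_def vector_bundle_def)
  obtain gi where gi: "gi \<in> carrier_mat n n" "gi * g = 1\<^sub>m n" "g * gi = 1\<^sub>m n"
    using det_nonzero_inverse[OF gc(1,2)] by blast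
  let ?h = "dual_bundle gi"
  have hc: "?h \<in> carrier_mat n n" using gi by (simp add: dual_bundle_def)
  have "simple_bundle n (int e) ?h"
    unfolding assms(4) using assms(2) by (intro dual_simple[OF g(2)] gi) auto
  hence "twist_equivalent n ?h g'" by (rule simple_bundles_twist_equivalent[OF _ g'(2) e])
  then obtain A C \<mu> where A: "A \<in> GL n regular_ring" "C \<in> GL n cusp_ring" "\<mu> \<noteq> 0" "A * ?h = \<mu> \<cdot>\<^sub>m (g' * C)"
    unfolding twist_equivalent_def by (elim bexE exE conjE)
  obtain A' where A': "A' \<in> GL n regular_ring" "A * A' = 1\<^sub>m n" "A' * A = 1\<^sub>m n" using A(1) by (rule GL_inverse)
  have Ac: "A \<in> carrier_mat n n" "A' \<in> carrier_mat n n" using GL_D(2)[OF A(1)] GL_D(2)[OF A'(1)] .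
  define \<Phi> where "\<Phi> = (\<lambda>s. A * (- transpose_mat s) * A')"
  show ?thesis unfolding g(1) g'(1)
  proof (rule gauge_equivalentI[OF g(2) g'(2) assms(1,2) e A(1) A'])
    fix x s assume s: "s \<in> H0_Ad n g x"
    note dual = H0_Ad_dual[OF gc(1) gi(1,3,2) s]
    note conj = H0_Ad_conj[OF A(1) A' A(2,3,4) hc gc(3) dual(1)]
    show "\<Phi> s \<in> H0_Ad n g' x" unfolding \<Phi>_def by (rule conj(1))
    fix y
    have ec: "eval_mat y (numer x s) \<in> carrier_mat n n" using H0_Ad_sl[OF s] by (simp add: sl_def)
    show "eval_mat y (numer x (\<Phi> s)) = neg_transpose_conj (eval_mat y A) (eval_mat y A') (eval_mat y (numer x s))"
      unfolding \<Phi>_def conj(2) dual(2) neg_transpose_conj_def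
      using Ac[THEN eval_mat_carrier, of y] ec by simp
  qed
qed

end
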